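(* Let $\mu,\nu$ be compactly supported Borel measures on $\mathbb{R}^3$ with $\mu(B(x,r))\le C_1r^{s_\mu}$ and $\nu(B(x,r))\le C_1r^{s_\nu}$ for all $x\in\mathbb{R}^3$, $r>0$, for some $s_\mu,s_\nu\in(0,3]$. For $f\in L^p(\mu)$ let $u$ be the solution of the initial value problem $$\Delta u=\frac{\partial^2u}{\partial t^2},\qquad u(x,0)=0,\qquad \frac{\partial u}{\partial t}(x,0)=f\mu(x),\qquad x\in\mathbb{R}^3 .$$ Then for every $t>0$ there exists $C=C(t)>0$ such that: $\bullet$ $\|u(\cdot,t)\|_{L^2(\nu)}\le C\|f\|_{L^2(\mu)}$ for all $f\in L^2(\mu)$, if $s_\mu+s_\nu>4$; $\bullet$ when $2\le p<\infty$, $\|u(\cdot,t)\|_{L^p(\nu)}\le C\|f\|_{L^p(\mu)}$ for all $f\in L^p(\mu)$, if $\dfrac{s_\mu}{p'}+\dfrac{s_\nu}{p}>3-\dfrac2p$; $\bullet$ when $1\le p\le2$, $\|u(\cdot,t)\|_{L^p(\nu)}\le C\|f\|_{L^p(\mu)}$ for all $f\in L^p(\mu)$, if $\dfrac{s_\mu}{p'}+\dfrac{s_\nu}{p}>1+\dfrac2p$. Here $C$ may depend on $t,p,\mu,\nu$ but not on $f$.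
   Context: $\frac1p+\frac1{p'}=1$. $f\mu$ is the measure with density $f$ with respect to $\mu$. The solution is given by $u(\cdot,t)=c\,t\,\sigma_t*(f\mu)$, where $c$ is an absolute constant, $\sigma$ is surface measure on the unit sphere $S^2\subset\mathbb{R}^3$ and $\sigma_t$ is its push-forward under $y\mapsto ty$. Since $u(\cdot,t)$ is a priori only a measure, the bounds are understood as follows: for a fixed nonnegative radial $\rho\in C_0^\infty(\mathbb{R}^3)$ with $\int\rho=1$ and $\rho_\epsilon(x)=\epsilon^{-3}\rho(x/\epsilon)$, one has $\|\rho_\epsilon*u(\cdot,t)\|_{L^p(\nu)}\le C\|f\|_{L^p(\mu)}$ with $C$ independent of $\epsilon\in(0,1)$ and $f$. *)

theory Defs
  imports "HOL-Analysis.Analysis"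
begin

text \<open>Surface measure on the unit sphere of \<open>\<real>\<^sup>3\<close>, normalised by polar coordinates:
  \<open>\<sigma>(A) = 3 \<cdot> \<lambda>({x. norm x < 1 \<and> x / norm x \<in> A})\<close>, so that its total mass is \<open>4 \<pi>\<close>.
  (\<open>sgn x\<close> is \<open>x / norm x\<close>, and \<open>sgn 0 = 0\<close> only matters on a null set.)\<close>

definition sphere_measure :: "(real ^ 3) measure" where
  "sphere_measure = distr (density lborel (\<lambda>x. 3 * indicator (ball 0 1) x)) borel sgn"

definition sphere_measure_dil :: "real \<Rightarrow> (real ^ 3) measure" where
  "sphere_measure_dil t = distr sphere_measure borel (\<lambda>y. t *\<^sub>R y)"

text \<open>A finite complex measure is represented by its action on (bounded continuous) test
  functions: \<open>T \<phi> = \<integral>\<phi> dT\<close>.\<close>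

type_synonym complex_measure = "(real ^ 3 \<Rightarrow> complex) \<Rightarrow> complex"

definition density_cmeasure ::
    "(real ^ 3 \<Rightarrow> complex) \<Rightarrow> (real ^ 3) measure \<Rightarrow> complex_measure" where
  "density_cmeasure f \<mu> \<phi> = (LINT y|\<mu>. \<phi> y * f y)"

text \<open>The convolution \<open>\<tau> * T\<close>: \<open>\<integral>\<phi> d(\<tau> * T) = \<integral>\<integral>\<phi>(y + z) d\<tau>(z) dT(y)\<close>.\<close>

definition conv_cmeasure :: "(real ^ 3) measure \<Rightarrow> complex_measure \<Rightarrow> complex_measure" where
  "conv_cmeasure \<tau> T \<phi> = T (\<lambda>y. LINT z|\<tau>. \<phi> (y + z))"

text \<open>The solution at time \<open>t\<close> of the wave equation with initial position \<open>0\<close> and initial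
  velocity \<open>f\<mu>\<close>, by Kirchhoff's formula \<open>u(\<cdot>,t) = t / (4 \<pi>) \<sigma>\<^sub>t * (f\<mu>)\<close>.\<close>

definition wave_solution ::
    "(real ^ 3) measure \<Rightarrow> (real ^ 3 \<Rightarrow> complex) \<Rightarrow> real \<Rightarrow> complex_measure" where
  "wave_solution \<mu> f t \<phi> =
     of_real (1 / (4 * pi) * t) * conv_cmeasure (sphere_measure_dil t) (density_cmeasure f \<mu>) \<phi>"

text \<open>\<open>\<rho>\<^sub>\<epsilon>\<close>, and the function \<open>\<rho> * T\<close>, \<open>x \<mapsto> \<integral>\<rho>(x - y) dT(y)\<close>.\<close>

definition rescale :: "(real ^ 3 \<Rightarrow> real) \<Rightarrow> real \<Rightarrow> real ^ 3 \<Rightarrow> real" where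
  "rescale \<rho> \<epsilon> x = \<rho> (x /\<^sub>R \<epsilon>) / \<epsilon> ^ 3"

definition mollify :: "(real ^ 3 \<Rightarrow> real) \<Rightarrow> complex_measure \<Rightarrow> real ^ 3 \<Rightarrow> complex" where
  "mollify \<rho> T x = T (\<lambda>y. of_real (\<rho> (x - y)))"

primrec Ck :: "nat \<Rightarrow> (real ^ 'n \<Rightarrow> real) \<Rightarrow> bool" where
  "Ck 0 g \<longleftrightarrow> continuous_on UNIV g"
| "Ck (Suc k) g \<longleftrightarrow> (\<forall>x. g differentiable (at x)) \<and>
     (\<forall>i. Ck k (\<lambda>x. frechet_derivative g (at x) (axis i 1)))"

definition radial_mollifier :: "(real ^ 3 \<Rightarrow> real) \<Rightarrow> bool" where
  "radial_mollifier \<rho> \<longleftrightarrow>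
     (\<forall>k. Ck k \<rho>) \<and> compact (closure {x. \<rho> x \<noteq> 0}) \<and> (\<forall>x. 0 \<le> \<rho> x) \<and>
     (\<forall>x y. norm x = norm y \<longrightarrow> \<rho> x = \<rho> y) \<and> (LINT x|lborel. \<rho> x) = 1"

definition in_Lp :: "real \<Rightarrow> 'a measure \<Rightarrow> ('a \<Rightarrow> complex) \<Rightarrow> bool" where
  "in_Lp p M f \<longleftrightarrow> f \<in> borel_measurable M \<and> integrable M (\<lambda>x. norm (f x) powr p)"

definition Lp_norm :: "real \<Rightarrow> 'a measure \<Rightarrow> ('a \<Rightarrow> complex) \<Rightarrow> real" where
  "Lp_norm p M f = (LINT x|M. norm (f x) powr p) powr (1 / p)"

text \<open>\<open>1 / p'\<close> for the exponent \<open>p'\<close> conjugate to \<open>p\<close>, i.e. \<open>1 / p + 1 / p' = 1\<close>; the value is \<open>0\<close>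
  for \<open>p = 1\<close>, \<open>p' = \<infinity>\<close>.\<close>

definition conj_recip :: "real \<Rightarrow> real" where
  "conj_recip p = 1 - 1 / p"

definition compactly_supported_borel :: "(real ^ 3) measure \<Rightarrow> bool" where
  "compactly_supported_borel M \<longleftrightarrow>
     sets M = sets borel \<and> (\<exists>K. compact K \<and> emeasure M (- K) = 0)"

text \<open>The estimate \<open>\<parallel>u(\<cdot>,t)\<parallel> \<le> C \<parallel>f\<parallel>\<close> from \<open>L\<^sup>p(\<mu>)\<close> to \<open>L\<^sup>p(\<nu>)\<close>, understood uniformly over the
  mollifications \<open>\<rho>\<^sub>\<epsilon> * u(\<cdot>,t)\<close>. Membership in \<open>L\<^sup>p(\<nu>)\<close> is part of the claim because
  \<open>Lp_norm\<close> is \<open>0\<close> on non-integrable functions.\<close>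

definition wave_Lp_bound ::
    "(real ^ 3 \<Rightarrow> real) \<Rightarrow> (real ^ 3) measure \<Rightarrow> (real ^ 3) measure \<Rightarrow> real \<Rightarrow> real \<Rightarrow> real \<Rightarrow> bool"
  where
  "wave_Lp_bound \<rho> \<mu> \<nu> t p C \<longleftrightarrow>
     (\<forall>f \<epsilon>. in_Lp p \<mu> f \<and> 0 < \<epsilon> \<and> \<epsilon> < 1 \<longrightarrow>
        in_Lp p \<nu> (mollify (rescale \<rho> \<epsilon>) (wave_solution \<mu> f t)) \<and>
        Lp_norm p \<nu> (mollify (rescale \<rho> \<epsilon>) (wave_solution \<mu> f t)) \<le> C * Lp_norm p \<mu> f)"

end

theory Submission
  imports Defs "HOL-Probability.Characteristic_Functions"
begin

text \<open>The solution operator has a nonnegative kernel, so \<open>f\<close> may be replaced by \<open>\<bar>f\<bar>\<close> and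
  \<open>\<rho>\<^sub>\<epsilon>\<close> by a multiple of a Gaussian \<open>heat \<delta>\<close> with \<open>\<delta> = 2\<^sup>-\<^sup>n\<close> comparable to \<open>\<epsilon>\<close>. The kernel
  \<open>heat \<delta> * \<sigma>\<^sub>t\<close> is a telescoping sum of pieces at the scales \<open>\<delta>\<^sub>i = 2\<^sup>-\<^sup>i\<close>. On one piece,
  \<open>\<bar>\<sigma>\<^sub>t\<^sup>^(\<xi>)\<bar> \<le> c / \<bar>\<xi>\<bar>\<close> and the growth conditions give an \<open>L\<^sup>2(\<mu>) \<rightarrow> L\<^sup>2(\<nu>)\<close> norm of order
  \<open>\<delta>\<^sub>i\<close> to the power \<open>(s\<^sub>\<mu> + s\<^sub>\<nu>) / 2 - 2\<close>, while the growth of \<open>\<mu>\<close> alone gives an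
  \<open>L\<^sup>\<infinity>\<close> norm of order \<open>\<delta>\<^sub>i\<close> to the power \<open>s\<^sub>\<mu> - 3\<close>. Interpolation makes the pieces summable
  in the stated range for \<open>p \<ge> 2\<close>. The range \<open>1 < p \<le> 2\<close> is dual to it (with \<open>\<mu>\<close> and \<open>\<nu>\<close>
  exchanged), and at \<open>p = 1\<close> the condition would force \<open>s\<^sub>\<nu> > 3\<close>.\<close>

section \<open>Decay of the Fourier transform of the sphere\<close>

text \<open>The pieces change sign, so positivity has to be spent before the decomposition:
  \<open>f\<close> and the mollifier are dominated first, at one dyadic scale, and only then is the
  kernel split into signed parts. Gaussians serve as cut-offs because their transforms are explicit,
  positive and integrable. Fubini then gives a Parseval identity for measures without any inversion
  theorem, and a Gaussian energy becomes a quadratic form with kernel \<open>heat\<close>, which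
  Schur's test bounds by a multiple of \<delta>^(s - 3) for a measure of growth exponent s. A piece
  has a multiplier of size \<delta> and is paired with one energy for each measure, so its squared
  norm is of order \<delta>^2 \<delta>^(a - 3) \<delta>^(b - 3), where a and b are the exponents of
  \<mu> and \<nu>. The supremum bound sees only \<mu>, which is why the two exponents enter
  asymmetrically when p is not 2. All norm inequalities are kept in the form of p-th powers of
  nonnegative functions. Absorbing a term into the left-hand side requires it to be finite; this
  comes from crude bounds on the smoothed kernels, which do not enter the final constants.\<close>

text \<open>A bound \<open>B\<close> on the second derivative, valid for almost every \<omega>,
  makes the first-order Taylor error at most \<open>B * h\<^sup>2\<close> uniformly in \<omega>.
  Integrated over a finite measure and divided by h, it tends to 0.\<close>

lemma DERIV_integral_bounded_second_derivative:
  fixes \<phi> \<phi>' \<phi>'' :: "real \<Rightarrow> 'a \<Rightarrow> real"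
  assumes "finite_measure M" and "\<And>\<theta>. integrable M (\<phi> \<theta>)" "integrable M (\<phi>' \<theta>\<^sub>0)"
    and ae: "AE \<omega> in M. \<forall>\<theta>. ((\<lambda>\<theta>. \<phi> \<theta> \<omega>) has_real_derivative \<phi>' \<theta> \<omega>) (at \<theta>) \<and>
       ((\<lambda>\<theta>. \<phi>' \<theta> \<omega>) has_real_derivative \<phi>'' \<theta> \<omega>) (at \<theta>) \<and> \<bar>\<phi>'' \<theta> \<omega>\<bar> \<le> B"
  shows "((\<lambda>\<theta>. \<integral>\<omega>. \<phi> \<theta> \<omega> \<partial>M) has_real_derivative (\<integral>\<omega>. \<phi>' \<theta>\<^sub>0 \<omega> \<partial>M)) (at \<theta>\<^sub>0)"
proof -
  interpret finite_measure M by fact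
  have taylor: "AE \<omega> in M. \<bar>\<phi> (\<theta>\<^sub>0 + h) \<omega> - \<phi> \<theta>\<^sub>0 \<omega> - h * \<phi>' \<theta>\<^sub>0 \<omega>\<bar> \<le> B * h\<^sup>2" for h
    using ae
  proof eventually_elim
    case (elim \<omega>)
    have lip: "\<bar>\<phi>' \<theta> \<omega> - \<phi>' \<theta>\<^sub>0 \<omega>\<bar> \<le> B * \<bar>\<theta> - \<theta>\<^sub>0\<bar>" for \<theta>
      using field_differentiable_bound[of UNIV "\<lambda>\<theta>. \<phi>' \<theta> \<omega>" "\<lambda>\<theta>. \<phi>'' \<theta> \<omega>" B \<theta> \<theta>\<^sub>0] elim by auto
    have "\<bar>\<phi>'' 0 \<omega>\<bar> \<le> B" using elim by blast
    then have B0: "0 \<le> B" by linarith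
    \<comment> \<open>Mean value inequality for \<phi> minus its linear part: the derivative of the
      difference is at most B|h| on the ball of radius |h|. This costs only the factor 1/2 of
      Taylor's formula.\<close>
    have "norm ((\<phi> (\<theta>\<^sub>0 + h) \<omega> - (\<theta>\<^sub>0 + h) * \<phi>' \<theta>\<^sub>0 \<omega>) - (\<phi> \<theta>\<^sub>0 \<omega> - \<theta>\<^sub>0 * \<phi>' \<theta>\<^sub>0 \<omega>))
       \<le> (B * \<bar>h\<bar>) * norm ((\<theta>\<^sub>0 + h) - \<theta>\<^sub>0)"
    proof (rule field_differentiable_bound[where S = "cball \<theta>\<^sub>0 \<bar>h\<bar>"])
      fix z assume z: "z \<in> cball \<theta>\<^sub>0 \<bar>h\<bar>"
      show "((\<lambda>\<theta>. \<phi> \<theta> \<omega> - \<theta> * \<phi>' \<theta>\<^sub>0 \<omega>) has_field_derivative (\<phi>' z \<omega> - \<phi>' \<theta>\<^sub>0 \<omega>)) (at z within cball \<theta>\<^sub>0 \<bar>h\<bar>)"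
      proof (rule has_field_derivative_at_within)
        have "((\<lambda>\<theta>. \<phi> \<theta> \<omega>) has_real_derivative \<phi>' z \<omega>) (at z)" using elim by blast
        then show "((\<lambda>\<theta>. \<phi> \<theta> \<omega> - \<theta> * \<phi>' \<theta>\<^sub>0 \<omega>) has_field_derivative (\<phi>' z \<omega> - \<phi>' \<theta>\<^sub>0 \<omega>)) (at z)"
          by (auto intro!: derivative_eq_intros)
      qed
      have "B * \<bar>z - \<theta>\<^sub>0\<bar> \<le> B * \<bar>h\<bar>"
        using z B0 by (intro mult_left_mono) (auto simp: dist_real_def)
      then show "norm (\<phi>' z \<omega> - \<phi>' \<theta>\<^sub>0 \<omega>) \<le> B * \<bar>h\<bar>" using lip[of z] by simp
    qed (auto simp: dist_real_def)
    then show ?case by (simp add: algebra_simps power2_eq_square)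
  qed
  let ?I = "\<lambda>\<theta>. \<integral>\<omega>. \<phi> \<theta> \<omega> \<partial>M" and ?D = "\<integral>\<omega>. \<phi>' \<theta>\<^sub>0 \<omega> \<partial>M" and ?m = "measure M (space M)"
  have est: "\<bar>?I (\<theta>\<^sub>0 + h) - ?I \<theta>\<^sub>0 - h * ?D\<bar> \<le> B * h\<^sup>2 * ?m" for h
  proof -
    have "?I (\<theta>\<^sub>0 + h) - ?I \<theta>\<^sub>0 - h * ?D = (\<integral>\<omega>. \<phi> (\<theta>\<^sub>0 + h) \<omega> - \<phi> \<theta>\<^sub>0 \<omega> - h * \<phi>' \<theta>\<^sub>0 \<omega> \<partial>M)"
      using assms(2,3) by simp
    also have "\<bar>\<dots>\<bar> \<le> (\<integral>\<omega>. \<bar>\<phi> (\<theta>\<^sub>0 + h) \<omega> - \<phi> \<theta>\<^sub>0 \<omega> - h * \<phi>' \<theta>\<^sub>0 \<omega>\<bar> \<partial>M)" by (rule integral_abs_bound)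
    also have "\<dots> \<le> (\<integral>\<omega>. B * h\<^sup>2 \<partial>M)"
      using assms(2,3) taylor[of h] by (intro integral_mono_AE) auto
    finally show ?thesis by (simp add: mult_ac)
  qed
  have "((\<lambda>h. (?I (\<theta>\<^sub>0 + h) - ?I \<theta>\<^sub>0) / h - ?D) \<longlongrightarrow> 0) (at 0)"
  proof (rule Lim_null_comparison[where g = "\<lambda>h. B * \<bar>h\<bar> * ?m"])
    show "\<forall>\<^sub>F h in at 0. norm ((?I (\<theta>\<^sub>0 + h) - ?I \<theta>\<^sub>0) / h - ?D) \<le> B * \<bar>h\<bar> * ?m"
      unfolding eventually_at_filter
    proof (rule always_eventually, intro allI impI)
      fix h :: real assume h: "h \<noteq> 0"
      have "norm ((?I (\<theta>\<^sub>0 + h) - ?I \<theta>\<^sub>0) / h - ?D) = \<bar>?I (\<theta>\<^sub>0 + h) - ?I \<theta>\<^sub>0 - h * ?D\<bar> / \<bar>h\<bar>"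
      proof -
        have "(?I (\<theta>\<^sub>0 + h) - ?I \<theta>\<^sub>0) / h - ?D = (?I (\<theta>\<^sub>0 + h) - ?I \<theta>\<^sub>0 - h * ?D) / h"
          using h by (simp add: diff_divide_distrib)
        then show ?thesis by (simp only: real_norm_def abs_divide)
      qed
      also have "\<dots> \<le> (B * h\<^sup>2 * ?m) / \<bar>h\<bar>" using est[of h] by (intro divide_right_mono) auto
      also have "h\<^sup>2 = \<bar>h\<bar> * \<bar>h\<bar>" by (simp add: power2_eq_square)
      also have "B * (\<bar>h\<bar> * \<bar>h\<bar>) * ?m / \<bar>h\<bar> = B * \<bar>h\<bar> * ?m"
        using h by (simp del: abs_mult_self_eq)
      finally show "norm ((?I (\<theta>\<^sub>0 + h) - ?I \<theta>\<^sub>0) / h - ?D) \<le> B * \<bar>h\<bar> * ?m" .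
    qed
    show "((\<lambda>h. B * \<bar>h\<bar> * ?m) \<longlongrightarrow> 0) (at 0)" by (auto intro!: tendsto_eq_intros)
  qed
  then show ?thesis unfolding DERIV_def by (rule LIM_zero_cancel)
qed

section \<open>Rotation invariance of Lebesgue measure and of the surface measure\<close>

lemma orthogonal_transformation_borel_measurable:
  fixes Q :: "'a::euclidean_space \<Rightarrow> 'a"
  assumes "orthogonal_transformation Q"
  shows "Q \<in> borel_measurable borel"
  using orthogonal_transformation_linear[OF assms]
  by (intro borel_measurable_continuous_onI linear_continuous_on)
    (simp only: linear_conv_bounded_linear)

text \<open>Open boxes determine \<open>lborel\<close>, and the preimage of a box under
  \<open>Q\<close> is its image under the orthogonal map \<open>inv Q\<close>, which preserves
  Lebesgue measure.\<close>

lemma lborel_distr_orthogonal: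
  fixes Q :: "real ^ 3 \<Rightarrow> real ^ 3"
  assumes Q: "orthogonal_transformation Q"
  shows "distr lborel borel Q = lborel"
proof (rule lborel_eqI[symmetric])
  have [measurable]: "Q \<in> borel_measurable borel"
    by (rule orthogonal_transformation_borel_measurable[OF Q])
  fix l u :: "real ^ 3" assume lu: "\<And>b. b \<in> Basis \<Longrightarrow> l \<bullet> b \<le> u \<bullet> b"
  have R: "orthogonal_transformation (inv Q)" and bij: "bij Q"
    using Q by (simp_all add: orthogonal_transformation_inv orthogonal_transformation_bij)
  have im: "Q -` box l u = inv Q ` box l u" by (rule bij_vimage_eq_inv_image[OF bij])
  have m: "inv Q ` box l u \<in> lmeasurable" "measure lebesgue (inv Q ` box l u) = measure lebesgue (box l u)"
    by (rule measurable_orthogonal_image[OF R] measure_orthogonal_image[OF R]; simp)+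
  have bor: "Q -` box l u \<in> sets borel"
    using measurable_sets[of Q borel borel "box l u"] by simp
  have "emeasure (distr lborel borel Q) (box l u) = emeasure lborel (Q -` box l u)"
    by (subst emeasure_distr) auto
  also have "\<dots> = emeasure lebesgue (Q -` box l u)"
    using bor by simp
  also have "\<dots> = ennreal (measure lebesgue (inv Q ` box l u))"
    unfolding im using m(1) by (simp add: emeasure_eq_measure2)
  also have "\<dots> = emeasure lebesgue (box l u)"
    unfolding m(2) by (subst emeasure_eq_measure2) auto
  also have "\<dots> = ennreal (\<Prod>b\<in>Basis. (u - l) \<bullet> b)" using lu by simp
  finally show "emeasure (distr lborel borel Q) (box l u) = ennreal (\<Prod>b\<in>Basis. (u - l) \<bullet> b)" .
qed simp

lemma sets_sphere_measure[simp, measurable_cong]: "sets sphere_measure = sets borel"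
  and space_sphere_measure[simp]: "space sphere_measure = UNIV"
  by (simp_all add: sphere_measure_def)

lemma sgn_borel_measurable_euclidean[measurable]: "(sgn :: 'a::euclidean_space \<Rightarrow> 'a) \<in> borel_measurable borel"
  unfolding sgn_div_norm by measurable

lemma borel_measurable_sphere_density[measurable]:
  "(\<lambda>x :: real ^ 3. 3 * indicator (ball 0 1) x :: ennreal) \<in> borel_measurable borel"
  by (intro borel_measurable_times_ennreal borel_measurable_const borel_measurable_indicator) auto

lemma emeasure_sphere_measure:
  assumes A[measurable]: "A \<in> sets borel"
  shows "emeasure sphere_measure A = (\<integral>\<^sup>+x. 3 * indicator (ball 0 1) x * indicator A (sgn x) \<partial>lborel)"
proof -
  have "emeasure sphere_measure A = emeasure (density lborel (\<lambda>x. 3 * indicator (ball 0 1) x)) (sgn -` A)"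
    unfolding sphere_measure_def by (subst emeasure_distr) auto
  also have "\<dots> = (\<integral>\<^sup>+x. 3 * indicator (ball 0 1) x * indicator (sgn -` A) x \<partial>lborel)"
    using measurable_sets[OF sgn_borel_measurable_euclidean A] by (subst emeasure_density) auto
  finally show ?thesis by (simp add: indicator_def)
qed

lemma finite_measure_sphere_measure: "finite_measure sphere_measure"
proof
  have "emeasure sphere_measure UNIV = 3 * emeasure lborel (ball (0::real^3) 1)"
    by (simp add: emeasure_sphere_measure nn_integral_cmult_indicator)
  also have "\<dots> < \<infinity>" using emeasure_lborel_ball_finite[of "0::real^3" 1]
    by (simp add: ennreal_mult_less_top)
  finally show "emeasure sphere_measure (space sphere_measure) \<noteq> \<infinity>" by simp
qed

lemma AE_sphere_measure_norm: "AE \<omega> in sphere_measure. norm \<omega> = 1"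
proof -
  have "AE x in lborel. x \<noteq> (0::real^3)" by (rule AE_lborel_singleton)
  then have "AE x in density lborel (\<lambda>x. 3 * indicator (ball 0 1) x). norm (sgn (x::real^3)) = 1"
    by (subst AE_density) (auto simp: norm_sgn)
  then show ?thesis unfolding sphere_measure_def
    by (subst AE_distr_iff) auto
qed

text \<open>In polar coordinates everything commutes with \<open>Q\<close>: it preserves the unit
  ball and Lebesgue measure, and \<open>sgn (Q x) = Q (sgn x)\<close>.\<close>

lemma sphere_measure_orthogonal:
  assumes Q: "orthogonal_transformation Q"
  shows "distr sphere_measure borel Q = sphere_measure"
proof (rule measure_eqI)
  have [measurable]: "Q \<in> borel_measurable borel"
    by (rule orthogonal_transformation_borel_measurable[OF Q])
  fix A assume "A \<in> sets (distr sphere_measure borel Q)"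
  then have A[measurable]: "A \<in> sets borel" by simp
  have QA: "Q -` A \<in> sets borel" using measurable_sets[of Q borel borel A] by simp
  have sgnQ: "Q (sgn x) = sgn (Q x)" for x
    using Q by (simp add: sgn_div_norm orthogonal_transformation_norm linear_cmul orthogonal_transformation_linear)
  have "emeasure (distr sphere_measure borel Q) A = emeasure sphere_measure (Q -` A)"
    by (subst emeasure_distr) auto
  also have "\<dots> = (\<integral>\<^sup>+x. 3 * indicator (ball 0 1) x * indicator (Q -` A) (sgn x) \<partial>lborel)"
    by (rule emeasure_sphere_measure[OF QA])
  also have "\<dots> = (\<integral>\<^sup>+x. 3 * indicator (ball 0 1) (Q x) * indicator A (sgn (Q x)) \<partial>lborel)"
    using Q by (simp add: indicator_def sgnQ orthogonal_transformation_norm)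
  also have "\<dots> = (\<integral>\<^sup>+x. 3 * indicator (ball 0 1) x * indicator A (sgn x) \<partial>distr lborel borel Q)"
    by (subst nn_integral_distr) auto
  also have "\<dots> = emeasure sphere_measure A"
    using lborel_distr_orthogonal[OF Q] by (simp add: emeasure_sphere_measure)
  finally show "emeasure (distr sphere_measure borel Q) A = emeasure sphere_measure A" .
qed simp

lemma integral_sphere_measure_orthogonal:
  fixes h :: "real ^ 3 \<Rightarrow> real"
  assumes Q: "orthogonal_transformation Q" and [measurable]: "h \<in> borel_measurable borel"
  shows "(\<integral>\<omega>. h (Q \<omega>) \<partial>sphere_measure) = (\<integral>\<omega>. h \<omega> \<partial>sphere_measure)"
proof -
  have [measurable]: "Q \<in> borel_measurable borel"
    by (rule orthogonal_transformation_borel_measurable[OF Q])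
  show ?thesis
    by (subst (2) sphere_measure_orthogonal[OF Q, symmetric]) (simp add: integral_distr)
qed

lemma norm_real3_sq: "(norm (v :: real ^ 3))\<^sup>2 = (v $ 1)\<^sup>2 + (v $ 2)\<^sup>2 + (v $ 3)\<^sup>2"
  by (simp add: norm_vec_def L2_set_def sum_3)

text \<open>A one-parameter group through the identity; differentiating an invariant integral along
  it gives an integration by parts on the sphere.\<close>

lemma orthogonal_transformation_rotation12:
  "orthogonal_transformation (\<lambda>v :: real ^ 3. (\<chi> i. if i = 1 then cos \<theta> * v $ 1 - sin \<theta> * v $ 2
      else if i = 2 then cos \<theta> * v $ 2 + sin \<theta> * v $ 1 else v $ 3 ) :: real ^ 3)"
  (is "orthogonal_transformation ?R")
proof -
  have "linear ?R" by (rule linearI) (auto simp: vec_eq_iff algebra_simps)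
  moreover have "norm (?R v) = norm v" for v
  proof -
    have ne: "(3::3) \<noteq> 1" "(3::3) \<noteq> 2" by auto
    have "(cos \<theta> * a - sin \<theta> * b)\<^sup>2 + (cos \<theta> * b + sin \<theta> * a)\<^sup>2 = ((cos \<theta>)\<^sup>2 + (sin \<theta>)\<^sup>2) * (a\<^sup>2 + b\<^sup>2)" for a b
      by algebra
    then have "(norm (?R v))\<^sup>2 = (norm v)\<^sup>2"
      unfolding norm_real3_sq using ne by simp
    then show ?thesis by simp
  qed
  ultimately show ?thesis by (simp add: orthogonal_transformation)
qed

text \<open>Fixes the first coordinate, and so identifies the moments in the other two when they are
  weighted by a function of the first.\<close>

lemma orthogonal_transformation_swap23:
  "orthogonal_transformation (\<lambda>v :: real ^ 3. (\<chi> i. if i = 1 then v $ 1 else if i = 2 then v $ 3 else v $ 2 ) :: real ^ 3)"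
  (is "orthogonal_transformation ?R")
proof -
  have "linear ?R" by (rule linearI) (auto simp: vec_eq_iff algebra_simps)
  moreover have "norm (?R v) = norm v" for v
  proof -
    have ne: "(3::3) \<noteq> 1" "(3::3) \<noteq> 2" by auto
    have "(norm (?R v))\<^sup>2 = (norm v)\<^sup>2"
      unfolding norm_real3_sq using ne by simp
    then show ?thesis by simp
  qed
  ultimately show ?thesis by (simp add: orthogonal_transformation)
qed

lemma abs_mult_le_one: "\<bar>a\<bar> \<le> 1 \<Longrightarrow> \<bar>b\<bar> \<le> 1 \<Longrightarrow> \<bar>a * b\<bar> \<le> 1" for a b :: real
  by (simp add: abs_mult mult_le_one)

lemma AE_sphere_measure_component: "AE \<omega> in sphere_measure. \<forall>i. \<bar>\<omega> $ i\<bar> \<le> 1"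
  using AE_sphere_measure_norm
  by eventually_elim (metis component_le_norm_cart)

lemma integrable_sphere_measure:
  fixes h :: "real ^ 3 \<Rightarrow> real"
  assumes "h \<in> borel_measurable borel" "\<And>\<omega>. \<forall>i. \<bar>\<omega> $ i\<bar> \<le> 1 \<Longrightarrow> \<bar>h \<omega>\<bar> \<le> B"
  shows "integrable sphere_measure h"
proof -
  interpret finite_measure sphere_measure by (rule finite_measure_sphere_measure)
  show ?thesis
    using assms AE_sphere_measure_component
    by (intro integrable_const_bound[where B = B]) (auto elim: eventually_mono)
qed

text \<open>The rotations in the first two coordinates leave \<open>\<integral>\<omega>\<^sub>2 sin(r \<omega>\<^sub>1) d\<sigma>\<close> unchanged;
  differentiate at the identity.\<close>

lemma sphere_measure_rotation_identity:
  "r * (\<integral>\<omega>. (\<omega> $ 2)\<^sup>2 * cos (r * \<omega> $ 1) \<partial>sphere_measure) = (\<integral>\<omega>. \<omega> $ 1 * sin (r * \<omega> $ 1) \<partial>sphere_measure)"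
proof -
  \<comment> \<open>These are the second and the first coordinate of the rotated point, so
    \<open>\<phi> \<theta>\<close> is the test function composed with the rotation. Since a' = b and
    b' = -a, the next two definitions are its \<theta>-derivatives.\<close>
  define a b where "a \<theta> \<omega> = cos \<theta> * \<omega> $ 2 + sin \<theta> * \<omega> $ 1" and "b \<theta> \<omega> = cos \<theta> * \<omega> $ 1 - sin \<theta> * \<omega> $ 2"
    for \<theta> and \<omega> :: "real ^ 3"
  have [measurable]: "a \<theta> \<in> borel_measurable borel" "b \<theta> \<in> borel_measurable borel" for \<theta>
    unfolding a_def[abs_def] b_def[abs_def] by measurable
  define \<phi> where "\<phi> \<theta> \<omega> = a \<theta> \<omega> * sin (r * b \<theta> \<omega>)" for \<theta> \<omega>
  define \<phi>' where "\<phi>' \<theta> \<omega> = b \<theta> \<omega> * sin (r * b \<theta> \<omega>) - r * (a \<theta> \<omega>)\<^sup>2 * cos (r * b \<theta> \<omega>)" for \<theta> \<omega>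
  define \<phi>'' where "\<phi>'' \<theta> \<omega> = - a \<theta> \<omega> * sin (r * b \<theta> \<omega>) - 3 * r * a \<theta> \<omega> * b \<theta> \<omega> * cos (r * b \<theta> \<omega>)
      - r\<^sup>2 * (a \<theta> \<omega>)^3 * sin (r * b \<theta> \<omega>)" for \<theta> \<omega>
  have [measurable]: "\<phi> \<theta> \<in> borel_measurable borel" "\<phi>' \<theta> \<in> borel_measurable borel" for \<theta>
    unfolding \<phi>_def[abs_def] \<phi>'_def[abs_def] by measurable
  have da: "((\<lambda>\<theta>. a \<theta> \<omega>) has_real_derivative b \<theta> \<omega>) (at \<theta>)"
    and db: "((\<lambda>\<theta>. b \<theta> \<omega>) has_real_derivative - a \<theta> \<omega>) (at \<theta>)" for \<theta> \<omega>
    unfolding a_def b_def by (auto intro!: derivative_eq_intros)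
  have d1: "((\<lambda>\<theta>. \<phi> \<theta> \<omega>) has_real_derivative \<phi>' \<theta> \<omega>) (at \<theta>)" for \<theta> \<omega>
    unfolding \<phi>_def \<phi>'_def
    by (rule derivative_eq_intros da db refl)+ (simp add: power2_eq_square)
  have d2: "((\<lambda>\<theta>. \<phi>' \<theta> \<omega>) has_real_derivative \<phi>'' \<theta> \<omega>) (at \<theta>)" for \<theta> \<omega>
    unfolding \<phi>'_def \<phi>''_def
    by (rule derivative_eq_intros da db refl)+ (simp add: power2_eq_square power3_eq_cube algebra_simps)
  have ab: "\<bar>a \<theta> \<omega>\<bar> \<le> 2" "\<bar>b \<theta> \<omega>\<bar> \<le> 2" if "\<forall>i. \<bar>\<omega> $ i\<bar> \<le> 1" for \<theta> \<omega>
  proof -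
    have "\<bar>cos \<theta> * \<omega> $ 2\<bar> \<le> 1" "\<bar>sin \<theta> * \<omega> $ 1\<bar> \<le> 1" "\<bar>cos \<theta> * \<omega> $ 1\<bar> \<le> 1" "\<bar>sin \<theta> * \<omega> $ 2\<bar> \<le> 1"
      using that by (simp_all add: abs_mult_le_one)
    then show "\<bar>a \<theta> \<omega>\<bar> \<le> 2" "\<bar>b \<theta> \<omega>\<bar> \<le> 2" unfolding a_def b_def by auto
  qed
  have bnd: "\<bar>\<phi> \<theta> \<omega>\<bar> \<le> 2 \<and> \<bar>\<phi>' \<theta> \<omega>\<bar> \<le> 2 + \<bar>r\<bar> * 4 \<and> \<bar>\<phi>'' \<theta> \<omega>\<bar> \<le> 2 + 12 * \<bar>r\<bar> + 8 * r\<^sup>2"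
    if "\<forall>i. \<bar>\<omega> $ i\<bar> \<le> 1" for \<theta> \<omega>
  proof -
    note ab' = ab[OF that, of \<theta>]
    have s: "\<bar>sin (r * b \<theta> \<omega>)\<bar> \<le> 1" and c: "\<bar>cos (r * b \<theta> \<omega>)\<bar> \<le> 1" by auto
    have a2: "\<bar>a \<theta> \<omega>\<bar>\<^sup>2 \<le> 2\<^sup>2" "\<bar>a \<theta> \<omega>\<bar>^3 \<le> 2^3" using power_mono[OF ab'(1), of 2] power_mono[OF ab'(1), of 3] by auto
    have 1: "\<bar>a \<theta> \<omega> * sin (r * b \<theta> \<omega>)\<bar> \<le> 2 * 1" "\<bar>b \<theta> \<omega> * sin (r * b \<theta> \<omega>)\<bar> \<le> 2 * 1"
      using mult_mono[OF ab'(1) s] mult_mono[OF ab'(2) s] by (auto simp: abs_mult)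
    have 2: "\<bar>r * (a \<theta> \<omega>)\<^sup>2 * cos (r * b \<theta> \<omega>)\<bar> \<le> \<bar>r\<bar> * 4 * 1"
      unfolding abs_mult using a2 c by (intro mult_mono) auto
    have 3: "\<bar>3 * r * a \<theta> \<omega> * b \<theta> \<omega> * cos (r * b \<theta> \<omega>)\<bar> \<le> 3 * \<bar>r\<bar> * 2 * 2 * 1"
      unfolding abs_mult using ab' c by (intro mult_mono) auto
    have 4: "\<bar>r\<^sup>2 * (a \<theta> \<omega>)^3 * sin (r * b \<theta> \<omega>)\<bar> \<le> r\<^sup>2 * 8 * 1"
      unfolding abs_mult power_abs using a2 s by (intro mult_mono) auto
    show ?thesis unfolding \<phi>_def \<phi>'_def \<phi>''_def using 1 2 3 4 by linarith
  qed
  have D: "((\<lambda>\<theta>. \<integral>\<omega>. \<phi> \<theta> \<omega> \<partial>sphere_measure) has_real_derivative (\<integral>\<omega>. \<phi>' 0 \<omega> \<partial>sphere_measure)) (at 0)"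
  proof (rule DERIV_integral_bounded_second_derivative[OF finite_measure_sphere_measure])
    show "integrable sphere_measure (\<phi> \<theta>)" for \<theta>
      by (rule integrable_sphere_measure[of _ 2]) (use bnd in auto)
    show "integrable sphere_measure (\<phi>' 0)"
      by (rule integrable_sphere_measure[of _ "2 + \<bar>r\<bar> * 4"]) (use bnd in auto)
    show "AE \<omega> in sphere_measure. \<forall>\<theta>. ((\<lambda>\<theta>. \<phi> \<theta> \<omega>) has_real_derivative \<phi>' \<theta> \<omega>) (at \<theta>) \<and>
       ((\<lambda>\<theta>. \<phi>' \<theta> \<omega>) has_real_derivative \<phi>'' \<theta> \<omega>) (at \<theta>) \<and> \<bar>\<phi>'' \<theta> \<omega>\<bar> \<le> 2 + 12 * \<bar>r\<bar> + 8 * r\<^sup>2"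
      using AE_sphere_measure_component by eventually_elim (use d1 d2 bnd in blast)
  qed
  have const: "(\<lambda>\<theta>. \<integral>\<omega>. \<phi> \<theta> \<omega> \<partial>sphere_measure) = (\<lambda>\<theta>. \<integral>\<omega>. \<omega> $ 2 * sin (r * \<omega> $ 1) \<partial>sphere_measure)"
  proof
    fix \<theta>
    show "(\<integral>\<omega>. \<phi> \<theta> \<omega> \<partial>sphere_measure) = (\<integral>\<omega>. \<omega> $ 2 * sin (r * \<omega> $ 1) \<partial>sphere_measure)"
      using integral_sphere_measure_orthogonal[OF orthogonal_transformation_rotation12[of \<theta>],
          of "\<lambda>\<omega>. \<omega> $ 2 * sin (r * \<omega> $ 1)"]
      by (simp add: \<phi>_def a_def b_def)
  qed
  have "(\<integral>\<omega>. \<phi>' 0 \<omega> \<partial>sphere_measure) = 0"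
    by (rule DERIV_unique[OF D[unfolded const] DERIV_const])
  moreover have "\<phi>' 0 = (\<lambda>\<omega>. \<omega> $ 1 * sin (r * \<omega> $ 1) - r * ((\<omega> $ 2)\<^sup>2 * cos (r * \<omega> $ 1)))"
    by (simp add: \<phi>'_def a_def b_def fun_eq_iff)
  moreover have "integrable sphere_measure (\<lambda>\<omega>. \<omega> $ 1 * sin (r * \<omega> $ 1))"
    "integrable sphere_measure (\<lambda>\<omega>. (\<omega> $ 2)\<^sup>2 * cos (r * \<omega> $ 1))"
    by (rule integrable_sphere_measure[of _ 1];
        auto simp: abs_square_le_1 intro!: abs_mult_le_one)+
  ultimately show ?thesis by simp
qed

text \<open>By rotation invariance, \<open>h(r) = r \<integral>cos(r \<omega>\<^sub>1) d\<sigma>\<close> satisfies \<open>h'' = - h\<close> (the Helmholtz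
  equation for a radial function), so \<open>h\<^sup>2 + h'\<^sup>2\<close> is constant.\<close>

lemma sphere_measure_cos_axis_decay:
  "\<bar>r * (\<integral>\<omega>. cos (r * \<omega> $ 1) \<partial>sphere_measure)\<bar> \<le> measure sphere_measure UNIV"
proof -
  let ?I = "\<lambda>f. \<integral>\<omega>. f \<omega> \<partial>sphere_measure"
  define g g1 g2 where "g r = ?I (\<lambda>\<omega>. cos (r * \<omega> $ 1))"
    and "g1 r = ?I (\<lambda>\<omega>. - (\<omega> $ 1) * sin (r * \<omega> $ 1))"
    and "g2 r = ?I (\<lambda>\<omega>. - (\<omega> $ 1)\<^sup>2 * cos (r * \<omega> $ 1))" for r
  have int: "integrable sphere_measure (\<lambda>\<omega>. cos (r * \<omega> $ 1))"
    "integrable sphere_measure (\<lambda>\<omega>. - (\<omega> $ 1) * sin (r * \<omega> $ 1))"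
    "integrable sphere_measure (\<lambda>\<omega>. - (\<omega> $ 1)\<^sup>2 * cos (r * \<omega> $ 1))"
    "integrable sphere_measure (\<lambda>\<omega>. (\<omega> $ i)\<^sup>2 * cos (r * \<omega> $ 1))" for r i
    by (rule integrable_sphere_measure[of _ 1];
        auto simp: abs_square_le_1 intro!: abs_mult_le_one)+
  have d1: "(g has_real_derivative g1 r) (at r)" for r
    unfolding g_def g1_def
  proof (rule DERIV_integral_bounded_second_derivative[OF finite_measure_sphere_measure int(1,2)])
    show "AE \<omega> in sphere_measure. \<forall>\<theta>. ((\<lambda>\<theta>. cos (\<theta> * \<omega> $ 1)) has_real_derivative - (\<omega> $ 1) * sin (\<theta> * \<omega> $ 1)) (at \<theta>) \<and>
       ((\<lambda>\<theta>. - (\<omega> $ 1) * sin (\<theta> * \<omega> $ 1)) has_real_derivative - (\<omega> $ 1)\<^sup>2 * cos (\<theta> * \<omega> $ 1)) (at \<theta>) \<and>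
       \<bar>- (\<omega> $ 1)\<^sup>2 * cos (\<theta> * \<omega> $ 1)\<bar> \<le> 1"
      using AE_sphere_measure_component
    proof (eventually_elim, intro allI conjI)
      fix \<omega> :: "real ^ 3" and \<theta> assume \<omega>: "\<forall>i. \<bar>\<omega> $ i\<bar> \<le> 1"
      show "((\<lambda>\<theta>. cos (\<theta> * \<omega> $ 1)) has_real_derivative - (\<omega> $ 1) * sin (\<theta> * \<omega> $ 1)) (at \<theta>)"
        by (auto intro!: derivative_eq_intros)
      show "((\<lambda>\<theta>. - (\<omega> $ 1) * sin (\<theta> * \<omega> $ 1)) has_real_derivative - (\<omega> $ 1)\<^sup>2 * cos (\<theta> * \<omega> $ 1)) (at \<theta>)"
        by (auto intro!: derivative_eq_intros simp: power2_eq_square)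
      show "\<bar>- (\<omega> $ 1)\<^sup>2 * cos (\<theta> * \<omega> $ 1)\<bar> \<le> 1"
        using \<omega> by (intro abs_mult_le_one) (auto simp: abs_square_le_1)
    qed
  qed
  have d2: "(g1 has_real_derivative g2 r) (at r)" for r
    unfolding g2_def g1_def
  proof (rule DERIV_integral_bounded_second_derivative[OF finite_measure_sphere_measure int(2,3)])
    show "AE \<omega> in sphere_measure. \<forall>\<theta>. ((\<lambda>\<theta>. - (\<omega> $ 1) * sin (\<theta> * \<omega> $ 1)) has_real_derivative - (\<omega> $ 1)\<^sup>2 * cos (\<theta> * \<omega> $ 1)) (at \<theta>) \<and>
       ((\<lambda>\<theta>. - (\<omega> $ 1)\<^sup>2 * cos (\<theta> * \<omega> $ 1)) has_real_derivative (\<omega> $ 1)^3 * sin (\<theta> * \<omega> $ 1)) (at \<theta>) \<and>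
       \<bar>(\<omega> $ 1)^3 * sin (\<theta> * \<omega> $ 1)\<bar> \<le> 1"
      using AE_sphere_measure_component
    proof (eventually_elim, intro allI conjI)
      fix \<omega> :: "real ^ 3" and \<theta> assume \<omega>: "\<forall>i. \<bar>\<omega> $ i\<bar> \<le> 1"
      show "((\<lambda>\<theta>. - (\<omega> $ 1) * sin (\<theta> * \<omega> $ 1)) has_real_derivative - (\<omega> $ 1)\<^sup>2 * cos (\<theta> * \<omega> $ 1)) (at \<theta>)"
        by (auto intro!: derivative_eq_intros simp: power2_eq_square)
      show "((\<lambda>\<theta>. - (\<omega> $ 1)\<^sup>2 * cos (\<theta> * \<omega> $ 1)) has_real_derivative (\<omega> $ 1)^3 * sin (\<theta> * \<omega> $ 1)) (at \<theta>)"
        by (auto intro!: derivative_eq_intros simp: power2_eq_square power3_eq_cube)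
      show "\<bar>(\<omega> $ 1)^3 * sin (\<theta> * \<omega> $ 1)\<bar> \<le> 1"
        using \<omega> by (intro abs_mult_le_one) (auto simp: power_abs power_le_one)
    qed
  qed
  \<comment> \<open>The radial Helmholtz equation r g'' + 2 g' + r g = 0. It comes from inserting
    the sum of the squared coordinates, which is 1 on the sphere, merging the second and third
    moments by symmetry, and removing the remaining one by the rotation identity.\<close>
  have ode: "r * g r = - (r * g2 r) - 2 * g1 r" for r
  proof -
    have ne: "(3::3) \<noteq> 1" "(3::3) \<noteq> 2" by auto
    have swap: "?I (\<lambda>\<omega>. (\<omega> $ 3)\<^sup>2 * cos (r * \<omega> $ 1)) = ?I (\<lambda>\<omega>. (\<omega> $ 2)\<^sup>2 * cos (r * \<omega> $ 1))"
      using integral_sphere_measure_orthogonal[OF orthogonal_transformation_swap23,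
          of "\<lambda>\<omega>. (\<omega> $ 2)\<^sup>2 * cos (r * \<omega> $ 1)"] ne
      by simp
    have "g r = ?I (\<lambda>\<omega>. (\<omega> $ 1)\<^sup>2 * cos (r * \<omega> $ 1) + (\<omega> $ 2)\<^sup>2 * cos (r * \<omega> $ 1) + (\<omega> $ 3)\<^sup>2 * cos (r * \<omega> $ 1))"
      unfolding g_def
    proof (rule integral_cong_AE)
      show "AE \<omega> in sphere_measure. cos (r * \<omega> $ 1) = (\<omega> $ 1)\<^sup>2 * cos (r * \<omega> $ 1) + (\<omega> $ 2)\<^sup>2 * cos (r * \<omega> $ 1) + (\<omega> $ 3)\<^sup>2 * cos (r * \<omega> $ 1)"
        using AE_sphere_measure_norm
      proof eventually_elim
        case (elim \<omega>)
        then have "(\<omega> $ 1)\<^sup>2 + (\<omega> $ 2)\<^sup>2 + (\<omega> $ 3)\<^sup>2 = 1" using norm_real3_sq[of \<omega>] by simp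
        then show ?case by (simp flip: distrib_right)
      qed
    qed measurable
    also have "\<dots> = - g2 r + 2 * ?I (\<lambda>\<omega>. (\<omega> $ 2)\<^sup>2 * cos (r * \<omega> $ 1))"
      using int(4) swap by (simp add: g2_def)
    finally have gr: "g r = - g2 r + 2 * ?I (\<lambda>\<omega>. (\<omega> $ 2)\<^sup>2 * cos (r * \<omega> $ 1))" .
    have "r * g r = - (r * g2 r) + 2 * (r * ?I (\<lambda>\<omega>. (\<omega> $ 2)\<^sup>2 * cos (r * \<omega> $ 1)))"
      by (subst gr) (simp add: algebra_simps)
    then show ?thesis
      unfolding sphere_measure_rotation_identity by (simp add: g1_def)
  qed
  \<comment> \<open>With h(r) = r g(r), the second square is h'(r)^2. At r = 0 only
    \<open>(g 0)\<^sup>2\<close> survives, the square of the total mass, which is the constant in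
    the claim.\<close>
  define E where "E r = (r * g r)\<^sup>2 + (g r + r * g1 r)\<^sup>2" for r
  have "(E has_real_derivative 0) (at r)" for r
  proof -
    have "(E has_real_derivative 2 * (r * g r) * (g r + r * g1 r) + 2 * (g r + r * g1 r) * (2 * g1 r + r * g2 r)) (at r)"
      unfolding E_def[abs_def] by (auto intro!: derivative_eq_intros d1 d2 simp: algebra_simps power2_eq_square)
    also have "2 * (r * g r) * (g r + r * g1 r) + 2 * (g r + r * g1 r) * (2 * g1 r + r * g2 r) = 0"
      unfolding ode[of r] by (simp add: algebra_simps)
    finally show ?thesis .
  qed
  then have "E r = E 0" by (intro DERIV_isconst_all) auto
  then have "(r * g r)\<^sup>2 \<le> (g 0)\<^sup>2" unfolding E_def by simp (metis le_add_same_cancel1 zero_le_power2)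
  then have "\<bar>r * g r\<bar> \<le> \<bar>g 0\<bar>" by (simp add: abs_le_square_iff)
  then show ?thesis by (simp add: g_def)
qed

text \<open>The antipodal symmetry kills the imaginary part, and a rotation taking \<open>v\<close>
  to the first axis reduces the real part to the one-variable estimate at
  \<open>r = norm v\<close>.\<close>

lemma sphere_measure_cis_decay:
  "norm (\<integral>\<omega>. cis (- (v \<bullet> \<omega>)) \<partial>sphere_measure) * norm v \<le> measure sphere_measure UNIV"
proof -
  interpret finite_measure sphere_measure by (rule finite_measure_sphere_measure)
  have [measurable]: "(\<lambda>x. cis (- (v \<bullet> x))) \<in> borel_measurable borel"
    by (intro borel_measurable_continuous_onI continuous_intros)
  have int: "integrable sphere_measure (\<lambda>\<omega>. cis (- (v \<bullet> \<omega>)))"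
    by (rule integrable_const_bound[where B = 1]) auto
  have nv: "norm v = norm (norm v *\<^sub>R (axis 1 1 :: real ^ 3))" by (simp add: norm_axis_1)
  obtain Q :: "real ^ 3 \<Rightarrow> real ^ 3" where Q: "orthogonal_transformation Q" "Q v = norm v *\<^sub>R axis 1 1"
    by (rule orthogonal_transformation_exists[OF nv])
  have "(\<integral>\<omega>. sin (v \<bullet> \<omega>) \<partial>sphere_measure) = (\<integral>\<omega>. sin (v \<bullet> (- \<omega>)) \<partial>sphere_measure)"
    by (rule integral_sphere_measure_orthogonal[symmetric])
      (auto simp: orthogonal_transformation_def linear_uminus intro!: linearI)
  then have "(\<integral>\<omega>. sin (v \<bullet> \<omega>) \<partial>sphere_measure) = 0" by simp
  then have im: "Im (\<integral>\<omega>. cis (- (v \<bullet> \<omega>)) \<partial>sphere_measure) = 0"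
    using int by (simp flip: integral_Im)
  have "Re (\<integral>\<omega>. cis (- (v \<bullet> \<omega>)) \<partial>sphere_measure) = (\<integral>\<omega>. cos (v \<bullet> \<omega>) \<partial>sphere_measure)"
    using int by (simp flip: integral_Re)
  also have "\<dots> = (\<integral>\<omega>. cos (Q v \<bullet> Q \<omega>) \<partial>sphere_measure)"
    using Q(1) by (simp add: orthogonal_transformation_def)
  also have "\<dots> = (\<integral>\<omega>. cos (Q v \<bullet> \<omega>) \<partial>sphere_measure)"
    using integral_sphere_measure_orthogonal[OF Q(1), of "\<lambda>\<omega>. cos (Q v \<bullet> \<omega>)"] by simp
  also have "\<dots> = (\<integral>\<omega>. cos (norm v * \<omega> $ 1) \<partial>sphere_measure)"
    unfolding Q(2) by (simp add: inner_axis')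
  finally have re: "Re (\<integral>\<omega>. cis (- (v \<bullet> \<omega>)) \<partial>sphere_measure) = \<dots>" .
  show ?thesis
    using sphere_measure_cos_axis_decay[of "norm v"]
    by (simp add: cmod_def im re abs_mult mult.commute)
qed

section \<open>Gaussians and Fourier transforms of measures\<close>

text \<open>The characteristic function of the standard normal distribution, rescaled by the
  substitution \<xi> = \<eta> / \<delta>.\<close>

lemma gaussian_fourier_real:
  fixes x \<delta> :: real
  assumes \<delta>: "0 < \<delta>"
  shows "(\<integral>\<xi>. cis (\<xi> * x) * of_real (exp (- (\<delta> * \<xi>)\<^sup>2 / 2)) \<partial>lborel)
    = of_real (sqrt (2 * pi) / \<delta> * exp (- x\<^sup>2 / (2 * \<delta>\<^sup>2)))"
proof -
  have "char std_normal_distribution (x / \<delta>) = (\<integral>\<eta>. std_normal_density \<eta> *\<^sub>R iexp (x / \<delta> * \<eta>) \<partial>lborel)"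
    unfolding char_def by (rule integral_density) auto
  \<comment> \<open>The odd form \<open>0 + 1 / \<delta> * \<eta>\<close> is the shape in which
    \<open>lborel_integral_real_affine\<close> performs the substitution.\<close>
  also have "\<dots> = (\<integral>\<eta>. of_real (1 / sqrt (2 * pi)) * (cis (0 + 1 / \<delta> * \<eta> * x) * of_real (exp (- (\<delta> * (0 + 1 / \<delta> * \<eta>))\<^sup>2 / 2))) \<partial>lborel)"
    using \<delta> by (intro Bochner_Integration.integral_cong)
      (auto simp: std_normal_density_def cis_conv_exp scaleR_conv_of_real mult_ac)
  also have "\<dots> = of_real (1 / sqrt (2 * pi)) * (\<integral>\<eta>. cis ((0 + 1 / \<delta> * \<eta>) * x) * of_real (exp (- (\<delta> * (0 + 1 / \<delta> * \<eta>))\<^sup>2 / 2)) \<partial>lborel)"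
    by simp
  finally have 1: "(\<integral>\<eta>. cis ((0 + 1 / \<delta> * \<eta>) * x) * of_real (exp (- (\<delta> * (0 + 1 / \<delta> * \<eta>))\<^sup>2 / 2)) \<partial>lborel)
      = of_real (sqrt (2 * pi)) * of_real (exp (- (x / \<delta>)\<^sup>2 / 2))"
    by (simp add: char_std_normal_distribution field_simps)
  have "(\<integral>\<xi>. cis (\<xi> * x) * of_real (exp (- (\<delta> * \<xi>)\<^sup>2 / 2)) \<partial>lborel)
    = \<bar>1 / \<delta>\<bar> *\<^sub>R (\<integral>\<eta>. cis ((0 + 1 / \<delta> * \<eta>) * x) * of_real (exp (- (\<delta> * (0 + 1 / \<delta> * \<eta>))\<^sup>2 / 2)) \<partial>lborel)"
    using \<delta> by (intro lborel_integral_real_affine) auto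
  also have "\<dots> = of_real (sqrt (2 * pi) / \<delta> * exp (- x\<^sup>2 / (2 * \<delta>\<^sup>2)))"
    unfolding 1 using \<delta> by (simp add: scaleR_conv_of_real power_divide mult_ac)
  finally show ?thesis .
qed

text \<open>\<open>lborel\<close> is the image of a finite product of one-dimensional Lebesgue
  measures under the coordinate map, so integrals of products of one-variable functions
  factor.\<close>

lemma lborel_integral_prod_euclidean:
  fixes f :: "'a::euclidean_space \<Rightarrow> real \<Rightarrow> complex"
  assumes "\<And>b. b \<in> Basis \<Longrightarrow> integrable lborel (f b)"
  shows "(\<integral>x. (\<Prod>b\<in>Basis. f b (x \<bullet> b)) \<partial>lborel) = (\<Prod>b\<in>Basis. \<integral>x. f b x \<partial>lborel)"
proof -
  interpret product_sigma_finite "\<lambda>_ :: 'a. lborel :: real measure" by standard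
  have [measurable]: "f b \<in> borel_measurable borel" if "b \<in> Basis" for b
    using assms[OF that] by auto
  have "(\<integral>x. (\<Prod>b\<in>Basis. f b (x \<bullet> b)) \<partial>lborel)
    = (\<integral>x. (\<Prod>b\<in>Basis. f b (x \<bullet> b)) \<partial>distr (\<Pi>\<^sub>M b\<in>Basis. lborel) borel (\<lambda>x. \<Sum>b\<in>Basis. x b *\<^sub>R b :: 'a))"
    using lborel_eq[where 'a = 'a] by simp
  also have "\<dots> = (\<integral>x. (\<Prod>b\<in>Basis. f b ((\<Sum>b'\<in>Basis. x b' *\<^sub>R b') \<bullet> b)) \<partial>(\<Pi>\<^sub>M b\<in>(Basis :: 'a set). lborel))"
    by (rule integral_distr) measurable
  also have "\<dots> = (\<integral>x. (\<Prod>b\<in>Basis. f b (x b)) \<partial>(\<Pi>\<^sub>M b\<in>(Basis :: 'a set). lborel))"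
    by (intro Bochner_Integration.integral_cong refl prod.cong) simp
  also have "\<dots> = (\<Prod>b\<in>Basis. \<integral>x. f b x \<partial>lborel)"
    by (rule product_integral_prod) (auto simp: assms)
  finally show ?thesis .
qed

definition gauss_weight :: "real \<Rightarrow> 'a::euclidean_space \<Rightarrow> real" where
  "gauss_weight \<delta> \<xi> = exp (- (\<delta> * norm \<xi>)\<^sup>2 / 2)"

text \<open>This is (2 pi)^(d/2) times the heat kernel at time \<delta>^2 / 2, with d the dimension;
  its mass is (2 pi)^(d/2), not 1. \<open>gauss_weight \<delta>\<close> is the transform of the
  normalised kernel.\<close>

definition heat :: "real \<Rightarrow> 'a::euclidean_space \<Rightarrow> real" where
  "heat \<delta> x = exp (- (norm x)\<^sup>2 / (2 * \<delta>\<^sup>2)) / \<delta> ^ DIM('a)"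

lemma gaussian_fourier:
  fixes x :: "'a::euclidean_space"
  assumes \<delta>: "0 < \<delta>"
  shows "(\<integral>\<xi>. cis (\<xi> \<bullet> x) * of_real (gauss_weight \<delta> \<xi>) \<partial>lborel)
    = of_real (sqrt (2 * pi) ^ DIM('a) * heat \<delta> x)"
proof -
  define f where "f b \<xi> = cis (\<xi> * (x \<bullet> b)) * of_real (exp (- (\<delta> * \<xi>)\<^sup>2 / 2))" for b :: 'a and \<xi>
  have val: "(\<integral>\<xi>. f b \<xi> \<partial>lborel) = of_real (sqrt (2 * pi) / \<delta> * exp (- (x \<bullet> b)\<^sup>2 / (2 * \<delta>\<^sup>2)))" for b
    unfolding f_def by (rule gaussian_fourier_real[OF \<delta>])
  \<comment> \<open>A nonintegrable function has Bochner integral 0 by convention, while the value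
    just computed is nonzero.\<close>
  have int: "integrable lborel (f b)" for b
  proof (rule ccontr)
    assume "\<not> integrable lborel (f b)"
    then have "(\<integral>\<xi>. f b \<xi> \<partial>lborel) = 0" by (rule not_integrable_integral_eq)
    then show False unfolding val using \<delta> by simp
  qed
  have nrm: "(norm y)\<^sup>2 = (\<Sum>b\<in>Basis. (y \<bullet> b)\<^sup>2)" for y :: 'a
    unfolding power2_norm_eq_inner by (subst euclidean_inner) (simp add: power2_eq_square)
  have "cis (\<xi> \<bullet> x) * of_real (gauss_weight \<delta> \<xi>) = (\<Prod>b\<in>Basis. f b (\<xi> \<bullet> b))" for \<xi> :: 'a
  proof -
    have "cis (\<xi> \<bullet> x) = (\<Prod>b\<in>Basis. cis ((\<xi> \<bullet> b) * (x \<bullet> b)))"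
      by (simp add: cis_conv_exp euclidean_inner[of \<xi> x] sum_distrib_left flip: exp_sum)
    moreover have "gauss_weight \<delta> \<xi> = (\<Prod>b\<in>Basis. exp (- (\<delta> * (\<xi> \<bullet> b))\<^sup>2 / 2))"
      by (simp add: gauss_weight_def power_mult_distrib nrm sum_distrib_left sum_negf sum_divide_distrib flip: exp_sum)
    ultimately show ?thesis by (simp add: f_def prod.distrib)
  qed
  then have "(\<integral>\<xi>. cis (\<xi> \<bullet> x) * of_real (gauss_weight \<delta> \<xi>) \<partial>lborel) = (\<Prod>b\<in>Basis. \<integral>\<xi>. f b \<xi> \<partial>lborel)"
    using lborel_integral_prod_euclidean[of f] int by simp
  also have "\<dots> = of_real (\<Prod>b\<in>Basis. sqrt (2 * pi) / \<delta> * exp (- (x \<bullet> b)\<^sup>2 / (2 * \<delta>\<^sup>2)))"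
    by (simp add: val)
  also have "(\<Prod>b\<in>Basis. sqrt (2 * pi) / \<delta> * exp (- (x \<bullet> b)\<^sup>2 / (2 * \<delta>\<^sup>2))) = sqrt (2 * pi) ^ DIM('a) * heat \<delta> x"
  proof -
    have "exp (- (norm x)\<^sup>2 / (2 * \<delta>\<^sup>2)) = (\<Prod>b\<in>Basis. exp (- (x \<bullet> b)\<^sup>2 / (2 * \<delta>\<^sup>2)))"
      by (simp add: nrm sum_negf sum_divide_distrib flip: exp_sum)
    then show ?thesis unfolding heat_def by (simp only: prod.distrib prod_constant power_divide) simp
  qed
  finally show ?thesis .
qed

lemma gauss_weight_borel_measurable[measurable]: "gauss_weight \<delta> \<in> borel_measurable borel"
  unfolding gauss_weight_def[abs_def] by measurable

lemma heat_borel_measurable[measurable]: "heat \<delta> \<in> borel_measurable borel"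
  unfolding heat_def[abs_def] by measurable

lemma gauss_weight_nonneg: "0 \<le> gauss_weight \<delta> \<xi>"
  by (simp add: gauss_weight_def)

lemma heat_nonneg: "0 < \<delta> \<Longrightarrow> 0 \<le> heat \<delta> x"
  by (simp add: heat_def)

lemma heat_le: "0 < \<delta> \<Longrightarrow> heat \<delta> (x :: 'a::euclidean_space) \<le> 1 / \<delta> ^ DIM('a)"
  by (simp add: heat_def divide_right_mono)

lemma abs_heat_le: "0 < \<delta> \<Longrightarrow> \<bar>heat \<delta> (x :: 'a::euclidean_space)\<bar> \<le> 1 / \<delta> ^ DIM('a)"
  using heat_nonneg[of \<delta> x] heat_le[of \<delta> x] by simp

text \<open>Again read off from a nonzero integral: at x = 0 the transform is a positive multiple of
  \<open>heat \<delta> 0\<close>.\<close>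

lemma integrable_gauss_weight:
  assumes \<delta>: "0 < \<delta>"
  shows "integrable lborel (gauss_weight \<delta> :: 'a::euclidean_space \<Rightarrow> real)"
proof -
  have "integrable lborel (\<lambda>\<xi> :: 'a. complex_of_real (gauss_weight \<delta> \<xi>))"
  proof (rule ccontr)
    assume "\<not> ?thesis"
    then have "(\<integral>\<xi>. complex_of_real (gauss_weight \<delta> (\<xi> :: 'a)) \<partial>lborel) = 0" by (rule not_integrable_integral_eq)
    moreover have "heat \<delta> (0::'a) \<noteq> 0" using \<delta> by (simp add: heat_def)
    ultimately show False using gaussian_fourier[OF \<delta>, of "0::'a"] by simp
  qed
  then show ?thesis by (simp add: complex_of_real_integrable_eq)
qed

section \<open>Fourier transforms of measures with density\<close>

text \<open>The integrability behind the exchanges of Bochner integrals below: the factor coupling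
  the two variables, a character or a Gaussian, is always bounded.\<close>

lemma integrable_pair_bounded_mult:
  fixes u :: "'a \<times> 'b \<Rightarrow> 'c::{real_normed_field, banach, second_countable_topology}"
  assumes "sigma_finite_measure M1" "sigma_finite_measure M2"
    and a: "integrable M1 a" and b: "integrable M2 b"
    and u: "u \<in> borel_measurable (M1 \<Otimes>\<^sub>M M2)" "\<And>z. norm (u z) \<le> B"
  shows "integrable (M1 \<Otimes>\<^sub>M M2) (\<lambda>(x, y). u (x, y) * (a x * b y))"
proof -
  interpret M1: sigma_finite_measure M1 by fact
  interpret M2: sigma_finite_measure M2 by fact
  interpret P: pair_sigma_finite M1 M2 ..
  have [measurable]: "a \<in> borel_measurable M1" "b \<in> borel_measurable M2" using a b by auto
  note u(1)[measurable]
  have ab: "integrable (M1 \<Otimes>\<^sub>M M2) (\<lambda>z. a (fst z) * b (snd z))"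
    by (rule P.Fubini_integrable) (use a b in \<open>auto simp: norm_mult\<close>)
  have B0: "0 \<le> B" using u(2) norm_ge_zero order_trans by blast
  have "integrable (M1 \<Otimes>\<^sub>M M2) (\<lambda>z. B * norm (a (fst z) * b (snd z)))"
    by (intro integrable_mult_right integrable_norm ab)
  then have "integrable (M1 \<Otimes>\<^sub>M M2) (\<lambda>z. u z * (a (fst z) * b (snd z)))"
  proof (rule Bochner_Integration.integrable_bound)
    show "AE z in M1 \<Otimes>\<^sub>M M2. norm (u z * (a (fst z) * b (snd z))) \<le> norm (B * norm (a (fst z) * b (snd z)))"
      using u(2) B0 by (intro AE_I2) (auto simp: norm_mult intro!: mult_right_mono)
  qed measurable
  then show ?thesis by (simp add: case_prod_beta')
qed

text \<open>The transform of the signed measure with density \<open>f\<close> with respect to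
  \<open>M\<close>, without any factor of 2 pi; \<open>f = (\<lambda>_. 1)\<close> gives the
  transform of \<open>M\<close> itself.\<close>

definition fourier :: "'a::euclidean_space measure \<Rightarrow> ('a \<Rightarrow> real) \<Rightarrow> 'a \<Rightarrow> complex" where
  "fourier M f \<xi> = (\<integral>y. cis (- (\<xi> \<bullet> y)) * of_real (f y) \<partial>M)"

lemma cis_borel_measurable[measurable (raw)]:
  assumes "g \<in> borel_measurable M"
  shows "(\<lambda>x. cis (g x)) \<in> borel_measurable M"
proof -
  have "cis \<in> borel_measurable borel" by (intro borel_measurable_continuous_onI continuous_intros)
  from measurable_compose[OF assms this] show ?thesis .
qed

lemma fourier_borel_measurable:
  assumes "sigma_finite_measure M" and [measurable_cong]: "sets M = sets borel"
    and [measurable]: "f \<in> borel_measurable borel"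
  shows "fourier M f \<in> borel_measurable borel"
proof -
  interpret sigma_finite_measure M by fact
  show ?thesis unfolding fourier_def[abs_def] by (intro borel_measurable_lebesgue_integral) measurable
qed

lemma norm_fourier_le:
  "norm (fourier M f \<xi>) \<le> (\<integral>y. \<bar>f y\<bar> \<partial>M)"
  unfolding fourier_def by (rule order_trans[OF integral_norm_bound]) (simp add: norm_mult)

text \<open>Since \<open>K\<close> is given as a Fourier integral of an integrable \<open>m\<close>,
  inserting that formula and exchanging the integrals is enough; Fourier inversion is never
  invoked.\<close>

lemma fourier_convolution:
  fixes m K :: "'a::euclidean_space \<Rightarrow> complex" and f :: "'a \<Rightarrow> real"
  assumes M: "sigma_finite_measure M" and sM[measurable_cong]: "sets M = sets borel"
    and f: "integrable M f" and m: "integrable lborel m"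
    and K: "\<And>z. K z = (\<integral>\<xi>. cis (\<xi> \<bullet> z) * m \<xi> \<partial>lborel)"
  shows "(\<integral>y. K (x - y) * of_real (f y) \<partial>M) = (\<integral>\<xi>. cis (\<xi> \<bullet> x) * (m \<xi> * fourier M f \<xi>) \<partial>lborel)"
proof -
  interpret M: sigma_finite_measure M by fact
  interpret P: pair_sigma_finite "lborel :: 'a measure" M ..
  have [measurable]: "f \<in> borel_measurable M" "m \<in> borel_measurable borel" using f m by auto
  have f': "integrable M (\<lambda>y. complex_of_real (f y))" using f by simp
  have "integrable (lborel \<Otimes>\<^sub>M M) (\<lambda>(\<xi>, y). (\<lambda>(\<xi>, y). cis (\<xi> \<bullet> (x - y))) (\<xi>, y) * (m \<xi> * of_real (f y)))"
    by (rule integrable_pair_bounded_mult[OF _ M m f', where B = 1]) (auto intro: sigma_finite_lborel)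
  then have int: "integrable (lborel \<Otimes>\<^sub>M M) (\<lambda>(\<xi>, y). cis (\<xi> \<bullet> (x - y)) * m \<xi> * of_real (f y))"
    by (simp add: mult.assoc)
  have "(\<integral>y. K (x - y) * of_real (f y) \<partial>M) = (\<integral>y. (\<integral>\<xi>. cis (\<xi> \<bullet> (x - y)) * m \<xi> * of_real (f y) \<partial>lborel) \<partial>M)"
    unfolding K by simp
  also have "\<dots> = (\<integral>\<xi>. (\<integral>y. cis (\<xi> \<bullet> (x - y)) * m \<xi> * of_real (f y) \<partial>M) \<partial>lborel)"
    by (rule P.Fubini_integral[OF int])
  also have "\<dots> = (\<integral>\<xi>. cis (\<xi> \<bullet> x) * (m \<xi> * fourier M f \<xi>) \<partial>lborel)"
  proof (rule Bochner_Integration.integral_cong[OF refl])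
    fix \<xi>
    have "(\<integral>y. cis (\<xi> \<bullet> (x - y)) * m \<xi> * of_real (f y) \<partial>M) = (\<integral>y. (cis (\<xi> \<bullet> x) * m \<xi>) * (cis (- (\<xi> \<bullet> y)) * of_real (f y)) \<partial>M)"
    proof (intro Bochner_Integration.integral_cong refl)
      fix y
      have "cis (\<xi> \<bullet> (x - y)) = cis (\<xi> \<bullet> x) * cis (- (\<xi> \<bullet> y))"
        by (simp add: inner_diff_right cis_mult)
      then show "cis (\<xi> \<bullet> (x - y)) * m \<xi> * of_real (f y) = (cis (\<xi> \<bullet> x) * m \<xi>) * (cis (- (\<xi> \<bullet> y)) * of_real (f y))"
        by simp
    qed
    also have "\<dots> = (cis (\<xi> \<bullet> x) * m \<xi>) * fourier M f \<xi>"
      unfolding fourier_def by (rule integral_mult_right_zero)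
    finally show "(\<integral>y. cis (\<xi> \<bullet> (x - y)) * m \<xi> * of_real (f y) \<partial>M) = cis (\<xi> \<bullet> x) * (m \<xi> * fourier M f \<xi>)"
      by (simp only: mult.assoc)
  qed
  finally show ?thesis .
qed

text \<open>A further exchange of integrals after the convolution formula. Two different measures
  are allowed, so that the same identity yields the operator from \<mu> to \<nu> and, with both
  equal, the energies.\<close>

lemma fourier_parseval:
  fixes m K :: "'a::euclidean_space \<Rightarrow> complex" and f g :: "'a \<Rightarrow> real"
  assumes M: "sigma_finite_measure M" and sM[measurable_cong]: "sets M = sets borel"
    and N: "sigma_finite_measure N" and sN[measurable_cong]: "sets N = sets borel"
    and f: "integrable M f" and g: "integrable N g" and m: "integrable lborel m"
    and K: "\<And>z. K z = (\<integral>\<xi>. cis (\<xi> \<bullet> z) * m \<xi> \<partial>lborel)"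
  shows "(\<integral>x. of_real (g x) * (\<integral>y. K (x - y) * of_real (f y) \<partial>M) \<partial>N)
    = (\<integral>\<xi>. m \<xi> * fourier M f \<xi> * cnj (fourier N g \<xi>) \<partial>lborel)"
proof -
  interpret N: sigma_finite_measure N by fact
  interpret P: pair_sigma_finite N "lborel :: 'a measure" ..
  have [measurable]: "f \<in> borel_measurable borel" "g \<in> borel_measurable borel" "m \<in> borel_measurable borel"
    using borel_measurable_integrable[OF f] borel_measurable_integrable[OF g] borel_measurable_integrable[OF m]
      measurable_cong_sets[OF sM refl, of "borel :: real measure"] measurable_cong_sets[OF sN refl, of "borel :: real measure"]
    by simp_all
  note fourier_borel_measurable[OF M sM, measurable]
  have mf: "integrable lborel (\<lambda>\<xi>. m \<xi> * fourier M f \<xi>)"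
  proof (rule Bochner_Integration.integrable_bound)
    show "integrable lborel (\<lambda>\<xi>. norm (m \<xi>) * (\<integral>y. \<bar>f y\<bar> \<partial>M))" using m by simp
    show "AE \<xi> in lborel. norm (m \<xi> * fourier M f \<xi>) \<le> norm (norm (m \<xi>) * (\<integral>y. \<bar>f y\<bar> \<partial>M))"
      by (intro AE_I2) (auto simp: norm_mult norm_fourier_le intro!: mult_left_mono)
  qed measurable
  have g': "integrable N (\<lambda>y. complex_of_real (g y))" using g by simp
  have "integrable (N \<Otimes>\<^sub>M lborel) (\<lambda>(x, \<xi>). (\<lambda>(x, \<xi>). cis (\<xi> \<bullet> x)) (x, \<xi>) * (of_real (g x) * (m \<xi> * fourier M f \<xi>)))"
    by (rule integrable_pair_bounded_mult[OF N _ g' mf, where B = 1]) (auto intro: sigma_finite_lborel)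
  then have int: "integrable (N \<Otimes>\<^sub>M lborel) (\<lambda>(x, \<xi>). cis (\<xi> \<bullet> x) * of_real (g x) * (m \<xi> * fourier M f \<xi>))"
    by (simp add: mult.assoc)
  have "(\<integral>x. of_real (g x) * (\<integral>y. K (x - y) * of_real (f y) \<partial>M) \<partial>N)
    = (\<integral>x. (\<integral>\<xi>. cis (\<xi> \<bullet> x) * of_real (g x) * (m \<xi> * fourier M f \<xi>) \<partial>lborel) \<partial>N)"
  proof (rule Bochner_Integration.integral_cong[OF refl])
    fix x
    have "(\<integral>\<xi>. cis (\<xi> \<bullet> x) * of_real (g x) * (m \<xi> * fourier M f \<xi>) \<partial>lborel)
      = (\<integral>\<xi>. of_real (g x) * (cis (\<xi> \<bullet> x) * (m \<xi> * fourier M f \<xi>)) \<partial>lborel)"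
      by (intro Bochner_Integration.integral_cong refl) (simp only: mult_ac)
    also have "\<dots> = of_real (g x) * (\<integral>\<xi>. cis (\<xi> \<bullet> x) * (m \<xi> * fourier M f \<xi>) \<partial>lborel)"
      by (rule integral_mult_right_zero)
    finally show "of_real (g x) * (\<integral>y. K (x - y) * of_real (f y) \<partial>M)
      = (\<integral>\<xi>. cis (\<xi> \<bullet> x) * of_real (g x) * (m \<xi> * fourier M f \<xi>) \<partial>lborel)"
      unfolding fourier_convolution[OF M sM f m K] by (rule sym)
  qed
  also have "\<dots> = (\<integral>\<xi>. (\<integral>x. cis (\<xi> \<bullet> x) * of_real (g x) * (m \<xi> * fourier M f \<xi>) \<partial>N) \<partial>lborel)"
    by (rule P.Fubini_integral[OF int, symmetric])
  also have "\<dots> = (\<integral>\<xi>. m \<xi> * fourier M f \<xi> * cnj (fourier N g \<xi>) \<partial>lborel)"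
  proof (rule Bochner_Integration.integral_cong[OF refl])
    fix \<xi>
    have "cnj (fourier N g \<xi>) = (\<integral>x. cnj (cis (- (\<xi> \<bullet> x)) * of_real (g x)) \<partial>N)"
      unfolding fourier_def by (rule Bochner_Integration.integral_cnj[symmetric])
    also have "\<dots> = (\<integral>x. cis (\<xi> \<bullet> x) * of_real (g x) \<partial>N)"
      by (simp add: cis_cnj)
    finally have "cnj (fourier N g \<xi>) = (\<integral>x. cis (\<xi> \<bullet> x) * of_real (g x) \<partial>N)" .
    then show "(\<integral>x. cis (\<xi> \<bullet> x) * of_real (g x) * (m \<xi> * fourier M f \<xi>) \<partial>N) = m \<xi> * fourier M f \<xi> * cnj (fourier N g \<xi>)"
      by (subst integral_mult_left_zero) (simp only: mult.commute)
  qed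
  finally show ?thesis .
qed

section \<open>Interpolation, summation and duality for kernel operators\<close>

lemma integrable_real_bound:
  fixes f g :: "'a \<Rightarrow> real"
  assumes "integrable M g" "f \<in> borel_measurable M" "\<And>y. \<bar>f y\<bar> \<le> g y"
  shows "integrable M f"
proof (rule Bochner_Integration.integrable_bound[OF assms(1,2)])
  show "AE y in M. norm (f y) \<le> norm (g y)"
    using assms(3) by (intro AE_I2) (metis abs_ge_self order_trans real_norm_def)
qed

lemma (in finite_measure) integrable_of_powr_integrable:
  fixes f :: "'a \<Rightarrow> real"
  assumes "f \<in> borel_measurable M" "\<And>y. 0 \<le> f y" "1 \<le> p" "integrable M (\<lambda>y. f y powr p)"
  shows "integrable M f"
proof (rule integrable_real_bound)
  show "integrable M (\<lambda>y. 1 + f y powr p)" using assms(4) by simp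
  show "\<bar>f y\<bar> \<le> 1 + f y powr p" for y
  proof (cases "f y \<le> 1")
    case True
    then show ?thesis using assms(2)[of y] by (simp add: add_increasing2)
  next
    case False
    then have "f y powr 1 \<le> f y powr p" using assms(3) by (intro powr_mono) auto
    then show ?thesis using assms(2)[of y] by simp
  qed
qed (rule assms(1))

lemma ennreal_mult_plus:
  "0 \<le> a \<Longrightarrow> 0 \<le> b \<Longrightarrow> 0 \<le> c \<Longrightarrow> 0 \<le> d \<Longrightarrow>
    ennreal (a * b + c * d) = ennreal a * ennreal b + ennreal c * ennreal d"
  by (simp add: ennreal_plus ennreal_mult)

text \<open>Convexity of the p-th power at a / (1 - \<beta>) and b / \<beta> with weights 1 -
  \<beta> and \<beta>. In sums whose norms decay like \<beta>^i it replaces Minkowski's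
  inequality.\<close>

lemma powr_sum_convex:
  fixes a b p \<beta> :: real
  assumes "1 \<le> p" "0 < \<beta>" "\<beta> < 1" "0 \<le> a" "0 \<le> b"
  shows "(a + b) powr p \<le> (1 - \<beta>) powr (1 - p) * a powr p + \<beta> powr (1 - p) * b powr p"
proof (cases "a = 0 \<or> b = 0")
  case True
  have 1: "1 \<le> \<beta> powr (1 - p)" "1 \<le> (1 - \<beta>) powr (1 - p)"
    using assms powr_mono2'[of "1 - p" \<beta> 1] powr_mono2'[of "1 - p" "1 - \<beta>" 1] by auto
  have "b powr p \<le> \<beta> powr (1 - p) * b powr p" "a powr p \<le> (1 - \<beta>) powr (1 - p) * a powr p"
    using mult_right_mono[OF 1(1), of "b powr p"] mult_right_mono[OF 1(2), of "a powr p"] by auto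
  then show ?thesis using True assms by auto
next
  case False
  define u v where "u = a / (1 - \<beta>)" and "v = b / \<beta>"
  have uv: "u > 0" "v > 0" using False assms by (auto simp: u_def v_def)
  have "((1 - \<beta>) *\<^sub>R u + \<beta> *\<^sub>R v) powr p \<le> (1 - \<beta>) * u powr p + \<beta> * v powr p"
    using powr_convex[OF assms(1)] uv assms by (intro convex_onD) auto
  moreover have "(1 - \<beta>) *\<^sub>R u + \<beta> *\<^sub>R v = a + b"
    using assms by (simp add: u_def v_def)
  moreover have "(1 - \<beta>) * u powr p = (1 - \<beta>) powr (1 - p) * a powr p"
    using assms by (simp add: u_def powr_divide powr_diff)
  moreover have "\<beta> * v powr p = \<beta> powr (1 - p) * b powr p"
    using assms by (simp add: v_def powr_divide powr_diff)
  ultimately show ?thesis by simp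
qed

text \<open>The p-th power of the bound obtained by summing norms proportional to \<beta>^i. The
  induction splits off the first term: the shifted tail satisfies the hypothesis with
  \<open>C\<close> multiplied by \<open>\<beta> powr p\<close>, so \<open>h\<close> and
  \<open>C\<close> must vary. The result does not depend on \<open>n\<close>.\<close>

lemma nn_integral_powr_sum_le:
  fixes h :: "nat \<Rightarrow> 'a \<Rightarrow> real" and p \<beta> C :: real and F :: ennreal
  assumes p: "1 \<le> p" and \<beta>: "0 < \<beta>" "\<beta> < 1" and C: "0 \<le> C"
    and [measurable]: "\<And>i. h i \<in> borel_measurable N"
    and le: "\<And>i. (\<integral>\<^sup>+x. ennreal (\<bar>h i x\<bar> powr p) \<partial>N) \<le> ennreal (C * (\<beta> powr p) ^ i) * F"
  shows "(\<integral>\<^sup>+x. ennreal (\<bar>\<Sum>i\<le>n. h i x\<bar> powr p) \<partial>N) \<le> ennreal (C * (1 - \<beta>) powr (- p)) * F"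
  using assms(4-)
proof (induction n arbitrary: h C)
  case 0
  have "1 \<le> (1 - \<beta>) powr (- p)"
    using \<beta> p powr_mono2'[of "- p" "1 - \<beta>" 1] by auto
  then have "C * 1 \<le> C * (1 - \<beta>) powr (- p)"
    using 0 by (intro mult_left_mono) auto
  then have "ennreal C * F \<le> ennreal (C * (1 - \<beta>) powr (- p)) * F"
    by (intro mult_right_mono ennreal_leI) auto
  then show ?case using 0(3)[of 0] by simp
next
  case (Suc n)
  note [measurable] = Suc.prems(2)
  let ?b = "\<beta> powr p" and ?r = "\<lambda>x. \<Sum>i\<le>n. h (Suc i) x"
  have IH: "(\<integral>\<^sup>+x. ennreal (\<bar>?r x\<bar> powr p) \<partial>N) \<le> ennreal (C * ?b * (1 - \<beta>) powr (- p)) * F"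
    using Suc.prems(3)[of "Suc _"] Suc.prems(1)
    by (intro Suc.IH) (auto simp: mult.assoc)
  have "(\<integral>\<^sup>+x. ennreal (\<bar>\<Sum>i\<le>Suc n. h i x\<bar> powr p) \<partial>N) \<le>
     (\<integral>\<^sup>+x. ennreal ((1 - \<beta>) powr (1 - p)) * ennreal (\<bar>h 0 x\<bar> powr p)
        + ennreal (\<beta> powr (1 - p)) * ennreal (\<bar>?r x\<bar> powr p) \<partial>N)"
  proof (intro nn_integral_mono)
    fix x
    have "\<bar>\<Sum>i\<le>Suc n. h i x\<bar> = \<bar>h 0 x + ?r x\<bar>"
      by (simp only: sum.atMost_Suc_shift)
    also have "\<dots> powr p \<le> (\<bar>h 0 x\<bar> + \<bar>?r x\<bar>) powr p"
      using p by (intro powr_mono2) auto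
    also have "\<dots> \<le> (1 - \<beta>) powr (1 - p) * \<bar>h 0 x\<bar> powr p + \<beta> powr (1 - p) * \<bar>?r x\<bar> powr p"
      using p \<beta> by (intro powr_sum_convex) auto
    finally have "ennreal (\<bar>\<Sum>i\<le>Suc n. h i x\<bar> powr p) \<le> ennreal ((1 - \<beta>) powr (1 - p) * \<bar>h 0 x\<bar> powr p + \<beta> powr (1 - p) * \<bar>?r x\<bar> powr p)"
      by (rule ennreal_leI)
    then show "ennreal (\<bar>\<Sum>i\<le>Suc n. h i x\<bar> powr p) \<le> ennreal ((1 - \<beta>) powr (1 - p)) * ennreal (\<bar>h 0 x\<bar> powr p)
        + ennreal (\<beta> powr (1 - p)) * ennreal (\<bar>?r x\<bar> powr p)"
      by (simp add: ennreal_plus ennreal_mult)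
  qed
  also have "\<dots> = ennreal ((1 - \<beta>) powr (1 - p)) * (\<integral>\<^sup>+x. ennreal (\<bar>h 0 x\<bar> powr p) \<partial>N)
        + ennreal (\<beta> powr (1 - p)) * (\<integral>\<^sup>+x. ennreal (\<bar>?r x\<bar> powr p) \<partial>N)"
    by (simp add: nn_integral_add nn_integral_cmult)
  also have "\<dots> \<le> ennreal ((1 - \<beta>) powr (1 - p)) * (ennreal C * F)
        + ennreal (\<beta> powr (1 - p)) * (ennreal (C * ?b * (1 - \<beta>) powr (- p)) * F)"
    using Suc.prems(3)[of 0] IH by (intro add_mono mult_left_mono) auto
  also have "\<dots> = ennreal ((1 - \<beta>) powr (1 - p) * C + \<beta> powr (1 - p) * (C * ?b * (1 - \<beta>) powr (- p))) * F"
    using Suc.prems(1) by (simp add: ennreal_plus ennreal_mult distrib_right mult.assoc)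
  \<comment> \<open>The constant reproduces itself: after the common factor C (1 - \<beta>)^(-p) is
    taken out, the two terms contribute 1 - \<beta> and \<beta>.\<close>
  also have "(1 - \<beta>) powr (1 - p) * C + \<beta> powr (1 - p) * (C * ?b * (1 - \<beta>) powr (- p)) = C * (1 - \<beta>) powr (- p)"
  proof -
    have "(1 - \<beta>) powr (1 - p) = (1 - \<beta>) * (1 - \<beta>) powr (- p)"
      using \<beta> powr_add[of "1-\<beta>" 1 "-p"] by simp
    moreover have "\<beta> powr (1 - p) * ?b = \<beta>"
      using \<beta> by (simp flip: powr_add)
    ultimately show ?thesis
      by (metis (no_types, lifting) add.commute diff_add_cancel distrib_right mult.assoc mult.commute mult_1)
  qed
  finally show ?case .
qed

text \<open>A Marcinkiewicz-type argument: where \<open>\<tau> < (\<bar>Tf\<bar> / 2B)\<^sup>p\<^sup>-\<^sup>2\<close>, the part of \<open>f\<close> with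
  \<open>f\<^sup>p\<^sup>-\<^sup>2 \<le> \<tau>\<close> contributes at most \<open>\<bar>Tf\<bar> / 2\<close> to \<open>Tf\<close>, so \<open>\<bar>Tf\<bar>\<close> is controlled there by the image of
  the remaining part, to which the \<open>L\<^sup>2\<close> bound applies.\<close>

lemma kernel_interpolation:
  fixes k :: "'b \<Rightarrow> 'a \<Rightarrow> real" and f :: "'a \<Rightarrow> real"
  assumes "finite_measure M" "sigma_finite_measure N"
    and k[measurable]: "(\<lambda>(x, y). k x y) \<in> borel_measurable (N \<Otimes>\<^sub>M M)"
    and kb: "\<And>x y. \<bar>k x y\<bar> \<le> kb"
    and B: "0 < B" "\<And>x. (\<integral>y. \<bar>k x y\<bar> \<partial>M) \<le> B"
    and A: "0 \<le> A" "\<And>f. f \<in> borel_measurable M \<Longrightarrow> (\<And>y. 0 \<le> f y) \<Longrightarrow> integrable M (\<lambda>y. (f y)\<^sup>2) \<Longrightarrow>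
        (\<integral>\<^sup>+x. ennreal ((\<integral>y. k x y * f y \<partial>M)\<^sup>2) \<partial>N) \<le> ennreal A * (\<integral>\<^sup>+y. ennreal ((f y)\<^sup>2) \<partial>M)"
    and p: "2 \<le> p" and f[measurable]: "f \<in> borel_measurable M" and f0: "\<And>y. 0 \<le> f y"
    and fp: "integrable M (\<lambda>y. f y powr p)"
  shows "(\<integral>\<^sup>+x. ennreal (\<bar>\<integral>y. k x y * f y \<partial>M\<bar> powr p) \<partial>N)
    \<le> ennreal (4 * (2 * B) powr (p - 2) * A) * (\<integral>\<^sup>+y. ennreal (f y powr p) \<partial>M)"
proof -
  interpret M: finite_measure M by fact
  interpret N: sigma_finite_measure N by fact
  have powr2: "x powr 2 = x\<^sup>2" if "0 \<le> x" for x :: real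
    using that by (simp add: powr_numeral)
  have kx[measurable]: "k x \<in> borel_measurable M" if "x \<in> space N" for x
    using measurable_Pair2[OF k that] by simp
  have f2p: "(f y)\<^sup>2 \<le> 1 + f y powr p" for y
  proof (cases "f y \<le> 1")
    case True
    then show ?thesis using f0[of y] power_le_one[of "f y" 2] by (simp add: add_increasing2)
  next
    case False
    then have "f y powr 2 \<le> f y powr p" using p by (intro powr_mono) auto
    with f0[of y] False show ?thesis by (simp add: powr2)
  qed
  have int1p: "integrable M (\<lambda>y. 1 + f y powr p)" using fp by simp
  have intf: "integrable M f"
    by (rule M.integrable_of_powr_integrable[OF f f0 _ fp]) (use p in simp)
  have intf2: "integrable M (\<lambda>y. (f y)\<^sup>2)"
    using f2p by (intro integrable_real_bound[OF int1p]) auto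
  show ?thesis
  proof (cases "p = 2")
    \<comment> \<open>Here the exponent p - 2 is 0 and the levels f^(p-2) carry no information; the
      claim is the assumed quadratic bound with a spare factor 4.\<close>
    case True
    have "4 * (2 * B) powr (p - 2) * A \<ge> A" using True B A(1) by simp
    then have "ennreal A * (\<integral>\<^sup>+y. ennreal ((f y)\<^sup>2) \<partial>M)
       \<le> ennreal (4 * (2 * B) powr (p - 2) * A) * (\<integral>\<^sup>+y. ennreal ((f y)\<^sup>2) \<partial>M)"
      by (intro mult_right_mono ennreal_leI) auto
    with A(2)[OF f f0 intf2] show ?thesis using True f0 by (simp add: powr2)
  next
    case False
    define q where "q = p - 2"
    have q: "q > 0" using p False by (simp add: q_def)
    define T where "T g x = (\<integral>y. k x y * g y \<partial>M)" for g x
    \<comment> \<open>The part of \<open>f\<close> above level \<tau>, with levels measured by f^q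
      rather than f. The layer-cake integral then needs no weight: integrating the square of
      \<open>g \<tau>\<close> over \<tau> > 0 gives f^2 f^q = f^p.\<close>
    define g where "g \<tau> y = f y * indicator {\<tau>. \<tau> < f y powr q} \<tau>" for \<tau> y
    have gm: "(\<lambda>(\<tau>, y). g \<tau> y) \<in> borel_measurable (lborel \<Otimes>\<^sub>M M)"
    proof -
      have "(\<lambda>z. f (snd z) * (if fst z < f (snd z) powr q then 1 else 0)) \<in> borel_measurable (lborel \<Otimes>\<^sub>M M)"
        by measurable
      then show ?thesis
        by (rule measurable_cong[THEN iffD1, rotated]) (auto simp: g_def)
    qed
    have g0: "0 \<le> g \<tau> y" and gf: "g \<tau> y \<le> f y" for \<tau> y
      using f0[of y] by (auto simp: g_def indicator_def)
    have [measurable]: "g \<tau> \<in> borel_measurable M" for \<tau>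
      using measurable_Pair2[OF gm, of \<tau>] by simp
    have intg: "integrable M (g \<tau>)" for \<tau>
      using g0 gf by (intro integrable_real_bound[OF intf]) auto
    have intg2: "integrable M (\<lambda>y. (g \<tau> y)\<^sup>2)" for \<tau>
      using g0 gf by (intro integrable_real_bound[OF intf2]) (auto intro: power_mono)
    have intk: "integrable M (\<lambda>y. k x y * h y)" if h: "integrable M h" and x: "x \<in> space N" for h x
    proof (rule integrable_real_bound)
      show "integrable M (\<lambda>y. kb * \<bar>h y\<bar>)" using h by simp
      show "\<bar>k x y * h y\<bar> \<le> kb * \<bar>h y\<bar>" for y
        unfolding abs_mult using kb by (intro mult_right_mono) auto
    qed (use h x in measurable)
    have intabs: "integrable M (\<lambda>y. \<bar>k x y\<bar>)" if "x \<in> space N" for x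
      using intk[of "\<lambda>_. 1" x] that by simp
    have Tm: "(\<lambda>(x, \<tau>). T (g \<tau>) x) \<in> borel_measurable (N \<Otimes>\<^sub>M lborel)"
    proof -
      have "(\<lambda>z. k (fst (fst z)) (snd z) * (\<lambda>(\<tau>, y). g \<tau> y) (snd (fst z), snd z))
        \<in> borel_measurable ((N \<Otimes>\<^sub>M lborel) \<Otimes>\<^sub>M M)"
        using gm by measurable
      then have "(\<lambda>z. \<integral>y. k (fst z) y * g (snd z) y \<partial>M) \<in> borel_measurable (N \<Otimes>\<^sub>M lborel)"
        by (intro M.borel_measurable_lebesgue_integral) (simp add: case_prod_beta')
      then show ?thesis by (simp add: T_def case_prod_beta')
    qed
    have pt: "ennreal (\<bar>T f x\<bar> powr p) \<le>
       (\<integral>\<^sup>+\<tau>. ennreal (4 * (2 * B) powr q) * (ennreal ((T (g \<tau>) x)\<^sup>2) * indicator {0<..} \<tau>) \<partial>lborel)"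
      if x: "x \<in> space N" for x
    proof -
      \<comment> \<open>The threshold for which \<tau> < u means \<tau>^(1/q) < |T f x| / (2B); the
        part of \<open>f\<close> dropped from \<open>g \<tau>\<close> is at most
        \<tau>^(1/q).\<close>
      define u where "u = (\<bar>T f x\<bar> / (2 * B)) powr q"
      have step: "(T f x)\<^sup>2 \<le> 4 * (T (g \<tau>) x)\<^sup>2" if \<tau>: "0 < \<tau>" "\<tau> < u" for \<tau>
      proof -
        define l where "l = \<tau> powr (1 / q)"
        have l: "0 < l" "l < \<bar>T f x\<bar> / (2 * B)"
        proof -
          show "0 < l" using \<tau> by (simp add: l_def)
          have "l < u powr (1 / q)" unfolding l_def using \<tau> q by (intro powr_less_mono2) auto
          also have "\<dots> = \<bar>T f x\<bar> / (2 * B)" using q B by (simp add: u_def powr_powr)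
          finally show "l < \<bar>T f x\<bar> / (2 * B)" .
        qed
        have fg: "f y - g \<tau> y \<le> l" for y
        proof (cases "\<tau> < f y powr q")
          case True then show ?thesis using l by (simp add: g_def)
        next
          case False
          then have "(f y powr q) powr (1 / q) \<le> \<tau> powr (1 / q)" using q by (intro powr_mono2) auto
          then show ?thesis using False q f0[of y] by (simp add: g_def l_def powr_powr)
        qed
        have "T f x - T (g \<tau>) x = (\<integral>y. k x y * (f y - g \<tau> y) \<partial>M)"
          unfolding T_def using intk[OF intf x] intk[OF intg[of \<tau>] x]
          by (simp add: right_diff_distrib)
        also have "\<bar>\<dots>\<bar> \<le> (\<integral>y. \<bar>k x y * (f y - g \<tau> y)\<bar> \<partial>M)" by (rule integral_abs_bound)
        also have "\<dots> \<le> (\<integral>y. \<bar>k x y\<bar> * l \<partial>M)"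
        proof (intro integral_mono integrable_abs intk x)
          show "\<bar>k x y * (f y - g \<tau> y)\<bar> \<le> \<bar>k x y\<bar> * l" for y
            unfolding abs_mult using fg[of y] gf[of \<tau> y] by (intro mult_left_mono) auto
        qed (use intf intg intabs[OF x] in auto)
        also have "\<dots> \<le> B * l" using B(2)[of x] l by simp
        also have "\<dots> \<le> \<bar>T f x\<bar> / 2" using l B by (simp add: field_simps)
        finally have "\<bar>T f x - T (g \<tau>) x\<bar> \<le> \<bar>T f x\<bar> / 2" .
        then have "\<bar>T f x\<bar> \<le> 2 * \<bar>T (g \<tau>) x\<bar>" by linarith
        then have "\<bar>T f x\<bar>\<^sup>2 \<le> (2 * \<bar>T (g \<tau>) x\<bar>)\<^sup>2" by (intro power_mono) auto
        then show ?thesis by (simp add: power_mult_distrib)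
      qed
      \<comment> \<open>The factor \<open>u\<close> is the length of the interval of levels where
        \<open>step\<close> applies, so the p-th power turns into an integral over \<tau>.\<close>
      have "\<bar>T f x\<bar> powr p = (T f x)\<^sup>2 * (2 * B) powr q * u"
      proof -
        have "\<bar>T f x\<bar> powr p = \<bar>T f x\<bar> powr (2 + q)" by (simp add: q_def)
        also have "\<dots> = \<bar>T f x\<bar> powr 2 * \<bar>T f x\<bar> powr q" by (rule powr_add)
        also have "\<bar>T f x\<bar> powr q = (2 * B) powr q * u"
          unfolding u_def using B by (subst powr_mult[symmetric]) auto
        finally show ?thesis by (simp add: powr2)
      qed
      then have "ennreal (\<bar>T f x\<bar> powr p) = ennreal ((T f x)\<^sup>2 * (2 * B) powr q) * emeasure lborel {0<..<u}"
        by (simp add: ennreal_mult u_def)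
      also have "\<dots> = (\<integral>\<^sup>+\<tau>. ennreal ((T f x)\<^sup>2 * (2 * B) powr q) * indicator {0<..<u} \<tau> \<partial>lborel)"
        by (simp add: nn_integral_cmult_indicator)
      also have "\<dots> \<le> (\<integral>\<^sup>+\<tau>. ennreal (4 * (2 * B) powr q) * (ennreal ((T (g \<tau>) x)\<^sup>2) * indicator {0<..} \<tau>) \<partial>lborel)"
      proof (intro nn_integral_mono)
        fix \<tau> :: real
        show "ennreal ((T f x)\<^sup>2 * (2 * B) powr q) * indicator {0<..<u} \<tau>
          \<le> ennreal (4 * (2 * B) powr q) * (ennreal ((T (g \<tau>) x)\<^sup>2) * indicator {0<..} \<tau>)"
        proof (cases "0 < \<tau> \<and> \<tau> < u")
          case True
          then have "(T f x)\<^sup>2 * (2 * B) powr q \<le> (4 * (2 * B) powr q) * (T (g \<tau>) x)\<^sup>2"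
            using step[of \<tau>] mult_right_mono[of "(T f x)\<^sup>2" "4 * (T (g \<tau>) x)\<^sup>2" "(2*B) powr q"]
            by (simp add: mult_ac)
          then show ?thesis using True by (simp add: ennreal_leI flip: ennreal_mult)
        qed simp
      qed
      finally show ?thesis .
    qed
    have meas2: "(\<lambda>(x, \<tau>). ennreal (4 * (2 * B) powr q) * (ennreal ((T (g \<tau>) x)\<^sup>2) * indicator {0<..} \<tau>))
        \<in> borel_measurable (N \<Otimes>\<^sub>M lborel)"
      using Tm by (simp add: case_prod_beta') 
    have meas3: "(\<lambda>(\<tau>, y). ennreal ((g \<tau> y)\<^sup>2) * indicator {0<..} \<tau>) \<in> borel_measurable (lborel \<Otimes>\<^sub>M M)"
      using gm by (simp add: case_prod_beta')
    interpret P: pair_sigma_finite N "lborel :: real measure" ..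
    interpret Q: pair_sigma_finite "lborel :: real measure" M ..
    have "(\<integral>\<^sup>+x. ennreal (\<bar>T f x\<bar> powr p) \<partial>N) \<le>
       (\<integral>\<^sup>+x. \<integral>\<^sup>+\<tau>. ennreal (4 * (2 * B) powr q) * (ennreal ((T (g \<tau>) x)\<^sup>2) * indicator {0<..} \<tau>) \<partial>lborel \<partial>N)"
      by (intro nn_integral_mono pt)
    also have "\<dots> = (\<integral>\<^sup>+\<tau>. \<integral>\<^sup>+x. ennreal (4 * (2 * B) powr q) * (ennreal ((T (g \<tau>) x)\<^sup>2) * indicator {0<..} \<tau>) \<partial>N \<partial>lborel)"
      using P.Fubini'[OF meas2] by simp
    also have "\<dots> = (\<integral>\<^sup>+\<tau>. ennreal (4 * (2 * B) powr q) * ((\<integral>\<^sup>+x. ennreal ((T (g \<tau>) x)\<^sup>2) \<partial>N) * indicator {0<..} \<tau>) \<partial>lborel)"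
    proof (intro nn_integral_cong)
      fix \<tau>
      have [measurable]: "T (g \<tau>) \<in> borel_measurable N"
        using measurable_Pair1[OF Tm, of \<tau>] by simp
      show "(\<integral>\<^sup>+x. ennreal (4 * (2 * B) powr q) * (ennreal ((T (g \<tau>) x)\<^sup>2) * indicator {0<..} \<tau>) \<partial>N) =
        ennreal (4 * (2 * B) powr q) * ((\<integral>\<^sup>+x. ennreal ((T (g \<tau>) x)\<^sup>2) \<partial>N) * indicator {0<..} \<tau>)"
        by (simp add: nn_integral_cmult nn_integral_multc)
    qed
    also have "\<dots> \<le> (\<integral>\<^sup>+\<tau>. ennreal (4 * (2 * B) powr q * A) * (\<integral>\<^sup>+y. ennreal ((g \<tau> y)\<^sup>2) * indicator {0<..} \<tau> \<partial>M) \<partial>lborel)"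
    proof (intro nn_integral_mono)
      fix \<tau> :: real
      have "(\<integral>\<^sup>+x. ennreal ((T (g \<tau>) x)\<^sup>2) \<partial>N) \<le> ennreal A * (\<integral>\<^sup>+y. ennreal ((g \<tau> y)\<^sup>2) \<partial>M)"
        unfolding T_def by (rule A(2)) (auto simp: g0 intg2)
      then have "ennreal (4 * (2 * B) powr q) * ((\<integral>\<^sup>+x. ennreal ((T (g \<tau>) x)\<^sup>2) \<partial>N) * indicator {0<..} \<tau>)
        \<le> ennreal (4 * (2 * B) powr q) * (ennreal A * (\<integral>\<^sup>+y. ennreal ((g \<tau> y)\<^sup>2) \<partial>M) * indicator {0<..} \<tau>)"
        by (intro mult_left_mono mult_right_mono) auto
      also have "\<dots> = ennreal (4 * (2 * B) powr q * A) * (\<integral>\<^sup>+y. ennreal ((g \<tau> y)\<^sup>2) * indicator {0<..} \<tau> \<partial>M)"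
        using A(1) by (simp add: nn_integral_multc ennreal_mult mult.assoc)
      finally show "ennreal (4 * (2 * B) powr q) * ((\<integral>\<^sup>+x. ennreal ((T (g \<tau>) x)\<^sup>2) \<partial>N) * indicator {0<..} \<tau>) \<le> \<dots>" .
    qed
    also have "\<dots> = ennreal (4 * (2 * B) powr q * A) * (\<integral>\<^sup>+\<tau>. \<integral>\<^sup>+y. ennreal ((g \<tau> y)\<^sup>2) * indicator {0<..} \<tau> \<partial>M \<partial>lborel)"
      using M.borel_measurable_nn_integral[OF meas3] by (intro nn_integral_cmult) simp
    \<comment> \<open>Integrating over the levels first restores the p-th power of \<open>f\<close>
      pointwise.\<close>
    also have "(\<integral>\<^sup>+\<tau>. \<integral>\<^sup>+y. ennreal ((g \<tau> y)\<^sup>2) * indicator {0<..} \<tau> \<partial>M \<partial>lborel)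
       = (\<integral>\<^sup>+y. \<integral>\<^sup>+\<tau>. ennreal ((g \<tau> y)\<^sup>2) * indicator {0<..} \<tau> \<partial>lborel \<partial>M)"
      using Q.Fubini'[OF meas3] by simp
    also have "\<dots> = (\<integral>\<^sup>+y. ennreal (f y powr p) \<partial>M)"
    proof (intro nn_integral_cong)
      fix y
      have "(\<integral>\<^sup>+\<tau>. ennreal ((g \<tau> y)\<^sup>2) * indicator {0<..} \<tau> \<partial>lborel) =
        (\<integral>\<^sup>+\<tau>. ennreal ((f y)\<^sup>2) * indicator {0<..<f y powr q} \<tau> \<partial>lborel)"
        by (intro nn_integral_cong) (auto simp: g_def indicator_def)
      also have "\<dots> = ennreal ((f y)\<^sup>2) * ennreal (f y powr q)"
        by (simp add: nn_integral_cmult_indicator)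
      also have "\<dots> = ennreal (f y powr 2 * f y powr q)"
        using f0[of y] by (simp add: ennreal_mult powr2)
      also have "f y powr 2 * f y powr q = f y powr p" by (simp add: q_def flip: powr_add)
      finally show "(\<integral>\<^sup>+\<tau>. ennreal ((g \<tau> y)\<^sup>2) * indicator {0<..} \<tau> \<partial>lborel) = ennreal (f y powr p)" .
    qed
    finally show ?thesis by (simp add: T_def q_def)
  qed
qed


text \<open>Testing against \<open>h\<^sup>p\<^sup>-\<^sup>1\<close> with \<open>h = Tf\<close>; Young's inequality with a weight \<open>m\<close> replaces
  Hoelder's, and the fraction \<open>1/q\<close> of \<open>\<integral>h\<^sup>p\<close> is absorbed into the left-hand side.\<close>

lemma kernel_duality:
  fixes k :: "'b \<Rightarrow> 'a \<Rightarrow> real" and f :: "'a \<Rightarrow> real"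
  assumes "finite_measure M" "finite_measure N"
    and k[measurable]: "(\<lambda>(x, y). k x y) \<in> borel_measurable (N \<Otimes>\<^sub>M M)"
    and kb: "\<And>x y. 0 \<le> k x y" "\<And>x y. k x y \<le> kb"
    and p: "1 < p" and q: "1 / p + 1 / q = 1" and C: "0 < C"
    and dual: "\<And>g. g \<in> borel_measurable N \<Longrightarrow> (\<And>x. 0 \<le> g x) \<Longrightarrow> integrable N (\<lambda>x. g x powr q) \<Longrightarrow>
        (\<integral>\<^sup>+y. ennreal ((\<integral>x. k x y * g x \<partial>N) powr q) \<partial>M) \<le> ennreal C * (\<integral>\<^sup>+x. ennreal (g x powr q) \<partial>N)"
    and f[measurable]: "f \<in> borel_measurable M" and f0: "\<And>y. 0 \<le> f y"
    and fp: "integrable M (\<lambda>y. f y powr p)"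
  shows "(\<integral>\<^sup>+x. ennreal ((\<integral>y. k x y * f y \<partial>M) powr p) \<partial>N)
    \<le> ennreal (C powr (p / q)) * (\<integral>\<^sup>+y. ennreal (f y powr p) \<partial>M)"
proof -
  interpret M: finite_measure M by fact
  interpret N: finite_measure N by fact
  interpret P: pair_sigma_finite N M ..
  have q1: "q > 1"
  proof -
    have "1 / q = 1 - 1 / p" "1 / p < 1" "0 < 1 / p" using p q by auto
    then have "0 < 1 / q" "1 / q < 1" by auto
    then show ?thesis by (simp add: field_simps split: if_splits)
  qed
  have pq: "(p - 1) * q = p" using p q q1 by (simp add: field_simps)
  define h where "h x = (\<integral>y. k x y * f y \<partial>M)" for x
  have kx[measurable]: "k x \<in> borel_measurable M" if "x \<in> space N" for x
    using measurable_Pair2[OF k that] by simp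
  have ky[measurable]: "(\<lambda>x. k x y) \<in> borel_measurable N" if "y \<in> space M" for y
    using measurable_Pair1[OF k that] by simp
  have [measurable]: "h \<in> borel_measurable N" unfolding h_def
    by (intro M.borel_measurable_lebesgue_integral) measurable
  have intf: "integrable M f"
    by (rule M.integrable_of_powr_integrable[OF f f0 _ fp]) (use p in simp)
  define H where "H = kb * (\<integral>y. f y \<partial>M)"
  have intkf: "integrable M (\<lambda>y. k x y * f y)" if x: "x \<in> space N" for x
  proof (rule integrable_real_bound)
    show "integrable M (\<lambda>y. kb * f y)" using intf by simp
    show "\<bar>k x y * f y\<bar> \<le> kb * f y" for y
      using kb[of x y] f0[of y] by (simp add: mult_right_mono)
  qed (use x in measurable)
  have h0: "0 \<le> h x" for x unfolding h_def using kb f0 by (intro integral_nonneg_AE) auto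
  have hH: "h x \<le> H" if "x \<in> space N" for x
  proof -
    have "h x \<le> (\<integral>y. kb * f y \<partial>M)" unfolding h_def
      using intkf[OF that] intf kb f0 by (intro integral_mono) (auto intro: mult_right_mono)
    then show ?thesis by (simp add: H_def)
  qed
  \<comment> \<open>The bounded kernel makes \<open>h\<close> bounded on a finite measure space.
    Hence the integral of h^p is finite, which the absorption at the end depends on.\<close>
  have hp: "integrable N (\<lambda>x. h x powr r)" if "r \<ge> 0" for r
    using hH h0 that by (intro N.integrable_const_bound[where B = "H powr r"]) (auto intro!: AE_I2 powr_mono2)
  define g where "g x = h x powr (p - 1)" for x
  have [measurable]: "g \<in> borel_measurable N" unfolding g_def by measurable
  have g0: "0 \<le> g x" for x by (simp add: g_def)
  have gq: "g x powr q = h x powr p" for x by (simp add: g_def powr_powr pq)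
  have intg: "integrable N g" unfolding g_def using hp[of "p - 1"] p by simp
  define S where "S y = (\<integral>x. k x y * g x \<partial>N)" for y
  have S0: "0 \<le> S y" for y unfolding S_def using kb g0 by (intro integral_nonneg_AE) auto
  have [measurable]: "S \<in> borel_measurable M" unfolding S_def
  proof (rule N.borel_measurable_lebesgue_integral)
    have "(\<lambda>(y, x). k x y) \<in> borel_measurable (M \<Otimes>\<^sub>M N)"
      using measurable_pair_swap[OF k] by simp
    then show "(\<lambda>(y, x). k x y * g x) \<in> borel_measurable (M \<Otimes>\<^sub>M N)"
      by (simp add: case_prod_beta')
  qed
  have SD: "(\<integral>\<^sup>+y. ennreal (S y powr q) \<partial>M) \<le> ennreal C * (\<integral>\<^sup>+x. ennreal (h x powr p) \<partial>N)"
    using dual[of g] g0 hp[of p] p by (simp add: S_def gq)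
  define I where "I = (\<integral>\<^sup>+x. ennreal (h x powr p) \<partial>N)"
  define J where "J = (\<integral>\<^sup>+y. ennreal (f y powr p) \<partial>M)"
  have Ifin: "I < top" and Jfin: "J < top"
    using hp[of p] fp p by (auto simp: I_def J_def integrable_iff_bounded less_top[symmetric])
  \<comment> \<open>With this weight m^(-q) C = 1, so the term containing \<open>S\<close> is
    exactly I / q. What remains on the left is I / p, and the other term carries m^p =
    C^(p/q).\<close>
  define m where "m = C powr (1 / q)"
  have m: "m > 0" "m powr q = C" "m powr p = C powr (p / q)"
    using C q1 by (simp_all add: m_def powr_powr)
  have "I = (\<integral>\<^sup>+x. ennreal (g x) * (\<integral>\<^sup>+y. ennreal (k x y * f y) \<partial>M) \<partial>N)"
    unfolding I_def
  proof (intro nn_integral_cong)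
    fix x assume x: "x \<in> space N"
    have "(\<integral>\<^sup>+y. ennreal (k x y * f y) \<partial>M) = ennreal (h x)"
      unfolding h_def using intkf[OF x] kb f0 by (intro nn_integral_eq_integral) auto
    moreover have "h x powr p = g x * h x"
      using h0[of x] powr_add[of "h x" "p - 1" 1] p by (cases "h x = 0") (auto simp: g_def)
    ultimately show "ennreal (h x powr p) = ennreal (g x) * (\<integral>\<^sup>+y. ennreal (k x y * f y) \<partial>M)"
      using g0 h0 by (simp add: ennreal_mult)
  qed
  also have "\<dots> = (\<integral>\<^sup>+x. \<integral>\<^sup>+y. ennreal (f y * (k x y * g x)) \<partial>M \<partial>N)"
    using g0 f0 kb by (intro nn_integral_cong) (auto simp flip: nn_integral_cmult ennreal_mult' simp: mult_ac)
  also have "\<dots> = (\<integral>\<^sup>+y. \<integral>\<^sup>+x. ennreal (f y * (k x y * g x)) \<partial>N \<partial>M)"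
    by (rule P.Fubini'[symmetric]) measurable
  also have "\<dots> = (\<integral>\<^sup>+y. ennreal (f y * S y) \<partial>M)"
  proof (intro nn_integral_cong)
    fix y assume y: "y \<in> space M"
    have "integrable N (\<lambda>x. k x y * g x)"
    proof (rule integrable_real_bound)
      show "integrable N (\<lambda>x. kb * g x)" using intg by simp
      show "\<bar>k x y * g x\<bar> \<le> kb * g x" for x
        using kb[of x y] g0[of x] by (simp add: mult_right_mono)
    qed (use y in measurable)
    then have "(\<integral>\<^sup>+x. ennreal (f y * (k x y * g x)) \<partial>N) = ennreal (\<integral>x. f y * (k x y * g x) \<partial>N)"
      using f0 kb g0 by (intro nn_integral_eq_integral) auto
    then show "(\<integral>\<^sup>+x. ennreal (f y * (k x y * g x)) \<partial>N) = ennreal (f y * S y)"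
      by (simp add: S_def)
  qed
  also have "\<dots> \<le> (\<integral>\<^sup>+y. ennreal (m powr p / p) * ennreal (f y powr p)
      + ennreal (m powr (- q) / q) * ennreal (S y powr q) \<partial>M)"
  proof (intro nn_integral_mono)
    fix y
    have "(m * f y) * (S y / m) \<le> (m * f y) powr p / p + (S y / m) powr q / q"
      using p q1 q m f0 S0 by (intro Youngs_inequality) auto
    then have "f y * S y \<le> m powr p / p * f y powr p + m powr (- q) / q * S y powr q"
      using m f0 S0 by (simp add: powr_mult powr_divide powr_minus field_simps)
    then have "ennreal (f y * S y) \<le> ennreal (m powr p / p * f y powr p + m powr (- q) / q * S y powr q)"
      by (rule ennreal_leI)
    also have "\<dots> = ennreal (m powr p / p) * ennreal (f y powr p)
      + ennreal (m powr (- q) / q) * ennreal (S y powr q)"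
      using p q1 by (intro ennreal_mult_plus) auto
    finally show "ennreal (f y * S y) \<le> ennreal (m powr p / p) * ennreal (f y powr p)
      + ennreal (m powr (- q) / q) * ennreal (S y powr q)" .
  qed
  also have "\<dots> = ennreal (m powr p / p) * J + ennreal (m powr (- q) / q) * (\<integral>\<^sup>+y. ennreal (S y powr q) \<partial>M)"
    by (simp add: nn_integral_add nn_integral_cmult J_def)
  also have "\<dots> \<le> ennreal (m powr p / p) * J + ennreal (m powr (- q) / q) * (ennreal C * I)"
    using SD by (intro add_left_mono mult_left_mono) (auto simp: I_def)
  finally have main: "I \<le> \<dots>" .
  obtain i where i: "I = ennreal i" "0 \<le> i" using Ifin by (cases I) auto
  obtain j where j: "J = ennreal j" "0 \<le> j" using Jfin by (cases J) auto
  have "ennreal i \<le> ennreal (m powr p / p * j + m powr (- q) / q * (C * i))"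
  proof -
    have "ennreal (m powr p / p * j + m powr (- q) / q * (C * i))
      = ennreal (m powr p / p) * J + ennreal (m powr (- q) / q) * (ennreal C * I)"
      using i j C p q1 by (subst ennreal_mult_plus) (auto simp: ennreal_mult)
    then show ?thesis using main i by simp
  qed
  then have "i \<le> m powr p / p * j + m powr (- q) / q * (C * i)"
    using i j C p q1 by (subst (asm) ennreal_le_iff) auto
  also have "m powr (- q) / q * (C * i) = i / q"
    using m C by (simp add: powr_minus field_simps)
  finally have "i * (1 - 1 / q) \<le> m powr p / p * j" by (simp add: algebra_simps)
  moreover have "1 - 1 / q = 1 / p" using q by simp
  ultimately have "i \<le> C powr (p / q) * j" using p m by (simp add: field_simps)
  then have "I \<le> ennreal (C powr (p / q)) * J"
    using i j by (simp flip: ennreal_mult')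
  then show ?thesis by (simp add: I_def J_def h_def)
qed

section \<open>Frostman measures\<close>

text \<open>Collects what \<mu> and \<nu> have in common, because the two measures exchange roles in
  the dual range.\<close>

locale frostman = finite_measure M for M :: "(real ^ 3) measure" +
  fixes a C :: real
  assumes sets_M: "sets M = sets borel" and a_nonneg: "0 \<le> a" and a_le: "a \<le> 3" and C_pos: "0 < C"
    and ball_le: "\<And>x r. 0 < r \<Longrightarrow> emeasure M (ball x r) \<le> ennreal (C * r powr a)"
begin

lemma measurable_M: "borel_measurable M = borel_measurable borel"
  by (rule measurable_cong_sets[OF sets_M refl])

text \<open>Dyadic balls of radius 2^k \<delta>: there the Gaussian is at most 128 / 16^k times
  \<delta>^(-3), while a \<le> 3 limits the growth of the mass to 8^k. The ratio 1/2 remains, and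
  the series contributes the factor 2 in 256.\<close>

lemma nn_integral_heat_le:
  assumes \<delta>: "0 < \<delta>"
  shows "(\<integral>\<^sup>+y. ennreal (heat \<delta> (x - y)) \<partial>M) \<le> ennreal (256 * C * \<delta> powr (a - 3))"
proof -
  note sets_M[measurable_cong]
  define c where "c k = 128 / 16 ^ k / \<delta> ^ 3" for k :: nat
  have pt: "ennreal (heat \<delta> (x - y)) \<le> (\<Sum>k. ennreal (c k) * indicator (ball x (2 ^ k * \<delta>)) y)" for y
  proof -
    define P where "P k \<longleftrightarrow> dist x y < 2 ^ k * \<delta>" for k :: nat
    have "\<exists>k. P k"
    proof -
      obtain k where "dist x y / \<delta> < 2 ^ k" using real_arch_pow[of 2 "dist x y / \<delta>"] by auto
      then show ?thesis using \<delta> by (auto simp: P_def field_simps)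
    qed
    then have Pk: "P (LEAST k. P k)" by (rule LeastI_ex)
    \<comment> \<open>By minimality, when \<open>k = Suc j\<close> the distance from
      \<open>x\<close> to \<open>y\<close> is at least 2^j \<delta>.\<close>
    define k where "k = (LEAST k. P k)"
    have bound: "exp (- (dist x y)\<^sup>2 / (2 * \<delta>\<^sup>2)) \<le> 128 / 16 ^ k"
    proof (cases k)
      case 0
      have "exp (- (dist x y)\<^sup>2 / (2 * \<delta>\<^sup>2)) \<le> 1" by simp
      also have "1 \<le> 128 / (16::real) ^ k" using 0 by simp
      finally show ?thesis .
    next
      case (Suc j)
      then have "\<not> P j" using not_less_Least[of j P] by (simp add: k_def)
      then have j: "2 ^ j * \<delta> \<le> dist x y" by (simp add: P_def)
      define u where "u = (dist x y)\<^sup>2 / (2 * \<delta>\<^sup>2)"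
      have "(2 ^ j * \<delta>)\<^sup>2 \<le> (dist x y)\<^sup>2" using j \<delta> by (intro power_mono) auto
      moreover have "((2::real) ^ j)\<^sup>2 = 4 ^ j" by (simp add: power2_eq_square flip: power_mult_distrib)
      ultimately have u: "4 ^ j / 2 \<le> u"
        using \<delta> by (simp add: u_def power_mult_distrib pos_le_divide_eq)
      have upos: "0 < u" by (rule less_le_trans[OF _ u]) simp
      \<comment> \<open>Quadratic growth of exp is enough: u \<ge> 4^j / 2 gives exp(-u) \<le> 8 /
        16^j, which is 128 / 16^(j+1).\<close>
      have "u\<^sup>2 / 2 \<le> exp u" using exp_lower_Taylor_quadratic[of u] upos by simp
      moreover have "(4 ^ j / 2)\<^sup>2 \<le> u\<^sup>2" using u by (intro power_mono) auto
      ultimately have "16 ^ j / 8 \<le> exp u"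
        by (simp add: power_divide power2_eq_square flip: power_mult_distrib)
      then have "exp (- u) \<le> 8 / 16 ^ j"
        by (simp add: exp_minus field_simps)
      then show ?thesis using Suc by (simp add: u_def)
    qed
    have "ennreal (heat \<delta> (x - y)) \<le> ennreal (c k) * indicator (ball x (2 ^ k * \<delta>)) y"
    proof -
      have "y \<in> ball x (2 ^ k * \<delta>)" using Pk by (simp add: k_def P_def)
      moreover have "heat \<delta> (x - y) \<le> c k"
        using divide_right_mono[OF bound, of "\<delta> ^ 3"] \<delta> by (simp add: heat_def c_def dist_norm)
      ultimately show ?thesis by (simp add: ennreal_leI)
    qed
    also have "\<dots> \<le> (\<Sum>k. ennreal (c k) * indicator (ball x (2 ^ k * \<delta>)) y)"
    proof -
      define g where "g k = ennreal (c k) * indicator (ball x (2 ^ k * \<delta>)) y" for k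
      have "g k \<le> (\<Sum>k. g k)" using sum_le_suminf[of g "{k}"] by simp
      then show ?thesis by (simp only: g_def)
    qed
    finally show ?thesis .
  qed
  have "(\<integral>\<^sup>+y. ennreal (heat \<delta> (x - y)) \<partial>M) \<le> (\<integral>\<^sup>+y. (\<Sum>k. ennreal (c k) * indicator (ball x (2 ^ k * \<delta>)) y) \<partial>M)"
    by (intro nn_integral_mono pt)
  also have "\<dots> = (\<Sum>k. ennreal (c k) * emeasure M (ball x (2 ^ k * \<delta>)))"
    by (subst nn_integral_suminf)
      (auto simp: nn_integral_cmult_indicator sets_M measurable_M
        intro!: borel_measurable_times_ennreal borel_measurable_indicator)
  also have "\<dots> \<le> (\<Sum>k. ennreal (128 * C * \<delta> powr (a - 3) * (1 / 2) ^ k))"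
  proof (intro suminf_le)
    fix k :: nat
    have "ennreal (c k) * emeasure M (ball x (2 ^ k * \<delta>)) \<le> ennreal (c k) * ennreal (C * (2 ^ k * \<delta>) powr a)"
      using \<delta> by (intro mult_left_mono ball_le) auto
    also have "\<dots> = ennreal (c k * (C * (2 ^ k * \<delta>) powr a))"
      by (rule ennreal_mult[symmetric]) (use \<delta> C_pos in \<open>auto simp: c_def\<close>)
    also have "c k * (C * (2 ^ k * \<delta>) powr a) \<le> c k * (C * (8 ^ k * \<delta> powr a))"
    proof -
      have "(2 ^ k) powr a \<le> (2 ^ k) powr (3::real)" using a_le by (intro powr_mono) auto
      also have "\<dots> = (8::real) ^ k" by (simp add: powr_numeral power2_eq_square power3_eq_cube flip: power_mult_distrib)
      finally have "(2 ^ k * \<delta>) powr a \<le> 8 ^ k * \<delta> powr a"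
        using \<delta> by (simp add: powr_mult mult_right_mono)
      then show ?thesis using \<delta> C_pos by (intro mult_left_mono) (auto simp: c_def)
    qed
    also have "\<dots> = 128 * C * \<delta> powr (a - 3) * (1 / 2) ^ k"
    proof -
      have "\<delta> powr (a - 3) = \<delta> powr a / \<delta> ^ 3" using \<delta> by (simp add: powr_diff powr_numeral)
      moreover have "(16::real) ^ k = 8 ^ k * 2 ^ k" by (simp flip: power_mult_distrib)
      ultimately show ?thesis by (simp add: c_def field_simps power_divide)
    qed
    finally show "ennreal (c k) * emeasure M (ball x (2 ^ k * \<delta>)) \<le> ennreal (128 * C * \<delta> powr (a - 3) * (1 / 2) ^ k)"
      by (simp add: ennreal_leI)
  qed auto
  also have "\<dots> = ennreal (\<Sum>k. 128 * C * \<delta> powr (a - 3) * (1 / 2) ^ k)"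
    using C_pos by (intro suminf_ennreal2) (auto intro!: summable_mult summable_geometric)
  also have "(\<Sum>k. 128 * C * \<delta> powr (a - 3) * (1 / 2) ^ k) = 256 * C * \<delta> powr (a - 3)"
    by (subst suminf_mult) (auto intro!: summable_geometric simp: suminf_geometric)
  finally show ?thesis .
qed

lemma integrable_heat:
  assumes \<delta>: "0 < \<delta>"
  shows "integrable M (\<lambda>y. heat \<delta> (x - y))"
proof (rule integrable_const_bound[where B = "1 / \<delta> ^ 3"])
  show "AE y in M. norm (heat \<delta> (x - y)) \<le> 1 / \<delta> ^ 3"
    using abs_heat_le[OF \<delta>, where 'a = "real ^ 3"] by (intro AE_I2) simp
qed (simp add: measurable_M)

lemma integral_heat_le:
  assumes \<delta>: "0 < \<delta>"
  shows "(\<integral>y. heat \<delta> (x - y) \<partial>M) \<le> 256 * C * \<delta> powr (a - 3)"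
proof -
  have "ennreal (\<integral>y. heat \<delta> (x - y) \<partial>M) = (\<integral>\<^sup>+y. ennreal (heat \<delta> (x - y)) \<partial>M)"
    using integrable_heat[OF \<delta>] heat_nonneg[OF \<delta>] by (intro nn_integral_eq_integral[symmetric]) auto
  also have "\<dots> \<le> ennreal (256 * C * \<delta> powr (a - 3))" by (rule nn_integral_heat_le[OF \<delta>])
  finally show ?thesis using C_pos by (subst (asm) ennreal_le_iff) auto
qed

text \<open>Parseval turns the energy into the quadratic form of \<open>heat \<delta>\<close> on the
  space of square integrable functions. Schur's test finishes: f(x) f(y) is at most the mean of the
  two squares, and by symmetry of the kernel both halves reduce to the bound of
  \<open>integral_heat_le\<close>.\<close>

lemma fourier_energy_le:
  assumes \<delta>: "0 < \<delta>" and f: "integrable M f" and f2: "integrable M (\<lambda>y. (f y)\<^sup>2)"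
  shows "(\<integral>\<xi>. gauss_weight \<delta> \<xi> * (norm (fourier M f \<xi>))\<^sup>2 \<partial>lborel)
    \<le> sqrt (2 * pi) ^ 3 * (256 * C * \<delta> powr (a - 3)) * (\<integral>y. (f y)\<^sup>2 \<partial>M)"
proof -
  interpret P: pair_sigma_finite M M ..
  note sets_M[measurable_cong]
  have sf: "sigma_finite_measure M" ..
  have [measurable]: "f \<in> borel_measurable M" using f by auto
  let ?\<kappa> = "sqrt (2 * pi) ^ 3" and ?B = "256 * C * \<delta> powr (a - 3)"
  let ?X = "\<integral>x. f x * (\<integral>y. heat \<delta> (x - y) * f y \<partial>M) \<partial>M"
  have "(\<integral>x. of_real (f x) * (\<integral>y. complex_of_real (?\<kappa> * heat \<delta> (x - y)) * of_real (f y) \<partial>M) \<partial>M)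
    = (\<integral>\<xi>. of_real (gauss_weight \<delta> \<xi>) * fourier M f \<xi> * cnj (fourier M f \<xi>) \<partial>lborel)"
    using gaussian_fourier[OF \<delta>, where 'a = "real ^ 3"] integrable_gauss_weight[OF \<delta>]
    by (intro fourier_parseval[OF sf sets_M sf sets_M f f]) auto
  also have "\<dots> = (\<integral>\<xi>. complex_of_real (gauss_weight \<delta> \<xi> * (norm (fourier M f \<xi>))\<^sup>2) \<partial>lborel)"
    by (intro Bochner_Integration.integral_cong refl) (simp add: mult.assoc complex_norm_square[symmetric])
  also have "\<dots> = complex_of_real (\<integral>\<xi>. gauss_weight \<delta> \<xi> * (norm (fourier M f \<xi>))\<^sup>2 \<partial>lborel)"
    by (rule integral_complex_of_real)
  finally have "complex_of_real (\<integral>\<xi>. gauss_weight \<delta> \<xi> * (norm (fourier M f \<xi>))\<^sup>2 \<partial>lborel)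
    = (\<integral>x. complex_of_real (?\<kappa> * (f x * (\<integral>y. heat \<delta> (x - y) * f y \<partial>M))) \<partial>M)"
    by (simp add: mult_ac flip: of_real_mult integral_mult_right_zero)
  then have eq: "(\<integral>\<xi>. gauss_weight \<delta> \<xi> * (norm (fourier M f \<xi>))\<^sup>2 \<partial>lborel) = ?\<kappa> * ?X"
    by (simp only: integral_complex_of_real of_real_eq_iff integral_mult_right_zero)
  have u: "(\<lambda>z. heat \<delta> (fst z - snd z)) \<in> borel_measurable (M \<Otimes>\<^sub>M M)" by measurable
  have ub: "norm (heat \<delta> (fst z - snd z :: real ^ 3)) \<le> 1 / \<delta> ^ 3" for z
    using abs_heat_le[OF \<delta>, where 'a = "real ^ 3"] by simp
  have one: "integrable M (\<lambda>_. 1 :: real)" by simp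
  have i1: "integrable (M \<Otimes>\<^sub>M M) (\<lambda>(x, y). heat \<delta> (x - y) * (f x * f y))"
    using integrable_pair_bounded_mult[OF sf sf f f u ub] by simp
  have i2: "integrable (M \<Otimes>\<^sub>M M) (\<lambda>(x, y). heat \<delta> (x - y) * (f x)\<^sup>2)"
    using integrable_pair_bounded_mult[OF sf sf f2 one u ub] by simp
  have i3: "integrable (M \<Otimes>\<^sub>M M) (\<lambda>(x, y). heat \<delta> (x - y) * (f y)\<^sup>2)"
    using integrable_pair_bounded_mult[OF sf sf one f2 u ub] by simp
  have hsym: "heat \<delta> (x - y) = heat \<delta> (y - x)" for x y :: "real ^ 3"
    by (simp add: heat_def norm_minus_commute)
  have row: "(\<integral>x. (f x)\<^sup>2 * (\<integral>y. heat \<delta> (x - y) \<partial>M) \<partial>M) \<le> ?B * (\<integral>x. (f x)\<^sup>2 \<partial>M)"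
  proof -
    have "(\<integral>x. (f x)\<^sup>2 * (\<integral>y. heat \<delta> (x - y) \<partial>M) \<partial>M) \<le> (\<integral>x. (f x)\<^sup>2 * ?B \<partial>M)"
    proof (rule integral_mono)
      show "integrable M (\<lambda>x. (f x)\<^sup>2 * (\<integral>y. heat \<delta> (x - y) \<partial>M))"
        using P.integrable_fst[OF i2] by (simp add: mult.commute)
      show "integrable M (\<lambda>x. (f x)\<^sup>2 * ?B)" using f2 by simp
      show "(f x)\<^sup>2 * (\<integral>y. heat \<delta> (x - y) \<partial>M) \<le> (f x)\<^sup>2 * ?B" for x
        by (intro mult_left_mono integral_heat_le \<delta>) auto
    qed
    then show ?thesis by (simp add: mult.commute)
  qed
  have "?X = (\<integral>x. (\<integral>y. heat \<delta> (x - y) * (f x * f y) \<partial>M) \<partial>M)"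
    by (simp add: mult_ac flip: integral_mult_right_zero)
  also have "\<dots> = (\<integral>(x, y). heat \<delta> (x - y) * (f x * f y) \<partial>(M \<Otimes>\<^sub>M M))"
    by (rule P.integral_fst[OF i1])
  also have "\<dots> \<le> (\<integral>z. ((\<lambda>(x, y). heat \<delta> (x - y) * (f x)\<^sup>2) z + (\<lambda>(x, y). heat \<delta> (x - y) * (f y)\<^sup>2) z) / 2 \<partial>(M \<Otimes>\<^sub>M M))"
  proof (rule integral_mono[OF i1])
    show "integrable (M \<Otimes>\<^sub>M M) (\<lambda>z. ((\<lambda>(x, y). heat \<delta> (x - y) * (f x)\<^sup>2) z + (\<lambda>(x, y). heat \<delta> (x - y) * (f y)\<^sup>2) z) / 2)"
      by (intro integrable_divide Bochner_Integration.integrable_add i2 i3)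
    fix z :: "(real ^ 3) \<times> (real ^ 3)"
    obtain x y where z: "z = (x, y)" by (cases z)
    have "f x * f y \<le> ((f x)\<^sup>2 + (f y)\<^sup>2) / 2" using sum_squares_bound[of "f x" "f y"] by simp
    then have "heat \<delta> (x - y) * (f x * f y) \<le> heat \<delta> (x - y) * (((f x)\<^sup>2 + (f y)\<^sup>2) / 2)"
      by (intro mult_left_mono heat_nonneg \<delta>)
    then show "(case z of (x, y) \<Rightarrow> heat \<delta> (x - y) * (f x * f y))
      \<le> ((case z of (x, y) \<Rightarrow> heat \<delta> (x - y) * (f x)\<^sup>2) + (case z of (x, y) \<Rightarrow> heat \<delta> (x - y) * (f y)\<^sup>2)) / 2"
      by (simp add: z algebra_simps)
  qed
  also have "\<dots> = ((\<integral>(x, y). heat \<delta> (x - y) * (f x)\<^sup>2 \<partial>(M \<Otimes>\<^sub>M M)) + (\<integral>(x, y). heat \<delta> (x - y) * (f y)\<^sup>2 \<partial>(M \<Otimes>\<^sub>M M))) / 2"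
    using i2 i3 by (simp only: integral_divide_zero Bochner_Integration.integral_add)
  also have "(\<integral>(x, y). heat \<delta> (x - y) * (f x)\<^sup>2 \<partial>(M \<Otimes>\<^sub>M M)) = (\<integral>x. (f x)\<^sup>2 * (\<integral>y. heat \<delta> (x - y) \<partial>M) \<partial>M)"
    unfolding P.integral_fst[OF i2, symmetric] by (simp add: mult.commute)
  also have "(\<integral>(x, y). heat \<delta> (x - y) * (f y)\<^sup>2 \<partial>(M \<Otimes>\<^sub>M M)) = (\<integral>y. (f y)\<^sup>2 * (\<integral>x. heat \<delta> (y - x) \<partial>M) \<partial>M)"
    unfolding P.integral_snd[OF i3, symmetric] by (simp add: mult.commute hsym)
  finally have "?X \<le> ?B * (\<integral>x. (f x)\<^sup>2 \<partial>M)" using row by simp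
  then have "?\<kappa> * ?X \<le> ?\<kappa> * (?B * (\<integral>x. (f x)\<^sup>2 \<partial>M))" by (intro mult_left_mono) auto
  then show ?thesis unfolding eq by (simp only: mult.assoc)
qed

end

text \<open>Bounds the bilinear form \<open>\<langle>Tf, g\<rangle> = \<integral>m (f\<mu>)\<^sup>^ cnj (g\<nu>)\<^sup>^\<close> at \<open>g = Tf\<close> by two Gaussian energies,
  with a weighted AM-GM inequality whose weight is chosen so that half of \<open>\<parallel>Tf\<parallel>\<^sup>2\<close> is absorbed.\<close>

lemma multiplier_L2_bound:
  fixes k :: "real ^ 3 \<Rightarrow> real" and m :: "real ^ 3 \<Rightarrow> complex"
  assumes "frostman M a C" "frostman N b D" and \<delta>: "0 < \<delta>" and \<Lambda>: "0 < \<Lambda>"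
    and m: "integrable lborel m" "\<And>\<xi>. norm (m \<xi>) \<le> \<Lambda> * gauss_weight \<delta> \<xi>"
    and k: "\<And>z. complex_of_real (k z) = (\<integral>\<xi>. cis (\<xi> \<bullet> z) * m \<xi> \<partial>lborel)"
    and k_meas[measurable]: "k \<in> borel_measurable borel"
    and f: "f \<in> borel_measurable M" and f2: "integrable M (\<lambda>y. (f y)\<^sup>2)"
  shows "(\<integral>\<^sup>+x. ennreal ((\<integral>y. k (x - y) * f y \<partial>M)\<^sup>2) \<partial>N)
    \<le> ennreal ((\<Lambda> * sqrt (2 * pi) ^ 3)\<^sup>2 * (256 * C * \<delta> powr (a - 3)) * (256 * D * \<delta> powr (b - 3)))
      * (\<integral>\<^sup>+y. ennreal ((f y)\<^sup>2) \<partial>M)"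
proof -
  interpret M: frostman M a C by fact
  interpret N: frostman N b D by fact
  note M.sets_M[measurable_cong] N.sets_M[measurable_cong] f[measurable]
  have sfM: "sigma_finite_measure M" and sfN: "sigma_finite_measure N" ..
  have f': "f \<in> borel_measurable borel" using f by (simp add: M.measurable_M)
  define \<kappa> where "\<kappa> = sqrt (2 * pi) ^ 3"
  define P where "P = 256 * C * \<delta> powr (a - 3)"
  define Q where "Q = 256 * D * \<delta> powr (b - 3)"
  have \<kappa>: "0 < \<kappa>" by (simp add: \<kappa>_def)
  have PQ: "0 < P" "0 < Q" using M.C_pos N.C_pos \<delta> by (auto simp: P_def Q_def)
  have f1: "integrable M f"
  proof (rule Bochner_Integration.integrable_bound)
    show "integrable M (\<lambda>y. 1 + (f y)\<^sup>2)" using f2 by simp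
    show "AE y in M. norm (f y) \<le> norm (1 + (f y)\<^sup>2)"
    proof (intro AE_I2)
      fix y
      have "2 * \<bar>f y\<bar> \<le> 1 + \<bar>f y\<bar>\<^sup>2" using sum_squares_bound[of 1 "\<bar>f y\<bar>"] by simp
      then show "norm (f y) \<le> norm (1 + (f y)\<^sup>2)" by simp
    qed
  qed (rule f)
  define kb where "kb = (\<integral>\<xi>. norm (m \<xi>) \<partial>lborel)"
  have kb: "\<bar>k z\<bar> \<le> kb" for z
  proof -
    have "norm (complex_of_real (k z)) \<le> kb"
      unfolding k kb_def by (rule order_trans[OF integral_norm_bound]) (simp add: norm_mult)
    then show ?thesis by simp
  qed
  define g where "g x = (\<integral>y. k (x - y) * f y \<partial>M)" for x
  have [measurable]: "g \<in> borel_measurable N"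
    unfolding g_def[abs_def] by (intro M.borel_measurable_lebesgue_integral) measurable
  \<comment> \<open>Any finite bound will do: it makes \<open>G\<close> an honest real number, half
    of which can be subtracted later.\<close>
  have gb: "\<bar>g x\<bar> \<le> kb * (\<integral>y. \<bar>f y\<bar> \<partial>M)" for x
  proof -
    have "\<bar>g x\<bar> \<le> (\<integral>y. \<bar>k (x - y) * f y\<bar> \<partial>M)" unfolding g_def by (rule integral_abs_bound)
    also have "\<dots> \<le> (\<integral>y. kb * \<bar>f y\<bar> \<partial>M)"
    proof (rule integral_mono')
      show "\<bar>k (x - y) * f y\<bar> \<le> kb * \<bar>f y\<bar>" for y
        unfolding abs_mult by (intro mult_right_mono kb) auto
      show "0 \<le> kb * \<bar>f y\<bar>" for y using kb[of 0] by (intro mult_nonneg_nonneg) auto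
    qed (use f1 in auto)
    finally show ?thesis by simp
  qed
  have g1: "integrable N g"
    by (rule N.integrable_const_bound[where B = "kb * (\<integral>y. \<bar>f y\<bar> \<partial>M)"]) (use gb in auto)
  have g2: "integrable N (\<lambda>x. (g x)\<^sup>2)"
  proof (rule N.integrable_const_bound[where B = "(kb * (\<integral>y. \<bar>f y\<bar> \<partial>M))\<^sup>2"])
    show "AE x in N. norm ((g x)\<^sup>2) \<le> (kb * (\<integral>y. \<bar>f y\<bar> \<partial>M))\<^sup>2"
    proof (intro AE_I2)
      fix x
      have "\<bar>g x\<bar>\<^sup>2 \<le> (kb * (\<integral>y. \<bar>f y\<bar> \<partial>M))\<^sup>2" using gb by (intro power_mono) auto
      then show "norm ((g x)\<^sup>2) \<le> (kb * (\<integral>y. \<bar>f y\<bar> \<partial>M))\<^sup>2" by simp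
    qed
  qed measurable
  define F where "F = (\<integral>y. (f y)\<^sup>2 \<partial>M)"
  define G where "G = (\<integral>x. (g x)\<^sup>2 \<partial>N)"
  have FG: "0 \<le> F" "0 \<le> G" by (auto simp: F_def G_def)
  have "complex_of_real G = (\<integral>x. of_real (g x) * (\<integral>y. complex_of_real (k (x - y)) * of_real (f y) \<partial>M) \<partial>N)"
  proof -
    have "(\<integral>y. complex_of_real (k (x - y)) * of_real (f y) \<partial>M) = of_real (g x)" for x
      unfolding g_def by (simp only: of_real_mult[symmetric] integral_complex_of_real)
    then show ?thesis
      unfolding G_def by (simp only: of_real_mult[symmetric] integral_complex_of_real power2_eq_square)
  qed
  also have "\<dots> = (\<integral>\<xi>. m \<xi> * fourier M f \<xi> * cnj (fourier N g \<xi>) \<partial>lborel)"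
    by (rule fourier_parseval[OF sfM M.sets_M sfN N.sets_M f1 g1 m(1) k])
  finally have GF: "complex_of_real G = \<dots>" .
  have Fm: "fourier M f \<in> borel_measurable borel" "fourier N g \<in> borel_measurable borel"
    using fourier_borel_measurable[OF sfM M.sets_M f'] fourier_borel_measurable[OF sfN N.sets_M, of g]
      N.measurable_M by auto
  note Fm[measurable]
  have Ei: "integrable lborel (\<lambda>\<xi>. gauss_weight \<delta> \<xi> * (norm (h \<xi>))\<^sup>2)"
    if "h \<in> borel_measurable borel" "\<And>\<xi>. norm (h \<xi>) \<le> c" for h :: "real ^ 3 \<Rightarrow> complex" and c
  proof (rule Bochner_Integration.integrable_bound)
    show "integrable lborel (\<lambda>\<xi> :: real ^ 3. gauss_weight \<delta> \<xi> * c\<^sup>2)"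
      using integrable_gauss_weight[OF \<delta>] by (rule integrable_mult_left)
    show "AE \<xi> in lborel. norm (gauss_weight \<delta> \<xi> * (norm (h \<xi>))\<^sup>2) \<le> norm (gauss_weight \<delta> \<xi> * c\<^sup>2)"
      using that(2) by (intro AE_I2) (auto simp: abs_mult intro!: mult_left_mono power_mono)
  qed (use that(1) in measurable)
  have Ef: "integrable lborel (\<lambda>\<xi>. gauss_weight \<delta> \<xi> * (norm (fourier M f \<xi>))\<^sup>2)"
    and Eg: "integrable lborel (\<lambda>\<xi>. gauss_weight \<delta> \<xi> * (norm (fourier N g \<xi>))\<^sup>2)"
    by (rule Ei[OF Fm(1) norm_fourier_le] Ei[OF Fm(2) norm_fourier_le])+
  \<comment> \<open>Chosen so that the energy of \<open>g\<close>, at most \<kappa> Q G, enters with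
    total weight 1/2.\<close>
  define s where "s = \<Lambda> * \<kappa> * Q"
  have s: "0 < s" using \<Lambda> \<kappa> PQ by (simp add: s_def)
  have "G = norm (complex_of_real G)" using FG by simp
  also have "\<dots> \<le> (\<integral>\<xi>. norm (m \<xi> * fourier M f \<xi> * cnj (fourier N g \<xi>)) \<partial>lborel)"
    unfolding GF by (rule integral_norm_bound)
  also have "\<dots> \<le> (\<integral>\<xi>. \<Lambda> * s / 2 * (gauss_weight \<delta> \<xi> * (norm (fourier M f \<xi>))\<^sup>2)
      + \<Lambda> / (2 * s) * (gauss_weight \<delta> \<xi> * (norm (fourier N g \<xi>))\<^sup>2) \<partial>lborel)"
  proof (rule integral_mono')
    show "integrable lborel (\<lambda>\<xi>. \<Lambda> * s / 2 * (gauss_weight \<delta> \<xi> * (norm (fourier M f \<xi>))\<^sup>2)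
      + \<Lambda> / (2 * s) * (gauss_weight \<delta> \<xi> * (norm (fourier N g \<xi>))\<^sup>2))"
      by (intro Bochner_Integration.integrable_add integrable_mult_right Ef Eg)
    fix \<xi>
    define u v w where "u = norm (fourier M f \<xi>)" and "v = norm (fourier N g \<xi>)" and "w = gauss_weight \<delta> \<xi>"
    have uvw: "0 \<le> u" "0 \<le> v" "0 \<le> w" using gauss_weight_nonneg by (auto simp: u_def v_def w_def)
    have "2 * (s * u) * v \<le> (s * u)\<^sup>2 + v\<^sup>2" by (rule sum_squares_bound)
    then have uv: "u * v \<le> s / 2 * u\<^sup>2 + v\<^sup>2 / (2 * s)"
      using s by (simp add: field_simps power2_eq_square)
    have "norm (m \<xi> * fourier M f \<xi> * cnj (fourier N g \<xi>)) = norm (m \<xi>) * (u * v)"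
      by (simp add: norm_mult u_def v_def)
    also have "\<dots> \<le> (\<Lambda> * w) * (s / 2 * u\<^sup>2 + v\<^sup>2 / (2 * s))"
      using m(2)[of \<xi>] uvw uv \<Lambda> by (intro mult_mono) (auto simp: w_def)
    also have "\<dots> = \<Lambda> * s / 2 * (w * u\<^sup>2) + \<Lambda> / (2 * s) * (w * v\<^sup>2)"
      by (simp add: algebra_simps)
    finally show "norm (m \<xi> * fourier M f \<xi> * cnj (fourier N g \<xi>))
      \<le> \<Lambda> * s / 2 * (gauss_weight \<delta> \<xi> * (norm (fourier M f \<xi>))\<^sup>2)
      + \<Lambda> / (2 * s) * (gauss_weight \<delta> \<xi> * (norm (fourier N g \<xi>))\<^sup>2)"
      by (simp add: u_def v_def w_def)
  qed (use s \<Lambda> gauss_weight_nonneg in \<open>auto intro!: add_nonneg_nonneg mult_nonneg_nonneg divide_nonneg_nonneg\<close>)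
  also have "\<dots> = \<Lambda> * s / 2 * (\<integral>\<xi>. gauss_weight \<delta> \<xi> * (norm (fourier M f \<xi>))\<^sup>2 \<partial>lborel)
      + \<Lambda> / (2 * s) * (\<integral>\<xi>. gauss_weight \<delta> \<xi> * (norm (fourier N g \<xi>))\<^sup>2 \<partial>lborel)"
    using Ef Eg by simp
  also have "\<dots> \<le> \<Lambda> * s / 2 * (\<kappa> * P * F) + \<Lambda> / (2 * s) * (\<kappa> * Q * G)"
    using M.fourier_energy_le[OF \<delta> f1 f2] N.fourier_energy_le[OF \<delta> g1 g2] s \<Lambda>
    by (intro add_mono mult_left_mono) (auto simp: \<kappa>_def P_def Q_def F_def G_def)
  also have "\<Lambda> / (2 * s) * (\<kappa> * Q * G) = G / 2"
    using \<Lambda> \<kappa> PQ by (simp add: s_def)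
  finally have "G \<le> (\<Lambda> * \<kappa>)\<^sup>2 * P * Q * F" by (simp add: s_def power2_eq_square mult_ac)
  then have "ennreal G \<le> ennreal ((\<Lambda> * \<kappa>)\<^sup>2 * P * Q) * ennreal F"
    using PQ FG by (simp add: ennreal_leI flip: ennreal_mult)
  moreover have "(\<integral>\<^sup>+x. ennreal ((g x)\<^sup>2) \<partial>N) = ennreal G"
    unfolding G_def using g2 by (intro nn_integral_eq_integral) auto
  moreover have "(\<integral>\<^sup>+y. ennreal ((f y)\<^sup>2) \<partial>M) = ennreal F"
    unfolding F_def using f2 by (intro nn_integral_eq_integral) auto
  ultimately show ?thesis by (simp add: g_def P_def Q_def \<kappa>_def)
qed

section \<open>Dyadic decomposition of the smoothed spherical kernel\<close>

lemma sets_sphere_measure_dil[simp, measurable_cong]: "sets (sphere_measure_dil t) = sets borel"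
  and space_sphere_measure_dil[simp]: "space (sphere_measure_dil t) = UNIV"
  by (simp_all add: sphere_measure_dil_def)

lemma finite_measure_sphere_measure_dil: "finite_measure (sphere_measure_dil t)"
  unfolding sphere_measure_dil_def
  by (intro finite_measure.finite_measure_distr[OF finite_measure_sphere_measure]) measurable

lemma measure_sphere_measure_dil: "measure (sphere_measure_dil t) UNIV = measure sphere_measure UNIV"
  unfolding sphere_measure_dil_def by (subst measure_distr) auto

lemma integral_sphere_measure_dil:
  fixes h :: "real ^ 3 \<Rightarrow> 'b::{banach, second_countable_topology}"
  assumes "h \<in> borel_measurable borel"
  shows "(\<integral>z. h z \<partial>sphere_measure_dil t) = (\<integral>\<omega>. h (t *\<^sub>R \<omega>) \<partial>sphere_measure)"
  unfolding sphere_measure_dil_def using assms by (subst integral_distr) auto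

text \<open>Dilation evaluates the transform of the unit sphere at t \<xi>, whose norm supplies the
  factor 1 / t.\<close>

lemma fourier_sphere_measure_dil_decay:
  assumes t: "0 < t"
  shows "norm (fourier (sphere_measure_dil t) (\<lambda>_. 1) \<xi>) * norm \<xi> \<le> measure sphere_measure UNIV / t"
proof -
  have "fourier (sphere_measure_dil t) (\<lambda>_. 1) \<xi> = (\<integral>\<omega>. cis (- ((t *\<^sub>R \<xi>) \<bullet> \<omega>)) \<partial>sphere_measure)"
    unfolding fourier_def by (subst integral_sphere_measure_dil) auto
  then show ?thesis using sphere_measure_cis_decay[of "t *\<^sub>R \<xi>"] t by (simp add: field_simps)
qed

lemma norm_fourier_sphere_measure_dil_le:
  "norm (fourier (sphere_measure_dil t) (\<lambda>_. 1) \<xi>) \<le> measure sphere_measure UNIV"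
  using norm_fourier_le[of "sphere_measure_dil t" "\<lambda>_. 1" \<xi>] by (simp add: measure_sphere_measure_dil)

definition sphere_heat :: "real \<Rightarrow> real \<Rightarrow> real ^ 3 \<Rightarrow> real" where
  "sphere_heat t \<delta> x = (\<integral>z. heat \<delta> (x - z) \<partial>sphere_measure_dil t)"

lemma sphere_heat_borel_measurable[measurable]: "sphere_heat t \<delta> \<in> borel_measurable borel"
proof -
  interpret finite_measure "sphere_measure_dil t" by (rule finite_measure_sphere_measure_dil)
  show ?thesis unfolding sphere_heat_def[abs_def]
    by (intro borel_measurable_lebesgue_integral) measurable
qed

lemma integrable_sphere_heat:
  assumes \<delta>: "0 < \<delta>"
  shows "integrable (sphere_measure_dil t) (\<lambda>z. heat \<delta> (x - z))"
proof -
  interpret finite_measure "sphere_measure_dil t" by (rule finite_measure_sphere_measure_dil)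
  show ?thesis
    using abs_heat_le[OF \<delta>, where 'a = "real ^ 3"]
    by (intro integrable_const_bound[where B = "1 / \<delta> ^ 3"]) auto
qed

lemma sphere_heat_nonneg: "0 < \<delta> \<Longrightarrow> 0 \<le> sphere_heat t \<delta> x"
  unfolding sphere_heat_def by (intro integral_nonneg_AE) (auto simp: heat_nonneg)

lemma sphere_heat_le:
  assumes \<delta>: "0 < \<delta>"
  shows "sphere_heat t \<delta> x \<le> measure sphere_measure UNIV / \<delta> ^ 3"
proof -
  interpret finite_measure "sphere_measure_dil t" by (rule finite_measure_sphere_measure_dil)
  have "sphere_heat t \<delta> x \<le> (\<integral>z. 1 / \<delta> ^ 3 \<partial>sphere_measure_dil t)"
    unfolding sphere_heat_def using heat_le[OF \<delta>, where 'a = "real ^ 3"]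
    by (intro integral_mono integrable_sphere_heat \<delta>) auto
  then show ?thesis by (simp add: measure_sphere_measure_dil)
qed

text \<open>Comes from the antipodal symmetry of the sphere. It makes the kernel in x - y symmetric,
  so the adjoint operator is the same operator with the two measures exchanged.\<close>

lemma sphere_heat_uminus: "sphere_heat t \<delta> (- x) = sphere_heat t \<delta> x"
proof -
  have "sphere_heat t \<delta> (- x) = (\<integral>\<omega>. heat \<delta> (- x - t *\<^sub>R \<omega>) \<partial>sphere_measure)"
    unfolding sphere_heat_def by (subst integral_sphere_measure_dil) auto
  also have "\<dots> = (\<integral>\<omega>. heat \<delta> (- x - t *\<^sub>R (- \<omega>)) \<partial>sphere_measure)"
    by (rule integral_sphere_measure_orthogonal[symmetric, where h = "\<lambda>\<omega>. heat \<delta> (- x - t *\<^sub>R \<omega>)"])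
      (auto simp: orthogonal_transformation_def intro!: linearI)
  also have "\<dots> = (\<integral>\<omega>. heat \<delta> (x - t *\<^sub>R \<omega>) \<partial>sphere_measure)"
    by (intro Bochner_Integration.integral_cong refl) (simp add: heat_def norm_minus_commute)
  also have "\<dots> = sphere_heat t \<delta> x"
    unfolding sphere_heat_def by (subst integral_sphere_measure_dil) auto
  finally show ?thesis .
qed

text \<open>The convolution formula applied to the sphere with density 1; the divisor compensates
  for the normalisation of \<open>heat\<close>.\<close>

lemma sphere_heat_fourier:
  assumes \<delta>: "0 < \<delta>"
  shows "complex_of_real (sphere_heat t \<delta> x) = (\<integral>\<xi>. cis (\<xi> \<bullet> x) *
      (of_real (gauss_weight \<delta> \<xi> / sqrt (2 * pi) ^ 3) * fourier (sphere_measure_dil t) (\<lambda>_. 1) \<xi>) \<partial>lborel)"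
proof -
  interpret finite_measure "sphere_measure_dil t" by (rule finite_measure_sphere_measure_dil)
  have K: "complex_of_real (heat \<delta> z) = (\<integral>\<xi>. cis (\<xi> \<bullet> z) * of_real (gauss_weight \<delta> \<xi> / sqrt (2 * pi) ^ 3) \<partial>lborel)"
    for z :: "real ^ 3"
  proof -
    have "(\<integral>\<xi>. cis (\<xi> \<bullet> z) * of_real (gauss_weight \<delta> \<xi> / sqrt (2 * pi) ^ 3) \<partial>lborel)
      = (\<integral>\<xi>. (cis (\<xi> \<bullet> z) * of_real (gauss_weight \<delta> \<xi>)) / of_real (sqrt (2 * pi) ^ 3) \<partial>lborel)"
      by simp
    also have "\<dots> = of_real (sqrt (2 * pi) ^ 3 * heat \<delta> z) / of_real (sqrt (2 * pi) ^ 3)"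
      unfolding integral_divide_zero gaussian_fourier[OF \<delta>] by simp
    finally show ?thesis by simp
  qed
  have "(\<integral>z. complex_of_real (heat \<delta> (x - z)) * of_real 1 \<partial>sphere_measure_dil t) = (\<integral>\<xi>. cis (\<xi> \<bullet> x) *
      (of_real (gauss_weight \<delta> \<xi> / sqrt (2 * pi) ^ 3) * fourier (sphere_measure_dil t) (\<lambda>_. 1) \<xi>) \<partial>lborel)"
  proof (rule fourier_convolution[OF _ _ _ _ K])
    show "integrable lborel (\<lambda>\<xi> :: real ^ 3. complex_of_real (gauss_weight \<delta> \<xi> / sqrt (2 * pi) ^ 3))"
      by (intro integrable_of_real integrable_divide integrable_gauss_weight \<delta>)
  qed (auto intro: sigma_finite_measure_axioms)
  then show ?thesis by (simp add: sphere_heat_def)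
qed

text \<open>By Fubini this is an average over the sphere of the Gaussian bound at translated
  centres, so the power of \<delta> is that of a single Gaussian.\<close>

lemma (in frostman) sphere_heat_integral_le:
  assumes \<delta>: "0 < \<delta>"
  shows "integrable M (\<lambda>y. sphere_heat t \<delta> (x - y))"
    and "(\<integral>y. sphere_heat t \<delta> (x - y) \<partial>M) \<le> measure sphere_measure UNIV * (256 * C * \<delta> powr (a - 3))"
proof -
  note sets_M[measurable_cong]
  interpret S: finite_measure "sphere_measure_dil t" by (rule finite_measure_sphere_measure_dil)
  interpret P: pair_sigma_finite "sphere_measure_dil t" M ..
  have one: "integrable M (\<lambda>_. 1 :: real)" "integrable (sphere_measure_dil t) (\<lambda>_. 1 :: real)" by simp_all
  have "integrable (sphere_measure_dil t \<Otimes>\<^sub>M M) (\<lambda>(z, y). heat \<delta> (x - y - z) * (1 * 1))"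
    using integrable_pair_bounded_mult[OF S.sigma_finite_measure_axioms sigma_finite_measure_axioms one(2,1),
        of "\<lambda>(z, y). heat \<delta> (x - y - z)" "1 / \<delta> ^ 3"] abs_heat_le[OF \<delta>, where 'a = "real ^ 3"]
    by (simp add: case_prod_beta')
  then have int: "integrable (sphere_measure_dil t \<Otimes>\<^sub>M M) (\<lambda>(z, y). heat \<delta> (x - y - z))" by simp
  show "integrable M (\<lambda>y. sphere_heat t \<delta> (x - y))"
    using P.integrable_snd[OF int] by (simp add: sphere_heat_def)
  have "(\<integral>y. sphere_heat t \<delta> (x - y) \<partial>M) = (\<integral>z. (\<integral>y. heat \<delta> ((x - z) - y) \<partial>M) \<partial>sphere_measure_dil t)"
    unfolding sphere_heat_def P.Fubini_integral[OF int] by (simp add: algebra_simps)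
  also have "\<dots> \<le> (\<integral>z. 256 * C * \<delta> powr (a - 3) \<partial>sphere_measure_dil t)"
  proof (rule integral_mono)
    show "integrable (sphere_measure_dil t) (\<lambda>z. \<integral>y. heat \<delta> ((x - z) - y) \<partial>M)"
      using P.integrable_fst[OF int] by (simp add: algebra_simps)
  qed (auto intro: integral_heat_le[OF \<delta>])
  finally show "(\<integral>y. sphere_heat t \<delta> (x - y) \<partial>M) \<le> measure sphere_measure UNIV * (256 * C * \<delta> powr (a - 3))"
    by (simp add: measure_sphere_measure_dil)
qed

text \<open>The zeroth piece carries the coarsest scale 1, so that the first n + 1 pieces telescope
  exactly to scale 2^(-n).\<close>

primrec sphere_piece :: "real \<Rightarrow> nat \<Rightarrow> real ^ 3 \<Rightarrow> real" where
  "sphere_piece t 0 x = sphere_heat t 1 x"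
| "sphere_piece t (Suc i) x = sphere_heat t (1 / 2 ^ Suc i) x - sphere_heat t (1 / 2 ^ i) x"

lemma sum_sphere_piece: "(\<Sum>i\<le>n. sphere_piece t i x) = sphere_heat t (1 / 2 ^ n) x"
  by (induction n) auto

lemma sphere_piece_borel_measurable[measurable]: "sphere_piece t i \<in> borel_measurable borel"
proof (cases i)
  case (Suc j)
  have "sphere_piece t (Suc j) = (\<lambda>x. sphere_heat t (1 / 2 ^ Suc j) x - sphere_heat t (1 / 2 ^ j) x)"
    by (simp add: fun_eq_iff)
  then show ?thesis using Suc by simp
next
  case 0
  have "sphere_piece t 0 = sphere_heat t 1" by (simp add: fun_eq_iff)
  then show ?thesis using 0 by simp
qed

text \<open>With v = \<delta>|\<xi>| the difference is exp(-v^2/2) (1 - exp(-3v^2/2)), at most (3/2)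
  v^2 exp(-v^2/2). One factor v is kept to meet the decay 1/|\<xi>|; the other is absorbed by half
  of the Gaussian exponent, hence the width \<delta> / \<open>sqrt 2\<close>.\<close>

lemma gauss_weight_difference_le:
  assumes \<delta>: "0 < \<delta>"
  shows "0 \<le> gauss_weight \<delta> \<xi> - gauss_weight (2 * \<delta>) \<xi>"
    and "gauss_weight \<delta> \<xi> - gauss_weight (2 * \<delta>) \<xi> \<le> 3 / 2 * \<delta> * norm \<xi> * gauss_weight (\<delta> / sqrt 2) \<xi>"
proof -
  define v where "v = \<delta> * norm \<xi>"
  have v: "0 \<le> v" using \<delta> by (simp add: v_def)
  have 1: "gauss_weight \<delta> \<xi> = exp (- v\<^sup>2 / 2)" "gauss_weight (2 * \<delta>) \<xi> = exp (- v\<^sup>2 / 2) * exp (- (3 * v\<^sup>2 / 2))"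
    "gauss_weight (\<delta> / sqrt 2) \<xi> = exp (- v\<^sup>2 / 4)"
    by (simp_all add: gauss_weight_def v_def power_mult_distrib power_divide flip: exp_add)
  show "0 \<le> gauss_weight \<delta> \<xi> - gauss_weight (2 * \<delta>) \<xi>" unfolding 1 by (simp add: mult_left_le)
  have "1 - exp (- (3 * v\<^sup>2 / 2)) \<le> 3 * v\<^sup>2 / 2" using exp_ge_add_one_self[of "- (3 * v\<^sup>2 / 2)"] by simp
  then have "exp (- v\<^sup>2 / 2) * (1 - exp (- (3 * v\<^sup>2 / 2))) \<le> exp (- v\<^sup>2 / 2) * (3 * v\<^sup>2 / 2)"
    by (rule mult_left_mono) simp
  also have "\<dots> = 3 / 2 * v * (v * exp (- v\<^sup>2 / 4)) * exp (- v\<^sup>2 / 4)"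
    by (simp add: power2_eq_square flip: exp_add)
  also have "\<dots> \<le> 3 / 2 * v * 1 * exp (- v\<^sup>2 / 4)"
  proof (intro mult_right_mono mult_left_mono)
    have "0 \<le> (1 - v / 2)\<^sup>2" by simp
    then have "v \<le> 1 + v\<^sup>2 / 4" by (simp add: power2_eq_square algebra_simps)
    also have "\<dots> \<le> exp (v\<^sup>2 / 4)" by (rule exp_ge_add_one_self)
    finally show "v * exp (- v\<^sup>2 / 4) \<le> 1" by (simp add: exp_minus field_simps)
  qed (use v in auto)
  finally show "gauss_weight \<delta> \<xi> - gauss_weight (2 * \<delta>) \<xi> \<le> 3 / 2 * \<delta> * norm \<xi> * gauss_weight (\<delta> / sqrt 2) \<xi>"
    unfolding 1 by (simp add: v_def algebra_simps)
qed

text \<open>One power of \<open>2\<^sup>-\<^sup>i\<close> is gained from the decay of the Fourier transform of the sphere, because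
  the weight \<open>gauss_weight \<delta> - gauss_weight (2 \<delta>)\<close> vanishes to second order at the origin.\<close>

lemma sphere_piece_multiplier:
  fixes t :: real
  assumes t: "0 < t"
  obtains \<Lambda> m where "0 < \<Lambda>" "\<And>i. integrable lborel (m i)"
    "\<And>i \<xi>. norm (m i \<xi>) \<le> \<Lambda> / 2 ^ i * gauss_weight (1 / 2 ^ i / sqrt 2) \<xi>"
    "\<And>i z. complex_of_real (sphere_piece t i z) = (\<integral>\<xi>. cis (\<xi> \<bullet> z) * m i \<xi> \<partial>lborel)"
proof -
  let ?S = "fourier (sphere_measure_dil t) (\<lambda>_. 1)"
  define \<kappa> where "\<kappa> = sqrt (2 * pi) ^ 3"
  \<comment> \<open>Adding 1 gives positivity without computing the mass of the sphere.\<close>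
  define s where "s = measure sphere_measure UNIV + 1"
  have \<kappa>: "0 < \<kappa>" by (simp add: \<kappa>_def)
  have s: "0 < s" "measure sphere_measure UNIV \<le> s" by (auto simp: s_def add_nonneg_pos)
  define m0 where "m0 \<delta> \<xi> = of_real (gauss_weight \<delta> \<xi> / \<kappa>) * ?S \<xi>" for \<delta> \<xi>
  define m where "m i = (case i of 0 \<Rightarrow> m0 1 | Suc j \<Rightarrow> (\<lambda>\<xi>. m0 (1 / 2 ^ Suc j) \<xi> - m0 (1 / 2 ^ j) \<xi>))" for i
  \<comment> \<open>The summand 1 serves piece 0, where the transform of the sphere is bounded by
    its mass. The summand 3 / (2t) serves the differences: 3/2 from the Gaussian weights times 1/t
    from the decay.\<close>
  define \<Lambda> where "\<Lambda> = s / \<kappa> * (1 + 3 / (2 * t))"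
  have \<Lambda>: "0 < \<Lambda>" "s / \<kappa> \<le> \<Lambda>" "s / \<kappa> * (3 / (2 * t)) \<le> \<Lambda>"
    using s \<kappa> t unfolding \<Lambda>_def distrib_left by (auto intro!: add_pos_pos)
  have Sm[measurable]: "?S \<in> borel_measurable borel"
    by (rule fourier_borel_measurable)
      (auto intro: finite_measure_sphere_measure_dil[THEN finite_measure.axioms(1)])
  have m0i: "integrable lborel (m0 \<delta>)" if "0 < \<delta>" for \<delta>
  proof (rule Bochner_Integration.integrable_bound)
    show "integrable lborel (\<lambda>\<xi> :: real ^ 3. gauss_weight \<delta> \<xi> / \<kappa> * s)"
      by (intro integrable_mult_left integrable_divide integrable_gauss_weight that)
    show "m0 \<delta> \<in> borel_measurable lborel" unfolding m0_def[abs_def] by measurable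
    show "AE \<xi> in lborel. norm (m0 \<delta> \<xi>) \<le> norm (gauss_weight \<delta> \<xi> / \<kappa> * s)"
    proof (intro AE_I2)
      fix \<xi>
      have "norm (?S \<xi>) \<le> s" using norm_fourier_sphere_measure_dil_le s(2) by (rule order_trans)
      then have "gauss_weight \<delta> \<xi> / \<kappa> * norm (?S \<xi>) \<le> gauss_weight \<delta> \<xi> / \<kappa> * s"
        using gauss_weight_nonneg[of \<delta> \<xi>] \<kappa> by (intro mult_left_mono) auto
      then have "norm (m0 \<delta> \<xi>) \<le> gauss_weight \<delta> \<xi> / \<kappa> * s"
        unfolding m0_def norm_mult norm_of_real using gauss_weight_nonneg[of \<delta> \<xi>] \<kappa> by simp
      then show "norm (m0 \<delta> \<xi>) \<le> norm (gauss_weight \<delta> \<xi> / \<kappa> * s)"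
        unfolding real_norm_def by (rule order_trans[OF _ abs_ge_self])
    qed
  qed
  have m0f: "complex_of_real (sphere_heat t \<delta> z) = (\<integral>\<xi>. cis (\<xi> \<bullet> z) * m0 \<delta> \<xi> \<partial>lborel)" if "0 < \<delta>" for \<delta> z
    using sphere_heat_fourier[OF that] by (simp add: m0_def \<kappa>_def)
  have m0c: "integrable lborel (\<lambda>\<xi>. cis (\<xi> \<bullet> z) * m0 \<delta> \<xi>)" if "0 < \<delta>" for \<delta> z
    by (rule Bochner_Integration.integrable_bound[OF m0i[OF that]])
      (use m0i[OF that] in \<open>auto simp: norm_mult\<close>)
  show ?thesis
  proof (rule that[OF \<Lambda>(1)])
    show "integrable lborel (m i)" for i
      by (cases i) (auto simp: m_def intro!: m0i Bochner_Integration.integrable_diff)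
    show "complex_of_real (sphere_piece t i z) = (\<integral>\<xi>. cis (\<xi> \<bullet> z) * m i \<xi> \<partial>lborel)" for i z
    proof (cases i)
      case 0
      then show ?thesis using m0f[of 1 z] by (simp add: m_def)
    next
      case (Suc j)
      have "complex_of_real (sphere_piece t i z) = complex_of_real (sphere_heat t (1 / 2 ^ Suc j) z) - complex_of_real (sphere_heat t (1 / 2 ^ j) z)"
        by (simp add: Suc)
      also have "\<dots> = (\<integral>\<xi>. cis (\<xi> \<bullet> z) * m0 (1 / 2 ^ Suc j) \<xi> - cis (\<xi> \<bullet> z) * m0 (1 / 2 ^ j) \<xi> \<partial>lborel)"
        by (subst Bochner_Integration.integral_diff) (auto intro!: m0c m0f arg_cong2[where f = minus] simp del: power_Suc)
      finally show ?thesis by (simp add: m_def Suc right_diff_distrib del: power_Suc)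
    qed
    show "norm (m i \<xi>) \<le> \<Lambda> / 2 ^ i * gauss_weight (1 / 2 ^ i / sqrt 2) \<xi>" for i \<xi>
    proof (cases i)
      case 0
      have w: "gauss_weight 1 \<xi> \<le> gauss_weight (1 / sqrt 2) \<xi>"
        by (simp add: gauss_weight_def power_divide)
      have "norm (?S \<xi>) \<le> s" using norm_fourier_sphere_measure_dil_le s(2) by (rule order_trans)
      then have "gauss_weight 1 \<xi> * norm (?S \<xi>) \<le> gauss_weight (1 / sqrt 2) \<xi> * s"
        using w gauss_weight_nonneg by (intro mult_mono) auto
      then have "gauss_weight 1 \<xi> * norm (?S \<xi>) / \<kappa> \<le> gauss_weight (1 / sqrt 2) \<xi> * s / \<kappa>"
        using \<kappa> by (intro divide_right_mono) auto
      also have "\<dots> \<le> \<Lambda> * gauss_weight (1 / sqrt 2) \<xi>"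
        using mult_right_mono[OF \<Lambda>(2) gauss_weight_nonneg[of "1 / sqrt 2" \<xi>]] by (simp add: mult.commute)
      finally show ?thesis
        using 0 \<kappa> gauss_weight_nonneg[of 1 \<xi>] by (simp add: m_def m0_def norm_mult norm_divide)
    next
      case (Suc j)
      let ?d = "1 / 2 ^ Suc j :: real"
      have d: "0 < ?d" "2 * ?d = 1 / 2 ^ j" by auto
      have "norm (?S \<xi>) * norm \<xi> \<le> s / t"
        by (rule order_trans[OF fourier_sphere_measure_dil_decay[OF t] divide_right_mono[OF s(2)]]) (use t in simp)
      then have "norm (?S \<xi>) * norm \<xi> * (3 / 2 * ?d * gauss_weight (?d / sqrt 2) \<xi> / \<kappa>)
        \<le> s / t * (3 / 2 * ?d * gauss_weight (?d / sqrt 2) \<xi> / \<kappa>)"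
        using gauss_weight_nonneg[of "?d / sqrt 2" \<xi>] \<kappa> by (intro mult_right_mono) auto
      moreover have "norm (m i \<xi>) = (gauss_weight ?d \<xi> - gauss_weight (2 * ?d) \<xi>) / \<kappa> * norm (?S \<xi>)"
      proof -
        have "m i \<xi> = of_real ((gauss_weight ?d \<xi> - gauss_weight (2 * ?d) \<xi>) / \<kappa>) * ?S \<xi>"
          unfolding d(2) by (simp add: m_def Suc m0_def diff_divide_distrib left_diff_distrib del: power_Suc)
        then have "norm (m i \<xi>) = \<bar>(gauss_weight ?d \<xi> - gauss_weight (2 * ?d) \<xi>) / \<kappa>\<bar> * norm (?S \<xi>)"
          by (simp only: norm_mult norm_of_real)
        also have "\<bar>(gauss_weight ?d \<xi> - gauss_weight (2 * ?d) \<xi>) / \<kappa>\<bar> = (gauss_weight ?d \<xi> - gauss_weight (2 * ?d) \<xi>) / \<kappa>"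
          using gauss_weight_difference_le(1)[OF d(1), of \<xi>] \<kappa> by (intro abs_of_nonneg divide_nonneg_pos)
        finally show ?thesis .
      qed
      moreover have "(gauss_weight ?d \<xi> - gauss_weight (2 * ?d) \<xi>) / \<kappa> * norm (?S \<xi>)
        \<le> (3 / 2 * ?d * norm \<xi> * gauss_weight (?d / sqrt 2) \<xi>) / \<kappa> * norm (?S \<xi>)"
        using \<kappa> gauss_weight_difference_le(2)[OF d(1), of \<xi>]
        by (intro mult_right_mono divide_right_mono) auto
      moreover have "(3 / 2 * ?d * norm \<xi> * gauss_weight (?d / sqrt 2) \<xi>) / \<kappa> * norm (?S \<xi>)
        = norm (?S \<xi>) * norm \<xi> * (3 / 2 * ?d * gauss_weight (?d / sqrt 2) \<xi> / \<kappa>)" by simp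
      moreover have "s / t * (3 / 2 * ?d * gauss_weight (?d / sqrt 2) \<xi> / \<kappa>) \<le> \<Lambda> / 2 ^ i * gauss_weight (1 / 2 ^ i / sqrt 2) \<xi>"
      proof -
        have "s / t * (3 / 2 * ?d * gauss_weight (?d / sqrt 2) \<xi> / \<kappa>) = s / \<kappa> * (3 / (2 * t)) * (?d * gauss_weight (?d / sqrt 2) \<xi>)"
          using t \<kappa> by (simp add: field_simps)
        also have "\<dots> \<le> \<Lambda> * (?d * gauss_weight (?d / sqrt 2) \<xi>)"
          using gauss_weight_nonneg[of "?d / sqrt 2" \<xi>] by (intro mult_right_mono \<Lambda>) auto
        finally show ?thesis by (simp add: Suc)
      qed
      ultimately show ?thesis by linarith
    qed
  qed
qed

text \<open>A crude bound that only secures integrability of the kernels; the factor 8^i does not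
  reach any final constant.\<close>

lemma abs_sphere_piece_le:
  "\<bar>sphere_piece t i z\<bar> \<le> 2 * measure sphere_measure UNIV * 8 ^ i"
proof -
  have *: "\<bar>sphere_heat t (1 / 2 ^ j) z\<bar> \<le> measure sphere_measure UNIV * 8 ^ j" for j
  proof -
    have "((2::real) ^ j) ^ 3 = 8 ^ j" by (simp add: power3_eq_cube flip: power_mult_distrib)
    then show ?thesis
      using sphere_heat_le[of "1 / 2 ^ j" t z] sphere_heat_nonneg[of "1 / 2 ^ j" t z] by (simp add: power_divide)
  qed
  show ?thesis
  proof (cases i)
    case 0
    then show ?thesis using *[of 0] by simp
  next
    case (Suc j)
    have "measure sphere_measure UNIV * 8 ^ j \<le> measure sphere_measure UNIV * (8::real) ^ Suc j"
      by (intro mult_left_mono power_increasing) auto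
    then show ?thesis
      using *[of j] *[of "Suc j"] abs_triangle_ineq4[of "sphere_heat t (1 / 2 ^ Suc j) z" "sphere_heat t (1 / 2 ^ j) z"]
      by (simp add: Suc del: power_Suc)
  qed
qed

text \<open>The cancellation in a piece is given up here. Because a - 3 \<le> 0 the finer of the two
  scales dominates, which doubles 256 to 512.\<close>

lemma (in frostman) integral_abs_sphere_piece_le:
  "(\<integral>y. \<bar>sphere_piece t i (x - y)\<bar> \<partial>M)
    \<le> (measure sphere_measure UNIV + 1) * (512 * C) * (1 / 2 ^ i) powr (a - 3)"
proof -
  let ?s = "measure sphere_measure UNIV" and ?d = "\<lambda>i. 1 / 2 ^ i :: real"
  have d: "0 < ?d j" for j by simp
  have row: "(\<integral>y. sphere_heat t (?d j) (x - y) \<partial>M) \<le> (?s + 1) * (256 * C) * ?d j powr (a - 3)" for j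
  proof -
    have "?s * (256 * C * ?d j powr (a - 3)) \<le> (?s + 1) * (256 * C * ?d j powr (a - 3))"
      using C_pos by (intro mult_right_mono) auto
    then show ?thesis using sphere_heat_integral_le(2)[OF d[of j], of t x] by (simp add: mult.assoc)
  qed
  show ?thesis
  proof (cases i)
    case 0
    have "(\<integral>y. \<bar>sphere_piece t i (x - y)\<bar> \<partial>M) \<le> (?s + 1) * (256 * C)"
      using row[of 0] 0 by (simp add: sphere_heat_nonneg)
    also have "\<dots> \<le> (?s + 1) * (512 * C)"
      using C_pos by (intro mult_left_mono) (auto simp: add_nonneg_nonneg)
    finally show ?thesis using 0 by simp
  next
    case (Suc j)
    have "(\<integral>y. \<bar>sphere_piece t i (x - y)\<bar> \<partial>M) \<le> (\<integral>y. sphere_heat t (?d (Suc j)) (x - y) + sphere_heat t (?d j) (x - y) \<partial>M)"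
    proof (rule integral_mono')
      show "\<bar>sphere_piece t i (x - y)\<bar> \<le> sphere_heat t (?d (Suc j)) (x - y) + sphere_heat t (?d j) (x - y)" for y
        using sphere_heat_nonneg[OF d[of j], of t "x - y"] sphere_heat_nonneg[OF d[of "Suc j"], of t "x - y"]
        by (simp add: Suc del: power_Suc)
    qed (auto intro!: Bochner_Integration.integrable_add sphere_heat_integral_le(1) add_nonneg_nonneg sphere_heat_nonneg)
    also have "\<dots> = (\<integral>y. sphere_heat t (?d (Suc j)) (x - y) \<partial>M) + (\<integral>y. sphere_heat t (?d j) (x - y) \<partial>M)"
      by (intro Bochner_Integration.integral_add sphere_heat_integral_le(1) d)
    also have "\<dots> \<le> (?s + 1) * (256 * C) * ?d (Suc j) powr (a - 3) + (?s + 1) * (256 * C) * ?d j powr (a - 3)"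
      by (intro add_mono row)
    also have "\<dots> \<le> (?s + 1) * (256 * C) * ?d (Suc j) powr (a - 3) + (?s + 1) * (256 * C) * ?d (Suc j) powr (a - 3)"
    proof (intro add_left_mono mult_left_mono)
      show "?d j powr (a - 3) \<le> ?d (Suc j) powr (a - 3)"
        using a_le by (intro powr_mono2') (auto simp: field_simps)
      show "0 \<le> (?s + 1) * (256 * C)" using C_pos by (intro mult_nonneg_nonneg add_nonneg_nonneg) auto
    qed
    finally show ?thesis by (simp add: Suc algebra_simps)
  qed
qed

section \<open>Summation over the scales, and the dual range\<close>

lemma sphere_heat_Lp_bound_ge_2:
  assumes FM: "frostman M a C" and FN: "frostman N b D" and t: "0 < t" and p: "2 \<le> p"
    and cond: "3 - 2 / p < a * (1 - 1 / p) + b / p"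
  obtains C' where "0 < C'"
    "\<And>n f. f \<in> borel_measurable M \<Longrightarrow> (\<And>y. 0 \<le> f y) \<Longrightarrow> integrable M (\<lambda>y. f y powr p) \<Longrightarrow>
      (\<integral>\<^sup>+x. ennreal ((\<integral>y. sphere_heat t (1 / 2 ^ n) (x - y) * f y \<partial>M) powr p) \<partial>N)
        \<le> ennreal C' * (\<integral>\<^sup>+y. ennreal (f y powr p) \<partial>M)"
proof -
  interpret M: frostman M a C by fact
  interpret N: frostman N b D by fact
  note M.sets_M[measurable_cong] N.sets_M[measurable_cong]
  obtain \<Lambda> m where \<Lambda>: "0 < \<Lambda>" and m: "\<And>i. integrable lborel (m i)"
    "\<And>i \<xi>. norm (m i \<xi>) \<le> \<Lambda> / 2 ^ i * gauss_weight (1 / 2 ^ i / sqrt 2) \<xi>"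
    "\<And>i z. complex_of_real (sphere_piece t i z) = (\<integral>\<xi>. cis (\<xi> \<bullet> z) * m i \<xi> \<partial>lborel)"
    using sphere_piece_multiplier[OF t] by blast
  define \<kappa> where "\<kappa> = sqrt (2 * pi) ^ 3"
  define s where "s = measure sphere_measure UNIV + 1"
  have s: "0 < s" by (simp add: s_def add_nonneg_pos)
  define d where "d i = (1 / 2 ^ i :: real)" for i :: nat
  have d: "0 < d i" for i by (simp add: d_def)
  define A where "A i = (\<Lambda> * d i * \<kappa>)\<^sup>2 * (256 * C * (d i / sqrt 2) powr (a - 3)) * (256 * D * (d i / sqrt 2) powr (b - 3))" for i
  define B where "B i = s * (512 * C) * d i powr (a - 3)" for i
  have A0: "0 \<le> A i" and B0: "0 < B i" for i
    using M.C_pos N.C_pos s d[of i] by (auto simp: A_def B_def)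
  \<comment> \<open>Interpolation bounds piece i in p-th powers by a multiple of B_i^(p-2) A_i. Here
    B_i scales like d_i^(a-3), and A_i like d_i to the power 2 + (a-3) + (b-3). The total exponent
    is \<open>e\<close>, and \<open>cond\<close> multiplied by p says exactly that it is
    positive.\<close>
  define e where "e = (a - 3) * (p - 2) + (a + b - 4)"
  have "p * (3 - 2 / p) < p * (a * (1 - 1 / p) + b / p)" using cond p by (intro mult_strict_left_mono) auto
  moreover have "p * (3 - 2 / p) = 3 * p - 2" "p * (a * (1 - 1 / p) + b / p) = a * (p - 1) + b"
    using p by (simp_all add: right_diff_distrib distrib_left)
  ultimately have e: "0 < e" by (simp add: e_def algebra_simps)
  \<comment> \<open>The ratio for norms rather than p-th powers, as the summation lemma
    requires.\<close>
  define \<beta> where "\<beta> = 2 powr (- e / p)"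
  have \<beta>: "0 < \<beta>" "\<beta> < 1" using e p by (auto simp: \<beta>_def powr_less_one)
  have \<beta>p: "\<beta> powr p = 2 powr (- e)" using p by (simp add: \<beta>_def powr_powr)
  \<comment> \<open>The interpolation constant with every power of \<open>d i\<close> removed, that
    is, its value at scale 1.\<close>
  define c where "c = 4 * (2 * (s * (512 * C))) powr (p - 2) * ((\<Lambda> * \<kappa>)\<^sup>2 * (256 * C * (1 / sqrt 2) powr (a - 3)) * (256 * D * (1 / sqrt 2) powr (b - 3)))"
  have c: "0 < c"
    using M.C_pos N.C_pos s \<Lambda> by (auto simp: c_def \<kappa>_def intro!: mult_pos_pos)
  have const: "4 * (2 * B i) powr (p - 2) * A i = c * (\<beta> powr p) ^ i" for i
  proof -
    have dp: "d i powr e = (\<beta> powr p) ^ i"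
    proof -
      have "d i = 2 powr (- real i)" by (simp add: d_def powr_minus_divide powr_realpow)
      then have "d i powr e = (2 powr (- e)) powr real i" by (simp add: powr_powr mult.commute)
      then show ?thesis by (simp add: \<beta>p powr_realpow)
    qed
    have "(2 * B i) powr (p - 2) = (2 * (s * (512 * C))) powr (p - 2) * d i powr ((a - 3) * (p - 2))"
      using s M.C_pos by (simp add: B_def powr_powr powr_mult flip: mult.assoc)
    moreover have "(d i / sqrt 2) powr r = d i powr r * (1 / sqrt 2) powr r" for r
      using powr_mult[of "d i" "1 / sqrt 2" r] d[of i] by simp
    moreover have "(\<Lambda> * d i * \<kappa>)\<^sup>2 = (\<Lambda> * \<kappa>)\<^sup>2 * d i powr 2"
      using d[of i] by (simp add: power_mult_distrib powr_numeral)
    ultimately have "4 * (2 * B i) powr (p - 2) * A i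
      = c * (d i powr ((a - 3) * (p - 2)) * d i powr 2 * d i powr (a - 3) * d i powr (b - 3))"
      unfolding A_def c_def by (simp only: mult_ac)
    also have "d i powr ((a - 3) * (p - 2)) * d i powr 2 * d i powr (a - 3) * d i powr (b - 3) = d i powr e"
      unfolding powr_add[symmetric] e_def by (simp add: algebra_simps)
    finally show ?thesis by (simp add: dp)
  qed
  show ?thesis
  proof (rule that)
    show "0 < c * (1 - \<beta>) powr (- p)" using c \<beta> by simp
    fix n and f :: "real ^ 3 \<Rightarrow> real"
    assume f[measurable]: "f \<in> borel_measurable M" and f0: "\<And>y. 0 \<le> f y" and fp: "integrable M (\<lambda>y. f y powr p)"
    have f1: "integrable M f" by (rule M.integrable_of_powr_integrable[OF f f0 _ fp]) (use p in simp)
    define h where "h i x = (\<integral>y. sphere_piece t i (x - y) * f y \<partial>M)" for i x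
    have hm: "h i \<in> borel_measurable N" for i
      unfolding h_def[abs_def] by (intro M.borel_measurable_lebesgue_integral) measurable
    have int: "integrable M (\<lambda>y. sphere_piece t i (x - y) * f y)" for i x
    proof (rule integrable_real_bound)
      show "integrable M (\<lambda>y. 2 * measure sphere_measure UNIV * 8 ^ i * \<bar>f y\<bar>)" using f1 by simp
      show "\<bar>sphere_piece t i (x - y) * f y\<bar> \<le> 2 * measure sphere_measure UNIV * 8 ^ i * \<bar>f y\<bar>" for y
        unfolding abs_mult by (intro mult_right_mono abs_sphere_piece_le) auto
    qed measurable
    have piece: "(\<integral>\<^sup>+x. ennreal (\<bar>h i x\<bar> powr p) \<partial>N) \<le> ennreal (c * (\<beta> powr p) ^ i) * (\<integral>\<^sup>+y. ennreal (f y powr p) \<partial>M)" for i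
      unfolding const[symmetric] h_def
    proof (rule kernel_interpolation)
      show "finite_measure M" "sigma_finite_measure N"
        by (rule M.finite_measure_axioms N.sigma_finite_measure_axioms)+
      show "(\<lambda>(x, y). sphere_piece t i (x - y)) \<in> borel_measurable (N \<Otimes>\<^sub>M M)" by measurable
      show "\<bar>sphere_piece t i (x - y)\<bar> \<le> 2 * measure sphere_measure UNIV * 8 ^ i" for x y
        by (rule abs_sphere_piece_le)
      show "(\<integral>y. \<bar>sphere_piece t i (x - y)\<bar> \<partial>M) \<le> B i" for x
        using M.integral_abs_sphere_piece_le[of t i x] by (simp add: B_def s_def d_def)
      fix g :: "real ^ 3 \<Rightarrow> real"
      assume g: "g \<in> borel_measurable M" "integrable M (\<lambda>y. (g y)\<^sup>2)"
      have "(\<integral>\<^sup>+x. ennreal ((\<integral>y. sphere_piece t i (x - y) * g y \<partial>M)\<^sup>2) \<partial>N)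
        \<le> ennreal ((\<Lambda> * d i * sqrt (2 * pi) ^ 3)\<^sup>2 * (256 * C * (d i / sqrt 2) powr (a - 3)) * (256 * D * (d i / sqrt 2) powr (b - 3)))
          * (\<integral>\<^sup>+y. ennreal ((g y)\<^sup>2) \<partial>M)"
        by (rule multiplier_L2_bound[OF FM FN _ _ m(1) _ m(3)]) (use m(2)[of i] d[of i] \<Lambda> g in \<open>auto simp: d_def\<close>)
      then show "(\<integral>\<^sup>+x. ennreal ((\<integral>y. sphere_piece t i (x - y) * g y \<partial>M)\<^sup>2) \<partial>N) \<le> ennreal (A i) * (\<integral>\<^sup>+y. ennreal ((g y)\<^sup>2) \<partial>M)"
        by (simp only: A_def \<kappa>_def)
    qed (use A0 B0 p f f0 fp in auto)
    have sum: "(\<Sum>i\<le>n. h i x) = (\<integral>y. sphere_heat t (1 / 2 ^ n) (x - y) * f y \<partial>M)" for x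
    proof -
      have "(\<Sum>i\<le>n. h i x) = (\<integral>y. (\<Sum>i\<le>n. sphere_piece t i (x - y) * f y) \<partial>M)"
        unfolding h_def by (rule Bochner_Integration.integral_sum[symmetric]) (rule int)
      then show ?thesis by (simp only: sum_distrib_right[symmetric] sum_sphere_piece)
    qed
    have nn: "0 \<le> (\<integral>y. sphere_heat t (1 / 2 ^ n) (x - y) * f y \<partial>M)" for x
      using f0 by (intro integral_nonneg_AE) (auto intro!: AE_I2 mult_nonneg_nonneg sphere_heat_nonneg)
    have "(\<integral>\<^sup>+x. ennreal (\<bar>\<Sum>i\<le>n. h i x\<bar> powr p) \<partial>N) \<le> ennreal (c * (1 - \<beta>) powr (- p)) * (\<integral>\<^sup>+y. ennreal (f y powr p) \<partial>M)"
      by (rule nn_integral_powr_sum_le[OF _ \<beta> _ hm piece]) (use p c in auto)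
    then show "(\<integral>\<^sup>+x. ennreal ((\<integral>y. sphere_heat t (1 / 2 ^ n) (x - y) * f y \<partial>M) powr p) \<partial>N)
        \<le> ennreal (c * (1 - \<beta>) powr (- p)) * (\<integral>\<^sup>+y. ennreal (f y powr p) \<partial>M)"
      using nn by (simp add: sum)
  qed
qed

lemma sphere_heat_Lp_bound:
  assumes FM: "frostman M a C" and FN: "frostman N b D" and t: "0 < t"
    and cond: "2 \<le> p \<and> 3 - 2 / p < a * (1 - 1 / p) + b / p \<or>
      1 \<le> p \<and> p \<le> 2 \<and> 1 + 2 / p < a * (1 - 1 / p) + b / p"
  obtains C' where "0 < C'"
    "\<And>n f. f \<in> borel_measurable M \<Longrightarrow> (\<And>y. 0 \<le> f y) \<Longrightarrow> integrable M (\<lambda>y. f y powr p) \<Longrightarrow>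
      (\<integral>\<^sup>+x. ennreal ((\<integral>y. sphere_heat t (1 / 2 ^ n) (x - y) * f y \<partial>M) powr p) \<partial>N)
        \<le> ennreal C' * (\<integral>\<^sup>+y. ennreal (f y powr p) \<partial>M)"
proof (cases "2 \<le> p")
  case True
  \<comment> \<open>At p = 2 the two alternatives of \<open>cond\<close> coincide: both left-hand
    sides equal 2.\<close>
  then have "3 - 2 / p < a * (1 - 1 / p) + b / p" using cond by (cases "p = 2") auto
  from sphere_heat_Lp_bound_ge_2[OF FM FN t True this] that show thesis by blast
next
  case False
  interpret M: frostman M a C by fact
  interpret N: frostman N b D by fact
  note M.sets_M[measurable_cong] N.sets_M[measurable_cong]
  have p: "1 \<le> p" "p < 2" and cond': "1 + 2 / p < a * (1 - 1 / p) + b / p" using False cond by auto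
  have "p \<noteq> 1" using cond' N.a_le by auto
  with p have p1: "1 < p" by simp
  define q where "q = p / (p - 1)"
  have q: "1 / q = 1 - 1 / p" "2 \<le> q" using p p1 by (auto simp: q_def field_simps)
  \<comment> \<open>Passing to the conjugate exponent and exchanging \<open>a\<close> with
    \<open>b\<close> carries the lower-range condition exactly into the upper-range one.\<close>
  have "3 - 2 / q = 1 + 2 / p" "b * (1 - 1 / q) + a / q = a * (1 - 1 / p) + b / p"
  proof -
    have "2 / q = 2 * (1 / q)" "a / q = a * (1 / q)" by simp_all
    then show "3 - 2 / q = 1 + 2 / p" "b * (1 - 1 / q) + a / q = a * (1 - 1 / p) + b / p"
      unfolding q(1) by (simp_all add: algebra_simps)
  qed
  with cond' have cq: "3 - 2 / q < b * (1 - 1 / q) + a / q" by simp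
  obtain C' where C': "0 < C'"
    "\<And>n g. g \<in> borel_measurable N \<Longrightarrow> (\<And>y. 0 \<le> g y) \<Longrightarrow> integrable N (\<lambda>y. g y powr q) \<Longrightarrow>
      (\<integral>\<^sup>+x. ennreal ((\<integral>y. sphere_heat t (1 / 2 ^ n) (x - y) * g y \<partial>N) powr q) \<partial>M)
        \<le> ennreal C' * (\<integral>\<^sup>+y. ennreal (g y powr q) \<partial>N)"
    using sphere_heat_Lp_bound_ge_2[OF FN FM t q(2) cq] by blast
  show thesis
  proof (rule that)
    show "0 < C' powr (p / q)" using C' by simp
    fix n and f :: "real ^ 3 \<Rightarrow> real"
    assume f: "f \<in> borel_measurable M" "\<And>y. 0 \<le> f y" "integrable M (\<lambda>y. f y powr p)"
    show "(\<integral>\<^sup>+x. ennreal ((\<integral>y. sphere_heat t (1 / 2 ^ n) (x - y) * f y \<partial>M) powr p) \<partial>N)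
        \<le> ennreal (C' powr (p / q)) * (\<integral>\<^sup>+y. ennreal (f y powr p) \<partial>M)"
    proof (rule kernel_duality[OF _ _ _ _ _ p1 _ C'(1) _ f])
      show "finite_measure M" "finite_measure N"
        by (rule M.finite_measure_axioms N.finite_measure_axioms)+
      show "(\<lambda>(x, y). sphere_heat t (1 / 2 ^ n) (x - y)) \<in> borel_measurable (N \<Otimes>\<^sub>M M)" by measurable
      show "0 \<le> sphere_heat t (1 / 2 ^ n) (x - y)" for x y by (simp add: sphere_heat_nonneg)
      show "sphere_heat t (1 / 2 ^ n) (x - y) \<le> measure sphere_measure UNIV / (1 / 2 ^ n) ^ 3" for x y
        by (rule sphere_heat_le) simp
      show "1 / p + 1 / q = 1" using q by simp
      fix g :: "real ^ 3 \<Rightarrow> real"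
      assume g: "g \<in> borel_measurable N" "\<And>x. 0 \<le> g x" "integrable N (\<lambda>x. g x powr q)"
      have "sphere_heat t (1 / 2 ^ n) (x - y) = sphere_heat t (1 / 2 ^ n) (y - x)" for x y
        using sphere_heat_uminus[of t "1 / 2 ^ n" "x - y"] by simp
      then show "(\<integral>\<^sup>+y. ennreal ((\<integral>x. sphere_heat t (1 / 2 ^ n) (x - y) * g x \<partial>N) powr q) \<partial>M)
        \<le> ennreal C' * (\<integral>\<^sup>+x. ennreal (g x powr q) \<partial>N)"
        using C'(2)[OF g] by simp
    qed
  qed
qed

section \<open>The solution operator\<close>

text \<open>A bounded function of compact support lies below a multiple of a Gaussian. Rounding
  \<epsilon> up to a dyadic \<delta> \<le> 2\<epsilon> widens the Gaussian, which is harmless, and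
  changes its height by a factor of at most 8.\<close>

lemma radial_mollifier_le_heat:
  assumes "radial_mollifier \<rho>"
  obtains c where "0 < c"
    "\<And>\<epsilon>. 0 < \<epsilon> \<Longrightarrow> \<epsilon> < 1 \<Longrightarrow> \<exists>n. \<forall>w. rescale \<rho> \<epsilon> w \<le> c * heat (1 / 2 ^ n) w"
proof -
  have "Ck 0 \<rho>" and cs: "compact (closure {x. \<rho> x \<noteq> 0})"
    using assms unfolding radial_mollifier_def by blast+
  then have cont: "continuous_on UNIV \<rho>" by simp
  let ?K = "closure {x. \<rho> x \<noteq> 0}"
  have "bounded (\<rho> ` ?K)"
    using cs cont by (intro compact_imp_bounded compact_continuous_image) (auto intro: continuous_on_subset)
  then obtain R where R: "R > 0" "\<And>x. x \<in> ?K \<Longrightarrow> \<bar>\<rho> x\<bar> \<le> R"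
    unfolding bounded_pos by auto
  obtain r where r: "r > 0" "\<And>x. x \<in> ?K \<Longrightarrow> norm x \<le> r"
    using compact_imp_bounded[OF cs] unfolding bounded_pos by auto
  \<comment> \<open>This makes the Gaussian at least \<open>R\<close> on the ball of radius
    \<open>r\<close>, which contains the support.\<close>
  define c where "c = R * exp (r\<^sup>2 / 2)"
  have c: "0 < c" using R by (simp add: c_def)
  have rho: "\<rho> x \<le> c * exp (- (norm x)\<^sup>2 / 2)" for x
  proof (cases "\<rho> x = 0")
    case True
    then show ?thesis using c by simp
  next
    case False
    then have x: "x \<in> ?K" using closure_subset[of "{x. \<rho> x \<noteq> 0}"] by auto
    have "(norm x)\<^sup>2 \<le> r\<^sup>2" using r(2)[OF x] by (intro power_mono) auto
    then have "1 \<le> exp (r\<^sup>2 / 2) * exp (- (norm x)\<^sup>2 / 2)" by (simp flip: exp_add)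
    then have "R * 1 \<le> R * (exp (r\<^sup>2 / 2) * exp (- (norm x)\<^sup>2 / 2))" using R by (intro mult_left_mono) auto
    then show ?thesis using R(2)[OF x] by (simp add: c_def)
  qed
  show thesis
  proof (rule that[of "8 * c"])
    show "0 < 8 * c" using c by simp
    fix \<epsilon> :: real assume \<epsilon>: "0 < \<epsilon>" "\<epsilon> < 1"
    \<comment> \<open>The least index satisfying this is positive because \<epsilon> < 1; its
      predecessor \<open>n\<close> gives \<epsilon> \<le> 2^(-n) \<le> 2\<epsilon>.\<close>
    define P where "P n \<longleftrightarrow> 1 / 2 ^ n < \<epsilon>" for n :: nat
    have "\<exists>n. P n"
      using real_arch_pow_inv[of \<epsilon> "1 / 2"] \<epsilon> by (auto simp: P_def power_one_over)
    then have Pl: "P (LEAST n. P n)" by (rule LeastI_ex)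
    moreover have "\<not> P 0" using \<epsilon> by (simp add: P_def)
    ultimately obtain n where n: "(LEAST n. P n) = Suc n" by (cases "LEAST n. P n") auto
    then have nP: "\<not> P n" using not_less_Least[of n P] by simp
    have PS: "P (Suc n)" using Pl n by simp
    define \<delta> where "\<delta> = (1 / 2 ^ n :: real)"
    have \<delta>: "\<epsilon> \<le> \<delta>" "\<delta> \<le> 2 * \<epsilon>" "0 < \<delta>"
      using PS nP unfolding P_def \<delta>_def by (auto simp: field_simps)
    have "rescale \<rho> \<epsilon> w \<le> 8 * c * heat \<delta> w" for w
    proof -
      have "\<delta> ^ 3 \<le> (2 * \<epsilon>) ^ 3" using \<delta> by (intro power_mono) auto
      then have inv: "1 / \<epsilon> ^ 3 \<le> 8 / \<delta> ^ 3" using \<delta> \<epsilon> by (simp add: field_simps power_mult_distrib)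
      have "(norm w)\<^sup>2 / (2 * \<delta>\<^sup>2) \<le> (norm w)\<^sup>2 / (2 * \<epsilon>\<^sup>2)"
        using \<delta> \<epsilon> by (intro divide_left_mono mult_left_mono power_mono) auto
      moreover have "(norm (w /\<^sub>R \<epsilon>))\<^sup>2 / 2 = (norm w)\<^sup>2 / (2 * \<epsilon>\<^sup>2)"
      proof -
        have "norm (w /\<^sub>R \<epsilon>) = norm w / \<epsilon>" using \<epsilon> by (simp add: divide_inverse)
        then show ?thesis by (simp add: power_divide)
      qed
      ultimately have exp: "exp (- (norm (w /\<^sub>R \<epsilon>))\<^sup>2 / 2) \<le> exp (- (norm w)\<^sup>2 / (2 * \<delta>\<^sup>2))"
        by simp
      have "rescale \<rho> \<epsilon> w = \<rho> (w /\<^sub>R \<epsilon>) * (1 / \<epsilon> ^ 3)" by (simp add: rescale_def)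
      also have "\<dots> \<le> (c * exp (- (norm w)\<^sup>2 / (2 * \<delta>\<^sup>2))) * (8 / \<delta> ^ 3)"
      proof (rule mult_mono)
        show "\<rho> (w /\<^sub>R \<epsilon>) \<le> c * exp (- (norm w)\<^sup>2 / (2 * \<delta>\<^sup>2))"
          using rho[of "w /\<^sub>R \<epsilon>"] mult_left_mono[OF exp, of c] c by linarith
      qed (use inv c \<epsilon> in auto)
      also have "\<dots> = 8 * c * heat \<delta> w" by (simp add: heat_def)
      finally show ?thesis .
    qed
    then show "\<exists>n. \<forall>w. rescale \<rho> \<epsilon> w \<le> 8 * c * heat (1 / 2 ^ n) w" unfolding \<delta>_def by blast
  qed
qed

text \<open>The mollified solution is dominated pointwise by \<open>L\<close> times the Gaussian
  operator applied to |f|, where \<open>L\<close> combines Kirchhoff's factor t / (4 pi) with the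
  constant of the domination. The p-th root of \<open>C'\<close> then gives \<open>CC\<close>, which
  depends on neither \<epsilon> nor \<open>f\<close>.\<close>

lemma wave_Lp_bound_of_sphere_heat:
  assumes \<rho>: "radial_mollifier \<rho>" and FM: "frostman \<mu> a C" and FN: "frostman \<nu> b D"
    and t: "0 < t" and p: "1 \<le> p" and C': "0 < C'"
    "\<And>n f. f \<in> borel_measurable \<mu> \<Longrightarrow> (\<And>y. 0 \<le> f y) \<Longrightarrow> integrable \<mu> (\<lambda>y. f y powr p) \<Longrightarrow>
      (\<integral>\<^sup>+x. ennreal ((\<integral>y. sphere_heat t (1 / 2 ^ n) (x - y) * f y \<partial>\<mu>) powr p) \<partial>\<nu>)
        \<le> ennreal C' * (\<integral>\<^sup>+y. ennreal (f y powr p) \<partial>\<mu>)"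
  shows "\<exists>C>0. wave_Lp_bound \<rho> \<mu> \<nu> t p C"
proof -
  interpret M: frostman \<mu> a C by fact
  interpret N: frostman \<nu> b D by fact
  interpret S: finite_measure "sphere_measure_dil t" by (rule finite_measure_sphere_measure_dil)
  note M.sets_M[measurable_cong] N.sets_M[measurable_cong]
  obtain c where c: "0 < c"
    "\<And>\<epsilon>. 0 < \<epsilon> \<Longrightarrow> \<epsilon> < 1 \<Longrightarrow> \<exists>n. \<forall>w. rescale \<rho> \<epsilon> w \<le> c * heat (1 / 2 ^ n) w"
    using radial_mollifier_le_heat[OF \<rho>] by blast
  have "Ck 0 \<rho>" and \<rho>0: "\<And>x. 0 \<le> \<rho> x" using \<rho> unfolding radial_mollifier_def by blast+
  then have [measurable]: "\<rho> \<in> borel_measurable borel" by (simp add: borel_measurable_continuous_onI)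
  define L where "L = t / (4 * pi) * c"
  have L: "0 < L" using t c by (simp add: L_def)
  define CC where "CC = L * C' powr (1 / p)"
  have CC: "0 < CC" using L C' by (simp add: CC_def)
  have "wave_Lp_bound \<rho> \<mu> \<nu> t p CC"
    unfolding wave_Lp_bound_def
  proof (intro allI impI, elim conjE)
    fix f :: "real ^ 3 \<Rightarrow> complex" and \<epsilon> :: real
    assume "in_Lp p \<mu> f" and \<epsilon>: "0 < \<epsilon>" "\<epsilon> < 1"
    then have f[measurable]: "f \<in> borel_measurable \<mu>" and fp: "integrable \<mu> (\<lambda>y. norm (f y) powr p)"
      by (auto simp: in_Lp_def)
    have f1: "integrable \<mu> (\<lambda>y. norm (f y))"
      by (rule M.integrable_of_powr_integrable[OF _ _ p fp]) auto
    obtain n where n: "\<And>w. rescale \<rho> \<epsilon> w \<le> c * heat (1 / 2 ^ n) w" using c(2)[OF \<epsilon>] by blast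
    define \<delta> where "\<delta> = (1 / 2 ^ n :: real)"
    have \<delta>: "0 < \<delta>" by (simp add: \<delta>_def)
    define r where "r = rescale \<rho> \<epsilon>"
    have r0: "0 \<le> r w" for w using \<rho>0 \<epsilon> by (simp add: r_def rescale_def)
    have [measurable]: "r \<in> borel_measurable borel" unfolding r_def rescale_def[abs_def] by measurable
    define u where "u = mollify r (wave_solution \<mu> f t)"
    have u: "u x = of_real (t / (4 * pi)) * (\<integral>y. (\<integral>z. of_real (r (x - (y + z))) \<partial>sphere_measure_dil t) * f y \<partial>\<mu>)" for x
      by (simp add: u_def mollify_def wave_solution_def conv_cmeasure_def density_cmeasure_def)
    have um: "u \<in> borel_measurable \<nu>"
    proof -
      have "(\<lambda>(x, y). \<integral>z. complex_of_real (r (x - (y + z))) \<partial>sphere_measure_dil t) \<in> borel_measurable (\<nu> \<Otimes>\<^sub>M \<mu>)"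
        unfolding case_prod_beta' by (intro S.borel_measurable_lebesgue_integral) measurable
      then have [measurable]: "(\<lambda>w. \<integral>z. complex_of_real (r (fst w - (snd w + z))) \<partial>sphere_measure_dil t) \<in> borel_measurable (\<nu> \<Otimes>\<^sub>M \<mu>)"
        by (simp add: case_prod_beta')
      have "(\<lambda>x. \<integral>y. (\<integral>z. complex_of_real (r (x - (y + z))) \<partial>sphere_measure_dil t) * f y \<partial>\<mu>) \<in> borel_measurable \<nu>"
        by (intro M.borel_measurable_lebesgue_integral) (simp add: case_prod_beta')
      then show ?thesis unfolding u[abs_def] by measurable
    qed
    define T where "T x = (\<integral>y. sphere_heat t \<delta> (x - y) * norm (f y) \<partial>\<mu>)" for x
    have T0: "0 \<le> T x" for x unfolding T_def
      using \<delta> by (intro integral_nonneg_AE) (auto intro!: AE_I2 mult_nonneg_nonneg sphere_heat_nonneg)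
    have uT: "norm (u x) \<le> L * T x" for x
    proof -
      have inner: "norm (\<integral>z. complex_of_real (r (x - (y + z))) \<partial>sphere_measure_dil t) \<le> c * sphere_heat t \<delta> (x - y)" for y
      proof -
        have "norm (\<integral>z. complex_of_real (r (x - (y + z))) \<partial>sphere_measure_dil t)
          \<le> (\<integral>z. norm (complex_of_real (r (x - (y + z)))) \<partial>sphere_measure_dil t)"
          by (rule integral_norm_bound)
        also have "\<dots> \<le> (\<integral>z. c * heat \<delta> (x - y - z) \<partial>sphere_measure_dil t)"
        proof (rule integral_mono')
          show "norm (complex_of_real (r (x - (y + z)))) \<le> c * heat \<delta> (x - y - z)" for z
            using n[of "x - (y + z)"] r0[of "x - (y + z)"] by (simp add: r_def \<delta>_def algebra_simps)
          show "0 \<le> c * heat \<delta> (x - y - z)" for z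
            using c(1) heat_nonneg[OF \<delta>] by (intro mult_nonneg_nonneg) auto
        qed (intro integrable_mult_right integrable_sphere_heat \<delta>)
        finally show ?thesis by (simp add: sphere_heat_def)
      qed
      have "norm (\<integral>y. (\<integral>z. complex_of_real (r (x - (y + z))) \<partial>sphere_measure_dil t) * f y \<partial>\<mu>)
        \<le> (\<integral>y. norm ((\<integral>z. complex_of_real (r (x - (y + z))) \<partial>sphere_measure_dil t) * f y) \<partial>\<mu>)"
        by (rule integral_norm_bound)
      also have "\<dots> \<le> (\<integral>y. c * (sphere_heat t \<delta> (x - y) * norm (f y)) \<partial>\<mu>)"
      proof (rule integral_mono')
        have "integrable \<mu> (\<lambda>y. sphere_heat t \<delta> (x - y) * norm (f y))"
        proof (rule integrable_real_bound)
          show "integrable \<mu> (\<lambda>y. measure sphere_measure UNIV / \<delta> ^ 3 * norm (f y))" using f1 by simp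
          show "\<bar>sphere_heat t \<delta> (x - y) * norm (f y)\<bar> \<le> measure sphere_measure UNIV / \<delta> ^ 3 * norm (f y)" for y
            using sphere_heat_le[OF \<delta>, of t "x - y"] sphere_heat_nonneg[OF \<delta>, of t "x - y"]
            unfolding abs_mult by (intro mult_mono) auto
        qed measurable
        then show "integrable \<mu> (\<lambda>y. c * (sphere_heat t \<delta> (x - y) * norm (f y)))" by simp
        show "norm ((\<integral>z. complex_of_real (r (x - (y + z))) \<partial>sphere_measure_dil t) * f y)
          \<le> c * (sphere_heat t \<delta> (x - y) * norm (f y))" for y
          using mult_right_mono[OF inner[of y], of "norm (f y)"] by (simp add: norm_mult)
        show "0 \<le> c * (sphere_heat t \<delta> (x - y) * norm (f y))" for y
          using c sphere_heat_nonneg[OF \<delta>] by (intro mult_nonneg_nonneg) auto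
      qed
      also have "\<dots> = c * T x" by (simp add: T_def)
      finally have "t / (4 * pi) * norm (\<integral>y. (\<integral>z. complex_of_real (r (x - (y + z))) \<partial>sphere_measure_dil t) * f y \<partial>\<mu>)
        \<le> t / (4 * pi) * (c * T x)" using t by (intro mult_left_mono) auto
      moreover have "norm (u x) = t / (4 * pi) * norm (\<integral>y. (\<integral>z. complex_of_real (r (x - (y + z))) \<partial>sphere_measure_dil t) * f y \<partial>\<mu>)"
        unfolding u norm_mult norm_of_real using t by simp
      ultimately show ?thesis by (simp add: L_def)
    qed
    define F where "F = (\<integral>y. norm (f y) powr p \<partial>\<mu>)"
    have F: "(\<integral>\<^sup>+y. ennreal (norm (f y) powr p) \<partial>\<mu>) = ennreal F" "0 \<le> F"
      unfolding F_def using fp by (auto intro!: nn_integral_eq_integral)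
    have Tm[measurable]: "T \<in> borel_measurable \<nu>"
      unfolding T_def[abs_def] by (intro M.borel_measurable_lebesgue_integral) measurable
    have "(\<integral>\<^sup>+x. ennreal (norm (u x) powr p) \<partial>\<nu>) \<le> (\<integral>\<^sup>+x. ennreal (L powr p) * ennreal (T x powr p) \<partial>\<nu>)"
    proof (intro nn_integral_mono)
      fix x
      have "norm (u x) powr p \<le> (L * T x) powr p" using uT p by (intro powr_mono2) auto
      also have "\<dots> = L powr p * T x powr p" using L T0 by (simp add: powr_mult)
      finally show "ennreal (norm (u x) powr p) \<le> ennreal (L powr p) * ennreal (T x powr p)"
        by (simp add: ennreal_leI flip: ennreal_mult)
    qed
    also have "\<dots> = ennreal (L powr p) * (\<integral>\<^sup>+x. ennreal (T x powr p) \<partial>\<nu>)"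
      by (rule nn_integral_cmult) measurable
    also have "\<dots> \<le> ennreal (L powr p) * (ennreal C' * ennreal F)"
      unfolding F(1)[symmetric] T_def \<delta>_def using fp by (intro mult_left_mono C'(2)) auto
    also have "\<dots> = ennreal (L powr p * C' * F)" using C'(1) F(2) by (simp add: ennreal_mult mult.assoc)
    finally have main: "(\<integral>\<^sup>+x. ennreal (norm (u x) powr p) \<partial>\<nu>) \<le> ennreal (L powr p * C' * F)" .
    \<comment> \<open>Finiteness of the bound just proved supplies the membership half of the
      claim.\<close>
    have up: "integrable \<nu> (\<lambda>x. norm (u x) powr p)"
    proof (rule integrableI_bounded)
      show "(\<integral>\<^sup>+x. ennreal (norm (norm (u x) powr p)) \<partial>\<nu>) < \<infinity>"
        using main by (simp add: order_le_less_trans)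
    qed (use um in measurable)
    have "ennreal (\<integral>x. norm (u x) powr p \<partial>\<nu>) \<le> ennreal (L powr p * C' * F)"
      using main up by (subst nn_integral_eq_integral[symmetric]) auto
    then have "(\<integral>x. norm (u x) powr p \<partial>\<nu>) \<le> L powr p * C' * F"
      using C'(1) F(2) by (subst (asm) ennreal_le_iff) auto
    then have "Lp_norm p \<nu> u \<le> (L powr p * C' * F) powr (1 / p)"
      unfolding Lp_norm_def using p by (intro powr_mono2) auto
    also have "\<dots> = CC * Lp_norm p \<mu> f"
      using L C'(1) F(2) p by (simp add: CC_def Lp_norm_def powr_mult powr_powr F_def)
    finally show "in_Lp p \<nu> (mollify (rescale \<rho> \<epsilon>) (wave_solution \<mu> f t)) \<and>
        Lp_norm p \<nu> (mollify (rescale \<rho> \<epsilon>) (wave_solution \<mu> f t)) \<le> CC * Lp_norm p \<mu> f"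
      using um up by (simp add: in_Lp_def u_def r_def)
  qed
  with CC show ?thesis by blast
qed

text \<open>Up to a null set the support lies in one ball, so the growth condition itself gives
  finite total mass. The maximum with 1 ensures a positive constant, since the sign of
  \<open>C\<close> is not prescribed.\<close>

lemma frostmanI:
  assumes "compactly_supported_borel M" "0 < a" "a \<le> 3"
    and ball: "\<And>x r. 0 < r \<Longrightarrow> emeasure M (ball x r) \<le> ennreal (C * r powr a)"
  shows "frostman M a (max C 1)"
proof -
  obtain K where sM: "sets M = sets borel" and K: "compact K" "emeasure M (- K) = 0"
    using assms(1) by (auto simp: compactly_supported_borel_def)
  have sp: "space M = UNIV" using sets_eq_imp_space_eq[OF sM] by simp
  obtain r where r: "0 < r" "K \<subseteq> ball 0 r"
    using bounded_subset_ballD[OF compact_imp_bounded[OF K(1)], of 0] by auto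
  have "emeasure M UNIV \<le> emeasure M (ball 0 r \<union> - K)" 
    using r sM borel_compact[OF K(1)] by (intro emeasure_mono) (auto intro: borel_comp)
  also have "\<dots> \<le> emeasure M (ball 0 r) + emeasure M (- K)"
    using sM borel_compact[OF K(1)] by (intro emeasure_subadditive) (auto intro: borel_comp)
  also have "\<dots> < top" using ball[OF r(1), of 0] K by (simp add: order_le_less_trans)
  finally have fin: "emeasure M (space M) \<noteq> \<infinity>" unfolding sp by simp
  show ?thesis
  proof (intro frostman.intro frostman_axioms.intro)
    show "finite_measure M" using fin by (rule finite_measureI)
    fix x :: "real ^ 3" and r :: real assume r: "0 < r"
    have "C * r powr a \<le> max C 1 * r powr a" by (intro mult_right_mono) auto
    then show "emeasure M (ball x r) \<le> ennreal (max C 1 * r powr a)"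
      using ball[OF r, of x] ennreal_leI order_trans by blast
  qed (use assms sM in auto)
qed

theorem theorem4p1:
  fixes \<mu> \<nu> :: "(real ^ 3) measure" and s\<^sub>\<mu> s\<^sub>\<nu> C\<^sub>1 :: real and \<rho> :: "real ^ 3 \<Rightarrow> real"
  assumes "compactly_supported_borel \<mu>" and "compactly_supported_borel \<nu>"
    and "0 < s\<^sub>\<mu>" "s\<^sub>\<mu> \<le> 3" and "0 < s\<^sub>\<nu>" "s\<^sub>\<nu> \<le> 3"
    and "\<And>x r. 0 < r \<Longrightarrow> emeasure \<mu> (ball x r) \<le> ennreal (C\<^sub>1 * r powr s\<^sub>\<mu>)"
    and "\<And>x r. 0 < r \<Longrightarrow> emeasure \<nu> (ball x r) \<le> ennreal (C\<^sub>1 * r powr s\<^sub>\<nu>)"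
    and "radial_mollifier \<rho>"
  shows "\<forall>t>0.
      (s\<^sub>\<mu> + s\<^sub>\<nu> > 4 \<longrightarrow> (\<exists>C>0. wave_Lp_bound \<rho> \<mu> \<nu> t 2 C)) \<and>
      (\<forall>p. 2 \<le> p \<and> s\<^sub>\<mu> * conj_recip p + s\<^sub>\<nu> / p > 3 - 2 / p \<longrightarrow>
         (\<exists>C>0. wave_Lp_bound \<rho> \<mu> \<nu> t p C)) \<and>
      (\<forall>p. 1 \<le> p \<and> p \<le> 2 \<and> s\<^sub>\<mu> * conj_recip p + s\<^sub>\<nu> / p > 1 + 2 / p \<longrightarrow>
         (\<exists>C>0. wave_Lp_bound \<rho> \<mu> \<nu> t p C))"
proof -
  have FM: "frostman \<mu> s\<^sub>\<mu> (max C\<^sub>1 1)" and FN: "frostman \<nu> s\<^sub>\<nu> (max C\<^sub>1 1)"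
    using assms by (auto intro!: frostmanI)
  have bound: "\<exists>C>0. wave_Lp_bound \<rho> \<mu> \<nu> t p C"
    if "0 < t" and cond: "2 \<le> p \<and> 3 - 2 / p < s\<^sub>\<mu> * (1 - 1 / p) + s\<^sub>\<nu> / p \<or>
      1 \<le> p \<and> p \<le> 2 \<and> 1 + 2 / p < s\<^sub>\<mu> * (1 - 1 / p) + s\<^sub>\<nu> / p" for t p
  proof -
    have "1 \<le> p" using cond by auto
    show ?thesis
    proof (rule sphere_heat_Lp_bound[OF FM FN that])
      fix C'
      assume "0 < C'"
        "\<And>n f. f \<in> borel_measurable \<mu> \<Longrightarrow> (\<And>y. 0 \<le> f y) \<Longrightarrow> integrable \<mu> (\<lambda>y. f y powr p) \<Longrightarrow>
          (\<integral>\<^sup>+x. ennreal ((\<integral>y. sphere_heat t (1 / 2 ^ n) (x - y) * f y \<partial>\<mu>) powr p) \<partial>\<nu>)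
            \<le> ennreal C' * (\<integral>\<^sup>+y. ennreal (f y powr p) \<partial>\<mu>)"
      then show ?thesis
        by (rule wave_Lp_bound_of_sphere_heat[OF assms(9) FM FN \<open>0 < t\<close> \<open>1 \<le> p\<close>])
    qed
  qed
  show ?thesis
    unfolding conj_recip_def
  proof (intro allI conjI impI)
    fix t :: real assume t: "0 < t"
    \<comment> \<open>The case p = 2 of the upper range: half the sum of the exponents must exceed 3
      - 1 = 2.\<close>
    show "\<exists>C>0. wave_Lp_bound \<rho> \<mu> \<nu> t 2 C" if "4 < s\<^sub>\<mu> + s\<^sub>\<nu>"
      by (rule bound[OF t]) (use that in simp)
    show "\<exists>C>0. wave_Lp_bound \<rho> \<mu> \<nu> t p C"
      if "2 \<le> p \<and> 3 - 2 / p < s\<^sub>\<mu> * (1 - 1 / p) + s\<^sub>\<nu> / p" for p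
      by (rule bound[OF t]) (use that in blast)
    show "\<exists>C>0. wave_Lp_bound \<rho> \<mu> \<nu> t p C"
      if "1 \<le> p \<and> p \<le> 2 \<and> 1 + 2 / p < s\<^sub>\<mu> * (1 - 1 / p) + s\<^sub>\<nu> / p" for p
      by (rule bound[OF t]) (use that in blast)
  qed
qed

end
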